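(* Let $\Sigma=\{\sigma_1,\ldots,\sigma_n\}$ be a semigroup of maps on $\{1,\ldots,N\}$, let $V$ be a finite dimensional real vector space, let $f\in C^\infty(V^n,V)$ and assume that $f(0)=0$. Taylor expand $f$ as $f=f_0+f_1+f_2+\ldots$ with $f_k\in P^k$. Let $1\le r<\infty$ and for every $1\le k\le r$ let $N^k\subset P^k$ be a subspace such that $$N^k\oplus\operatorname{im}\,\mathrm{ad}^\Sigma_{f_0}\big|_{P^k}=P^k.$$ Then there exists an analytic diffeomorphism $\Phi$, sending an open neighborhood of $0$ in $V^N$ to an open neighborhood of $0$ in $V^N$, that conjugates the coupled cell network vector field $\gamma_f$ to a coupled cell network vector field $\gamma_{\overline f}$ with $$\overline f=f_0+\overline f_1+\overline f_2+\ldots\quad\text{and}\quad \overline f_k\in N^k\ \text{for all } 1\le k\le r.$$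
   Context: $N,n\ge 1$ are integers and $\Sigma=\{\sigma_1,\ldots,\sigma_n\}$ is a collection of $n$ distinct maps $\sigma_j:\{1,\ldots,N\}\to\{1,\ldots,N\}$. $\Sigma$ is called a semigroup if for all $1\le j_1,j_2\le n$ there is a unique $1\le j_3\le n$ with $\sigma_{j_1}\circ\sigma_{j_2}=\sigma_{j_3}$. In that case $\widetilde\sigma_j:\{1,\ldots,n\}\to\{1,\ldots,n\}$ is determined by $\sigma_{\widetilde\sigma_j(k)}=\sigma_j\circ\sigma_k$, and $A_{\sigma_j}:V^n\to V^n$ is the linear map $A_{\sigma_j}(X_1,\ldots,X_n)=(X_{\widetilde\sigma_1(j)},\ldots,X_{\widetilde\sigma_n(j)})$. For $f\in C^\infty(V^n,V)$ the coupled cell network vector field $\gamma_f:V^N\to V^N$ is $(\gamma_f)_i(x)=f(x_{\sigma_1(i)},\ldots,x_{\sigma_n(i)})$, $1\le i\le N$. With $D_j$ the partial derivative with respect to the $j$-th argument in $V$, set $$[f,g]_\Sigma=\sum_{j=1}^n D_jf\cdot(g\circ A_{\sigma_j})-D_jg\cdot(f\circ A_{\sigma_j}),\qquad \mathrm{ad}^\Sigma_f(g)=[f,g]_\Sigma.$$ $P^k$ denotes the space of homogeneous polynomial maps $V^n\to V$ of degree $k+1$; for $f_0\in P^0$ (linear) one has $\mathrm{ad}^\Sigma_{f_0}:P^k\to P^k$. The expansions $f=f_0+f_1+\ldots$ and $\overline f=f_0+\overline f_1+\ldots$ denote Taylor expansions at $0$ with $f_k,\overline f_k\in P^k$. That $\Phi$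 conjugates $\gamma_f$ to $\gamma_{\overline f}$ means that the pushforward $\Phi_*\gamma_f$ equals $\gamma_{\overline f}$ on the respective neighborhoods. *)

theory Defs
  imports "HOL-Analysis.Analysis" "HOL-Library.Function_Algebras"
begin

text \<open>Throughout, the finite type \<open>'c\<close> plays the role of \<open>{1,\<dots>,N}\<close> (the cells), the finite type
  \<open>'n\<close> that of the index set \<open>{1,\<dots>,n}\<close> of \<open>\<Sigma>\<close>, and \<open>'v\<close> is the space \<open>V\<close>, so that
  \<open>V\<^sup>N\<close> and \<open>V\<^sup>n\<close> are \<open>'v ^ 'c\<close> and \<open>'v ^ 'n\<close>.\<close>

subsection \<open>Pointwise vector space structure on functions\<close>

instantiation "fun" :: (type, real_vector) real_vector
begin

definition scaleR_fun :: "real \<Rightarrow> ('a \<Rightarrow> 'b) \<Rightarrow> 'a \<Rightarrow> 'b"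
  where "scaleR_fun c f = (\<lambda>x. c *\<^sub>R f x)"

instance
  by standard (simp_all add: scaleR_fun_def fun_eq_iff scaleR_add_right scaleR_add_left)

end

definition is_direct_sum :: "'a::real_vector set \<Rightarrow> 'a set \<Rightarrow> 'a set \<Rightarrow> bool"
  where "is_direct_sum A B C \<longleftrightarrow> {a + b | a b. a \<in> A \<and> b \<in> B} = C \<and> A \<inter> B = {0}"

subsection \<open>Smooth and real analytic maps\<close>

primrec C_k :: "nat \<Rightarrow> ('a::real_normed_vector \<Rightarrow> 'b::real_normed_vector) \<Rightarrow> bool" where
  "C_k 0 f \<longleftrightarrow> continuous_on UNIV f"
| "C_k (Suc k) f \<longleftrightarrow> (\<forall>x. f differentiable (at x)) \<and>
     (\<forall>v. C_k k (\<lambda>x. frechet_derivative f (at x) v))"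

definition smooth :: "('a::real_normed_vector \<Rightarrow> 'b::real_normed_vector) \<Rightarrow> bool"
  where "smooth f \<longleftrightarrow> (\<forall>k. C_k k f)"

text \<open>Convergent power series in several variables: the multi-indices are the functions
  \<open>\<alpha> : Basis \<rightarrow> \<nat>\<close>. Convergence is unconditional, since multi-indices carry no preferred order.
  Only meant for open \<open>S\<close>, because values of \<open>f\<close> near a point of \<open>S\<close> matter.\<close>

definition real_analytic_on ::
    "('a::euclidean_space \<Rightarrow> 'b::real_normed_vector) \<Rightarrow> 'a set \<Rightarrow> bool"
  where "real_analytic_on f S \<longleftrightarrow>
    (\<forall>a\<in>S. \<exists>c r. r > 0 \<and> (\<forall>x\<in>ball a r.
       ((\<lambda>\<alpha>. (\<Prod>b\<in>Basis. ((x - a) \<bullet> b) ^ \<alpha> b) *\<^sub>R c \<alpha>) has_sum f x)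
         (Basis \<rightarrow>\<^sub>E (UNIV :: nat set))))"

definition analytic_diffeomorphism ::
    "('a::euclidean_space \<Rightarrow> 'b::euclidean_space) \<Rightarrow> 'a set \<Rightarrow> 'b set \<Rightarrow> bool"
  where "analytic_diffeomorphism \<Phi> U W \<longleftrightarrow>
    open U \<and> open W \<and> bij_betw \<Phi> U W \<and>
    real_analytic_on \<Phi> U \<and> real_analytic_on (inv_into U \<Phi>) W"

text \<open>The vector field \<open>\<Phi>\<^sub>* X\<close> on \<open>\<Phi> ` U\<close>, for a diffeomorphism \<open>\<Phi>\<close> with domain \<open>U\<close>.\<close>

definition pushforward ::
    "('a::real_normed_vector \<Rightarrow> 'b::real_normed_vector) \<Rightarrow> 'a set \<Rightarrow> ('a \<Rightarrow> 'a) \<Rightarrow> 'b \<Rightarrow> 'b"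
  where "pushforward \<Phi> U X y =
    frechet_derivative \<Phi> (at (inv_into U \<Phi> y)) (X (inv_into U \<Phi> y))"

subsection \<open>Homogeneous polynomials and Taylor expansion\<close>

text \<open>Note the shift: \<open>P\<^sup>k\<close> has degree \<open>k + 1\<close>.\<close>

definition homogeneous_polys :: "nat \<Rightarrow> ('a::real_normed_vector \<Rightarrow> 'b::real_normed_vector) set"
  where "homogeneous_polys k =
    {p. polynomial_function p \<and> (\<forall>c x. p (c *\<^sub>R x) = c ^ (k + 1) *\<^sub>R p x)}"

text \<open>The term of degree \<open>k + 1\<close> in the Taylor expansion at \<open>0\<close>,
  \<open>f\<^sub>k(x) = D\<^sup>k\<^sup>+\<^sup>1f(0)(x,\<dots>,x) / (k+1)!\<close>, with the derivative
  obtained by differentiating \<open>k + 1\<close> times in the direction \<open>x\<close>.\<close>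

definition taylor_term ::
    "nat \<Rightarrow> ('a::real_normed_vector \<Rightarrow> 'b::real_normed_vector) \<Rightarrow> 'a \<Rightarrow> 'b"
  where "taylor_term k f x =
    (((\<lambda>g y. frechet_derivative g (at y) x) ^^ (k + 1)) f 0) /\<^sub>R fact (k + 1)"

subsection \<open>Semigroups of maps and coupled cell networks\<close>

definition map_semigroup :: "('n \<Rightarrow> 'c \<Rightarrow> 'c) \<Rightarrow> bool"
  where "map_semigroup \<sigma> \<longleftrightarrow>
    inj \<sigma> \<and> (\<forall>j1 j2. \<exists>!j3. \<sigma> j1 \<circ> \<sigma> j2 = \<sigma> j3)"

definition sigma_tilde :: "('n \<Rightarrow> 'c \<Rightarrow> 'c) \<Rightarrow> 'n \<Rightarrow> 'n \<Rightarrow> 'n"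
  where "sigma_tilde \<sigma> j k = (THE l. \<sigma> l = \<sigma> j \<circ> \<sigma> k)"

definition A_map :: "('n::finite \<Rightarrow> 'c \<Rightarrow> 'c) \<Rightarrow> 'n \<Rightarrow> 'v ^ 'n \<Rightarrow> 'v ^ 'n"
  where "A_map \<sigma> j X = (\<chi> k. X $ sigma_tilde \<sigma> k j)"

definition network_field ::
    "('n::finite \<Rightarrow> 'c::finite \<Rightarrow> 'c) \<Rightarrow> ('v ^ 'n \<Rightarrow> 'v) \<Rightarrow> 'v ^ 'c \<Rightarrow> 'v ^ 'c"
  where "network_field \<sigma> f x = (\<chi> i. f (\<chi> j. x $ \<sigma> j i))"

definition partial_derivative ::
    "('v::real_normed_vector ^ 'n::finite \<Rightarrow> 'v) \<Rightarrow> 'n \<Rightarrow> 'v ^ 'n \<Rightarrow> 'v \<Rightarrow> 'v"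
  where "partial_derivative f j X =
    frechet_derivative (\<lambda>y. f (\<chi> k. if k = j then y else X $ k)) (at (X $ j))"

definition Sigma_bracket ::
    "('n::finite \<Rightarrow> 'c \<Rightarrow> 'c) \<Rightarrow> ('v::real_normed_vector ^ 'n \<Rightarrow> 'v) \<Rightarrow> ('v ^ 'n \<Rightarrow> 'v)
      \<Rightarrow> 'v ^ 'n \<Rightarrow> 'v"
  where "Sigma_bracket \<sigma> f g X =
    (\<Sum>j\<in>UNIV. partial_derivative f j X (g (A_map \<sigma> j X)) -
                partial_derivative g j X (f (A_map \<sigma> j X)))"

abbreviation ad_Sigma ::
    "('n::finite \<Rightarrow> 'c \<Rightarrow> 'c) \<Rightarrow> ('v::real_normed_vector ^ 'n \<Rightarrow> 'v) \<Rightarrow> ('v ^ 'n \<Rightarrow> 'v)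
      \<Rightarrow> 'v ^ 'n \<Rightarrow> 'v"
  where "ad_Sigma \<equiv> Sigma_bracket"

end

theory Submission
  imports Defs
begin

text \<open>The conjugacy is taken to be \<open>\<Phi> = id + \<gamma>_g\<close> rather than the time-one flow of a network field.
  On \<open>V\<^sup>n\<close> let \<open>\<Gamma>_f\<close> have the components \<open>f \<circ> A_{\<sigma>_j}\<close>; it is the network field of \<open>f\<close> for the maps
  \<open>sigma_tilde \<sigma> j\<close>, and the maps \<open>x \<mapsto> (x_{\<sigma>_1(i)}, \<dots>, x_{\<sigma>_n(i)})\<close> intertwine \<open>\<gamma>_f\<close> and \<open>\<Gamma>_f\<close>. Hence
  \<open>\<Phi>\<close> carries \<open>\<gamma>_f\<close> exactly to the network field of the function \<open>fbar\<close> determined by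
  \<open>fbar (X + \<Gamma>_g X) = f X + Dg(X) \<Gamma>_f(X)\<close>. Adding \<open>p \<in> P\<^sup>k\<close> to \<open>g\<close> changes \<open>fbar\<close> by \<open>-[f_0, p]\<close> up to
  terms of degree \<open>k + 2\<close>, so \<open>g\<close> can be chosen degree by degree.

  To have all maps globally defined, \<open>p\<close> is replaced by \<open>p \<circ> T\<close>, where \<open>T\<close> applies \<open>\<delta> sin(t/\<delta>)\<close> to
  every coordinate: this is analytic, agrees with \<open>p\<close> to higher order, and has a small Lipschitz
  constant for small \<open>\<delta>\<close>. So \<open>id + \<gamma>_g\<close> and \<open>id + \<Gamma>_g\<close> are global diffeomorphisms. The inverse is
  analytic because the fixed point iteration that computes it also contracts in the Banach algebra of
  power series with absolutely summable weighted coefficients.\<close>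


subsection \<open>Calculus of smooth maps\<close>

text \<open>For \<open>id + \<gamma>_g\<close> the derivative is explicit and only an inverse has to
  be found, while a time-one flow would require the regularity theory of flows. The obstacle is
  globality: \<open>fbar\<close> has to be one smooth function on the whole space, so
  \<open>X + \<Gamma>_g X\<close> must be inverted globally, but polynomials of degree at least two
  have no global Lipschitz constant in general, and a cutoff function would destroy analyticity.
  Lipschitz constants are controlled on two spaces at once: on the cells, where
  \<open>id + \<gamma>_g\<close> is the conjugacy, and on the index set, where
  \<open>id + \<Gamma>_g\<close> determines \<open>fbar\<close>. They start at 0, and each degree
  consumes half of what is left below a fixed bound, so any finite number of degrees fits. The
  analytic inverse needs a Lipschitz constant for substitution into power series that is the same at
  every centre; sine provides it, because the coefficients of its expansion at any real point are
  dominated by those of the exponential series. Since \<open>f\<close> is only smooth,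
  \<open>fbar\<close> is only claimed to be smooth, and smoothness of inverses is treated separately
  from analyticity.\<close>

lemma C_k_SucI:
  assumes "\<And>x. (f has_derivative f' x) (at x)" "\<And>v. C_k k (\<lambda>x. f' x v)"
  shows "C_k (Suc k) f"
proof -
  have "frechet_derivative f (at x) = f' x" for x
    using frechet_derivative_at[OF assms(1)[of x]] by simp
  then show ?thesis using assms by (auto simp: differentiable_def)
qed

lemma C_k_Suc_has_derivative:
  assumes "C_k (Suc k) f"
  shows "(f has_derivative frechet_derivative f (at x)) (at x)"
  using assms frechet_derivative_works by auto

lemma C_k_SucD: "C_k (Suc k) f \<Longrightarrow> C_k k f"
proof (induction k arbitrary: f)
  case 0
  then show ?case
    by (auto intro!: continuous_at_imp_continuous_on differentiable_imp_continuous_within)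
next
  case (Suc k)
  then show ?case by (metis C_k.simps(2))
qed

lemma C_k_continuous_on: "C_k k f \<Longrightarrow> continuous_on S f"
proof (induction k)
  case 0
  then show ?case by (auto intro: continuous_on_subset)
qed (metis C_k_SucD)

lemma C_k_const: "C_k k (\<lambda>x. c)"
proof (induction k arbitrary: c)
  case (Suc k)
  show ?case by (rule C_k_SucI[where f' = "\<lambda>_ _. 0"]) (auto intro: Suc)
qed simp

lemma C_k_bounded_linear: "bounded_linear f \<Longrightarrow> C_k k f"
proof (cases k)
  case (Suc n)
  assume "bounded_linear f"
  then show ?thesis
    unfolding Suc by (intro C_k_SucI[where f' = "\<lambda>_. f"] C_k_const bounded_linear_imp_has_derivative)
qed (simp add: linear_continuous_on)

lemma C_k_add: "C_k k f \<Longrightarrow> C_k k g \<Longrightarrow> C_k k (\<lambda>x. f x + g x)"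
proof (induction k arbitrary: f g)
  case 0 then show ?case by (auto intro: continuous_intros)
next
  case (Suc k)
  show ?case
  proof (rule C_k_SucI)
    show "((\<lambda>x. f x + g x) has_derivative
        (\<lambda>v. frechet_derivative f (at x) v + frechet_derivative g (at x) v)) (at x)" for x
      using Suc.prems by (intro has_derivative_add C_k_Suc_has_derivative)
  qed (use Suc in auto)
qed

lemma C_k_sum: "(\<And>i. i \<in> I \<Longrightarrow> C_k k (f i)) \<Longrightarrow> C_k k (\<lambda>x. \<Sum>i\<in>I. f i x)"
proof (induction I rule: infinite_finite_induct)
  case (insert i I)
  then show ?case by (simp add: C_k_add)
qed (auto intro: C_k_const)

lemma C_k_scaleR: "C_k k f \<Longrightarrow> C_k k g \<Longrightarrow> C_k k (\<lambda>x. f x *\<^sub>R g x)"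
proof (induction k arbitrary: f g)
  case 0 then show ?case by (auto intro: continuous_intros)
next
  case (Suc k)
  show ?case
  proof (rule C_k_SucI)
    show "((\<lambda>x. f x *\<^sub>R g x) has_derivative
        (\<lambda>v. f x *\<^sub>R frechet_derivative g (at x) v + frechet_derivative f (at x) v *\<^sub>R g x)) (at x)" for x
      using Suc.prems by (intro has_derivative_scaleR C_k_Suc_has_derivative)
    show "C_k k (\<lambda>x. f x *\<^sub>R frechet_derivative g (at x) v + frechet_derivative f (at x) v *\<^sub>R g x)" for v
      using Suc.prems by (intro C_k_add Suc.IH C_k_SucD[of k f] C_k_SucD[of k g]) auto
  qed
qed

lemma C_k_mult:
  fixes f g :: "'a::real_normed_vector \<Rightarrow> real"
  shows "C_k k f \<Longrightarrow> C_k k g \<Longrightarrow> C_k k (\<lambda>x. f x * g x)"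
  using C_k_scaleR[of k f g] by simp

lemma C_k_bounded_linear_compose:
  assumes "bounded_linear L"
  shows "C_k k f \<Longrightarrow> C_k k (\<lambda>x. L (f x))"
proof (induction k arbitrary: f)
  case 0
  then show ?case using assms by (auto intro: bounded_linear.continuous_on)
next
  case (Suc k)
  show ?case
  proof (rule C_k_SucI)
    show "((\<lambda>x. L (f x)) has_derivative (\<lambda>v. L (frechet_derivative f (at x) v))) (at x)" for x
      using Suc.prems by (intro bounded_linear.has_derivative[OF assms] C_k_Suc_has_derivative)
  qed (use Suc in auto)
qed

lemma C_k_componentwise:
  fixes f :: "'a::real_normed_vector \<Rightarrow> 'b::euclidean_space"
  assumes "\<And>b. b \<in> Basis \<Longrightarrow> C_k k (\<lambda>x. f x \<bullet> b)"
  shows "C_k k f"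
proof -
  have "C_k k (\<lambda>x. \<Sum>b\<in>Basis. (f x \<bullet> b) *\<^sub>R b)"
    by (intro C_k_sum C_k_scaleR assms C_k_const)
  then show ?thesis by (simp add: euclidean_representation)
qed

lemma linear_basis_expansion:
  fixes v :: "'a::euclidean_space"
  assumes "linear L"
  shows "L v = (\<Sum>b\<in>Basis. (v \<bullet> b) *\<^sub>R L b)"
proof -
  interpret linear L by fact
  show ?thesis
    by (subst (1) euclidean_representation[of v, symmetric]) (simp only: sum scale)
qed

text \<open>\<open>C_k\<close> is defined with constant directions, whereas the chain rule applies a
  derivative to a direction that varies with the point. Expanding that direction in the finite basis
  leaves only products of scalar and vector functions.\<close>

lemma C_k_apply_linear:
  fixes w :: "'a::real_normed_vector \<Rightarrow> 'b::euclidean_space"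
  assumes "\<And>x. linear (A x)" "\<And>b. b \<in> Basis \<Longrightarrow> C_k k (\<lambda>x. A x b)" "C_k k w"
  shows "C_k k (\<lambda>x. A x (w x))"
proof -
  have "C_k k (\<lambda>x. \<Sum>b\<in>Basis. (w x \<bullet> b) *\<^sub>R A x b)"
    by (intro C_k_sum C_k_scaleR assms C_k_bounded_linear_compose[OF bounded_linear_inner_left])
  then show ?thesis by (simp only: linear_basis_expansion[OF assms(1), symmetric])
qed

lemma C_k_compose:
  fixes f :: "'b::euclidean_space \<Rightarrow> 'c::real_normed_vector" and g :: "'a::real_normed_vector \<Rightarrow> 'b"
  shows "C_k k f \<Longrightarrow> C_k k g \<Longrightarrow> C_k k (\<lambda>x. f (g x))"
proof (induction k arbitrary: f)
  case 0
  then show ?case by (auto intro: continuous_on_compose2)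
next
  case (Suc k)
  show ?case
  proof (rule C_k_SucI)
    fix x
    show "((\<lambda>x. f (g x)) has_derivative
        (\<lambda>v. frechet_derivative f (at (g x)) (frechet_derivative g (at x) v))) (at x)"
      using has_derivative_compose[OF C_k_Suc_has_derivative[OF Suc.prems(2)]
          C_k_Suc_has_derivative[OF Suc.prems(1)]] .
  next
    fix v
    show "C_k k (\<lambda>x. frechet_derivative f (at (g x)) (frechet_derivative g (at x) v))"
    proof (rule C_k_apply_linear)
      show "linear (frechet_derivative f (at (g x)))" for x
        using C_k_Suc_has_derivative[OF Suc.prems(1)] by (rule has_derivative_linear)
      show "C_k k (\<lambda>x. frechet_derivative f (at (g x)) b)" for b
        using Suc.IH[of "\<lambda>y. frechet_derivative f (at y) b"] Suc.prems C_k_SucD[of k g] by auto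
    qed (use Suc.prems in auto)
  qed
qed

text \<open>Differentiation shifts the phase of sine by \<open>pi/2\<close>, so letting
  \<open>c\<close> vary in the induction keeps all derivatives within one family.\<close>

lemma C_k_sin:
  assumes "bounded_linear l" shows "C_k k (\<lambda>x. sin (l x + c :: real))"
proof (induction k arbitrary: c)
  case 0
  have "continuous_on UNIV l" using assms linear_continuous_on by blast
  then have "continuous_on UNIV (\<lambda>x. sin (l x + c))" by (intro continuous_intros)
  then show ?case by simp
next
  case (Suc k)
  show ?case
  proof (rule C_k_SucI)
    fix x
    have "sin (l x + (c + pi/2)) = cos (l x + c)" by (simp add: sin_add cos_add)
    then show "((\<lambda>x. sin (l x + c)) has_derivative (\<lambda>v. l v * sin (l x + (c + pi/2)))) (at x)"
      by (auto intro!: derivative_eq_intros bounded_linear_imp_has_derivative[OF assms])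
  qed (intro C_k_mult C_k_const Suc)
qed

lemma smooth_has_derivative: "smooth f \<Longrightarrow> (f has_derivative frechet_derivative f (at x)) (at x)"
  unfolding smooth_def by (metis C_k_Suc_has_derivative)

lemma smooth_deriv: "smooth f \<Longrightarrow> smooth (\<lambda>x. frechet_derivative f (at x) v)"
  unfolding smooth_def by (metis C_k.simps(2))

lemma smooth_deriv_linear: "smooth f \<Longrightarrow> linear (frechet_derivative f (at x))"
  using smooth_has_derivative has_derivative_linear by blast

lemma smooth_continuous_on: "smooth f \<Longrightarrow> continuous_on S f"
  unfolding smooth_def by (metis C_k.simps(1) continuous_on_subset subset_UNIV)

lemma smooth_const: "smooth (\<lambda>x. c)"
  by (simp add: smooth_def C_k_const)

lemma smooth_bounded_linear: "bounded_linear f \<Longrightarrow> smooth f"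
  by (simp add: smooth_def C_k_bounded_linear)

lemma smooth_add: "smooth f \<Longrightarrow> smooth g \<Longrightarrow> smooth (\<lambda>x. f x + g x)"
  by (simp add: smooth_def C_k_add)

lemma smooth_sum: "(\<And>i. i \<in> I \<Longrightarrow> smooth (f i)) \<Longrightarrow> smooth (\<lambda>x. \<Sum>i\<in>I. f i x)"
  by (simp add: smooth_def C_k_sum)

lemma smooth_scaleR: "smooth f \<Longrightarrow> smooth g \<Longrightarrow> smooth (\<lambda>x. f x *\<^sub>R g x)"
  by (simp add: smooth_def C_k_scaleR)

lemma smooth_mult:
  fixes f g :: "'a::real_normed_vector \<Rightarrow> real"
  shows "smooth f \<Longrightarrow> smooth g \<Longrightarrow> smooth (\<lambda>x. f x * g x)"
  by (simp add: smooth_def C_k_mult)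

lemma smooth_diff: "smooth f \<Longrightarrow> smooth g \<Longrightarrow> smooth (\<lambda>x. f x - g x)"
  using smooth_add[of f "\<lambda>x. (-1) *\<^sub>R g x"] smooth_scaleR[of "\<lambda>x. -1" g] by (simp add: smooth_const)

lemma smooth_compose:
  fixes f :: "'b::euclidean_space \<Rightarrow> 'c::real_normed_vector" and g :: "'a::real_normed_vector \<Rightarrow> 'b"
  shows "smooth f \<Longrightarrow> smooth g \<Longrightarrow> smooth (\<lambda>x. f (g x))"
  by (simp add: smooth_def C_k_compose)

lemma smooth_inner: "smooth f \<Longrightarrow> smooth (\<lambda>x. f x \<bullet> b)"
  by (simp add: smooth_def C_k_bounded_linear_compose[OF bounded_linear_inner_left])

lemma smooth_componentwise:
  fixes f :: "'a::real_normed_vector \<Rightarrow> 'b::euclidean_space"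
  assumes "\<And>b. b \<in> Basis \<Longrightarrow> smooth (\<lambda>x. f x \<bullet> b)"
  shows "smooth f"
  using assms by (simp add: smooth_def C_k_componentwise)

lemma smooth_deriv_apply:
  fixes w :: "'b::euclidean_space \<Rightarrow> 'b"
  assumes "smooth f" "smooth w"
  shows "smooth (\<lambda>x. frechet_derivative f (at x) (w x))"
  unfolding smooth_def
proof
  fix k
  show "C_k k (\<lambda>x. frechet_derivative f (at x) (w x))"
  proof (rule C_k_apply_linear[OF smooth_deriv_linear[OF assms(1)]])
    show "C_k k (\<lambda>x. frechet_derivative f (at x) b)" for b
      using smooth_deriv[OF assms(1), of b] by (simp only: smooth_def)
    show "C_k k w" using assms(2) by (simp only: smooth_def)
  qed
qed

section \<open>Linear systems depending on a parameter, and smooth inverses\<close>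

text \<open>At a zero of \<open>\<phi>\<close> the term of the product rule that contains the
  derivative of \<open>c\<close> drops out, so continuity of \<open>c\<close> is enough. This serves
  for factors whose differentiability is yet to be shown.\<close>

lemma has_derivative_vanishing_scaleR:
  fixes \<phi> :: "'a::real_normed_vector \<Rightarrow> 'b::real_normed_vector" and c :: "'a \<Rightarrow> real"
  assumes "(\<phi> has_derivative \<phi>') (at y)" "\<phi> y = 0" "isCont c y"
  shows "((\<lambda>z. c z *\<^sub>R \<phi> z) has_derivative (\<lambda>v. c y *\<^sub>R \<phi>' v)) (at y)"
proof -
  interpret bounded_linear \<phi>' using assms(1) has_derivative_bounded_linear by blast
  obtain K where K: "\<And>x. norm (\<phi>' x) \<le> norm x * K" using bounded by blast
  have lim: "((\<lambda>z. norm (\<phi> z - \<phi>' (z - y)) / norm (z - y)) \<longlongrightarrow> 0) (at y)"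
    using assms(1,2) by (simp add: has_derivative_iff_norm)
  have clim: "(c \<longlongrightarrow> c y) (at y)" using assms(3) by (simp add: isCont_def)
  have "((\<lambda>z. \<bar>c z\<bar> * (norm (\<phi> z - \<phi>' (z - y)) / norm (z - y)) + \<bar>c z - c y\<bar> * K) \<longlongrightarrow>
      \<bar>c y\<bar> * 0 + \<bar>c y - c y\<bar> * K) (at y)"
    by (intro tendsto_intros lim clim)
  then have lim2: "((\<lambda>z. \<bar>c z\<bar> * (norm (\<phi> z - \<phi>' (z - y)) / norm (z - y)) + \<bar>c z - c y\<bar> * K) \<longlongrightarrow> 0) (at y)"
    by simp
  have upper: "\<forall>\<^sub>F z in at y. norm (c z *\<^sub>R \<phi> z - c y *\<^sub>R \<phi>' (z - y)) / norm (z - y)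
       \<le> \<bar>c z\<bar> * (norm (\<phi> z - \<phi>' (z - y)) / norm (z - y)) + \<bar>c z - c y\<bar> * K"
    proof (rule eventually_mono[OF eventually_neq_at_within])
      fix z :: 'a assume "z \<noteq> y"
      then have pos: "norm (z - y) > 0" by simp
      have "c z *\<^sub>R \<phi> z - c y *\<^sub>R \<phi>' (z - y) = c z *\<^sub>R (\<phi> z - \<phi>' (z - y)) + (c z - c y) *\<^sub>R \<phi>' (z - y)"
        by (simp add: algebra_simps)
      then have "norm (c z *\<^sub>R \<phi> z - c y *\<^sub>R \<phi>' (z - y))
          \<le> \<bar>c z\<bar> * norm (\<phi> z - \<phi>' (z - y)) + \<bar>c z - c y\<bar> * norm (\<phi>' (z - y))"
        by (metis norm_scaleR norm_triangle_ineq)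
      also have "\<dots> \<le> \<bar>c z\<bar> * norm (\<phi> z - \<phi>' (z - y)) + \<bar>c z - c y\<bar> * (norm (z - y) * K)"
        using K by (intro add_mono mult_left_mono) auto
      finally show "norm (c z *\<^sub>R \<phi> z - c y *\<^sub>R \<phi>' (z - y)) / norm (z - y)
       \<le> \<bar>c z\<bar> * (norm (\<phi> z - \<phi>' (z - y)) / norm (z - y)) + \<bar>c z - c y\<bar> * K"
        using pos by (simp add: field_simps)
  qed
  have "((\<lambda>z. norm (c z *\<^sub>R \<phi> z - c y *\<^sub>R \<phi>' (z - y)) / norm (z - y)) \<longlongrightarrow> 0) (at y)"
    by (rule tendsto_sandwich[OF always_eventually upper tendsto_const lim2]) simp
  then show ?thesis
    by (simp add: has_derivative_iff_norm assms(2) bounded_linear_const_scaleR bounded_linear_axioms)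
qed

text \<open>Since \<open>A\<close> at most halves lengths,
  \<open>norm w \<le> 2 * norm (w + A w)\<close>. This gives injectivity, and bijectivity by finite
  dimension.\<close>

lemma perturbed_identity_inverse:
  fixes A :: "'a::euclidean_space \<Rightarrow> 'a"
  assumes "linear A" "\<And>w. norm (A w) \<le> norm w / 2"
  obtains M where "bounded_linear M" "\<And>w. M (w + A w) = w" "\<And>w. M w + A (M w) = w"
    "\<And>w. norm (M w) \<le> 2 * norm w"
proof -
  let ?S = "\<lambda>w. w + A w"
  have lin: "linear ?S" using assms(1) linear_ident by (rule linear_compose_add[rotated])
  have low: "norm w \<le> 2 * norm (?S w)" for w
    using assms(2)[of w] norm_triangle_ineq4[of "?S w" "A w"] by simp
  have "inj ?S"
    unfolding linear_injective_0[OF lin] using low by (metis norm_le_zero_iff norm_zero mult_zero_right)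
  then obtain M where M: "linear M" "\<And>w. M (?S w) = w" "\<And>w. ?S (M w) = w"
    using linear_injective_isomorphism[OF lin] by blast
  have "norm (M w) \<le> 2 * norm w" for w using low[of "M w"] M(3) by simp
  then show ?thesis using that M by (metis linear_conv_bounded_linear)
qed

text \<open>Each directional derivative of the solution \<open>W\<close> solves a system with the
  same \<open>A\<close> and a new right-hand side of class \<open>C_k k\<close>. Hence the induction
  runs over \<open>v\<close> and \<open>W\<close>, and no operator-valued map has to be
  differentiated.\<close>

lemma C_k_linear_system:
  fixes A :: "'b::euclidean_space \<Rightarrow> 'a::euclidean_space \<Rightarrow> 'a"
  assumes lin: "\<And>y. linear (A y)" and small: "\<And>y w. norm (A y w) \<le> norm w / 2"
  shows "(\<And>w. C_k k (\<lambda>y. A y w)) \<Longrightarrow> C_k k v \<Longrightarrow> (\<And>y. W y + A y (W y) = v y) \<Longrightarrow> C_k k W"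
proof (induction k arbitrary: v W)
  case 0
  \<comment> \<open>Subtracting the two systems with the operator taken at \<open>z\<close> leaves
    only the variation of \<open>A\<close> on the fixed vector \<open>W y\<close>.\<close>
  have diff: "norm (W z - W y) \<le> 2 * norm (v z - v y - (A z (W y) - A y (W y)))" for y z
  proof -
    have "(W z - W y) + A z (W z - W y) = v z - v y - (A z (W y) - A y (W y))"
      unfolding 0(3)[symmetric] linear_diff[OF lin] by simp
    moreover have "norm (W z - W y) \<le> norm (W z - W y + A z (W z - W y)) + norm (A z (W z - W y))"
      by (metis add_diff_cancel_right' norm_triangle_ineq4)
    ultimately show ?thesis using small[of z "W z - W y"] by auto
  qed
  have "isCont W y" for y
  proof -
    have "isCont v y" "isCont (\<lambda>z. A z (W y)) y"
      using 0 by (auto simp: continuous_on_eq_continuous_at)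
    then have "((\<lambda>z. 2 * norm (v z - v y - (A z (W y) - A y (W y)))) \<longlongrightarrow>
       2 * norm (v y - v y - (A y (W y) - A y (W y)))) (at y)"
      unfolding isCont_def by (intro tendsto_intros)
    then have "((\<lambda>z. 2 * norm (v z - v y - (A z (W y) - A y (W y)))) \<longlongrightarrow> 0) (at y)" by simp
    from Lim_null_comparison[OF always_eventually[OF allI[OF diff]] this]
    have "((\<lambda>z. W z - W y) \<longlongrightarrow> 0) (at y)" .
    then show ?thesis by (simp add: isCont_def LIM_zero_iff)
  qed
  then show ?case by (simp add: continuous_at_imp_continuous_on)
next
  case (Suc k)
  have WC: "C_k k W"
    by (rule Suc.IH[OF C_k_SucD[OF Suc.prems(1)] C_k_SucD[OF Suc.prems(2)] Suc.prems(3)])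
  let ?DA = "\<lambda>y b u. frechet_derivative (\<lambda>y. A y b) (at y) u"
  let ?Dv = "\<lambda>y. frechet_derivative v (at y)"
  let ?R = "\<lambda>y u. ?Dv y u - (\<Sum>b\<in>Basis. (W y \<bullet> b) *\<^sub>R ?DA y b u)"
  have "\<exists>M. bounded_linear M \<and> (\<forall>w. M (w + A y w) = w) \<and> (\<forall>w. M w + A y (M w) = w)" for y
    by (rule perturbed_identity_inverse[OF lin small, of y]) blast
  then obtain M where M: "\<And>y. bounded_linear (M y)" "\<And>y w. M y (w + A y w) = w" "\<And>y w. M y w + A y (M y w) = w"
    by metis
  have contW: "isCont W y" for y
    using C_k_continuous_on[OF WC, of UNIV] by (simp add: continuous_on_eq_continuous_at)
  have der: "(W has_derivative (\<lambda>u. M y (?R y u))) (at y)" for y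
  proof -
    have "((\<lambda>z. (W z \<bullet> b) *\<^sub>R (A z b - A y b)) has_derivative (\<lambda>u. (W y \<bullet> b) *\<^sub>R ?DA y b u)) (at y)" for b
    proof (rule has_derivative_vanishing_scaleR)
      show "((\<lambda>z. A z b - A y b) has_derivative ?DA y b) (at y)"
        using C_k_Suc_has_derivative[OF Suc.prems(1)[of b], of y]
        by (rule has_derivative_eq_rhs[OF has_derivative_diff[OF _ has_derivative_const]]) simp
      show "isCont (\<lambda>z. W z \<bullet> b) y" using contW by (intro continuous_intros)
    qed simp
    then have sder: "((\<lambda>z. \<Sum>b\<in>Basis. (W z \<bullet> b) *\<^sub>R (A z b - A y b)) has_derivative
        (\<lambda>u. \<Sum>b\<in>Basis. (W y \<bullet> b) *\<^sub>R ?DA y b u)) (at y)"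
      by (rule has_derivative_sum)
    have vder: "((\<lambda>z. v z - v y) has_derivative ?Dv y) (at y)"
      using has_derivative_diff[OF C_k_Suc_has_derivative[OF Suc.prems(2), of y] has_derivative_const] by simp
    \<comment> \<open>This expression equals \<open>W z\<close>. In it the unknown
      \<open>W z\<close> occurs only as a factor of \<open>A z b - A y b\<close>, which vanishes at
      \<open>y\<close>; so continuity of \<open>W\<close> suffices to differentiate it.\<close>
    have "((\<lambda>z. W y + M y (v z - v y - (\<Sum>b\<in>Basis. (W z \<bullet> b) *\<^sub>R (A z b - A y b)))) has_derivative
        (\<lambda>u. 0 + M y (?R y u))) (at y)"
      by (intro has_derivative_add has_derivative_const bounded_linear.has_derivative[OF M(1)] has_derivative_diff
          sder vder)
    moreover have "W y + M y (v z - v y - (\<Sum>b\<in>Basis. (W z \<bullet> b) *\<^sub>R (A z b - A y b))) = W z" for z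
    proof -
      have "(\<Sum>b\<in>Basis. (W z \<bullet> b) *\<^sub>R (A z b - A y b)) = A z (W z) - A y (W z)"
        using linear_basis_expansion[OF lin, of z "W z"] linear_basis_expansion[OF lin, of y "W z"]
        by (simp add: scaleR_diff_right sum_subtractf)
      moreover have "v z - v y - (A z (W z) - A y (W z)) = (W z - W y) + A y (W z - W y)"
        unfolding Suc.prems(3)[symmetric] linear_diff[OF lin] by (simp add: algebra_simps)
      ultimately show ?thesis by (simp add: M(2))
    qed
    ultimately show ?thesis by (simp only: add_0_left)
  qed
  show ?case
  proof (rule C_k_SucI[OF der])
    fix u
    have "C_k k (\<lambda>y. ?R y u)"
    proof -
      have "C_k k (\<lambda>y. ?Dv y u + (\<Sum>b\<in>Basis. ((W y \<bullet> b) * -1) *\<^sub>R ?DA y b u))"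
        using Suc.prems
        by (intro C_k_add C_k_sum C_k_scaleR C_k_mult C_k_const C_k_bounded_linear_compose[OF bounded_linear_inner_left WC]) auto
      moreover have "?Dv y u + (\<Sum>b\<in>Basis. ((W y \<bullet> b) * -1) *\<^sub>R ?DA y b u) = ?R y u" for y
        by (simp add: sum_negf)
      ultimately show ?thesis by (simp only:)
    qed
    then show "C_k k (\<lambda>y. M y (?R y u))"
      by (rule Suc.IH[where v = "\<lambda>y. ?R y u", OF C_k_SucD[OF Suc.prems(1)] _ M(3)])
  qed
qed

text \<open>The difference quotient along \<open>x + t w\<close> tends to the derivative. Only
  differences from the single point \<open>x\<close> enter, the form in which a power series
  estimate at a centre supplies them.\<close>

lemma deriv_norm_le_lipschitz:
  fixes p :: "'a::real_normed_vector \<Rightarrow> 'b::real_normed_vector"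
  assumes "(p has_derivative p') (at x)" and "0 < e"
    and "\<And>y. norm (y - x) < e \<Longrightarrow> norm (p y - p x) \<le> L * norm (y - x)"
  shows "norm (p' w) \<le> L * norm w"
proof -
  have lin: "linear p'" using assms(1) has_derivative_linear by blast
  have "((\<lambda>t. p (x + t *\<^sub>R w)) has_derivative (\<lambda>t. p' (t *\<^sub>R w))) (at (0::real))"
    by (rule has_derivative_compose[where g = p]) (use assms(1) in \<open>auto intro!: derivative_eq_intros\<close>)
  then have "((\<lambda>t::real. norm (p (x + t *\<^sub>R w) - p x - p' (t *\<^sub>R w)) / norm t) \<longlongrightarrow> 0) (at 0)"
    by (simp add: has_derivative_iff_norm)
  then have lim: "((\<lambda>t::real. norm (p (x + t *\<^sub>R w) - p x - p' (t *\<^sub>R w)) / norm t + L * norm w) \<longlongrightarrow> 0 + L * norm w) (at 0)"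
    by (intro tendsto_intros)
  have ev: "\<forall>\<^sub>F t::real in at 0. norm (t *\<^sub>R w) < e"
  proof -
    have "((\<lambda>t::real. norm (t *\<^sub>R w)) \<longlongrightarrow> norm (0 *\<^sub>R w)) (at 0)" by (intro tendsto_intros)
    then show ?thesis using \<open>0 < e\<close> by (intro order_tendstoD(2)) auto
  qed
  have "\<forall>\<^sub>F t::real in at 0. norm (p' w) \<le> norm (p (x + t *\<^sub>R w) - p x - p' (t *\<^sub>R w)) / norm t + L * norm w"
    using ev eventually_neq_at_within
  proof (rule eventually_elim2)
    fix t :: real assume elim: "norm (t *\<^sub>R w) < e" "t \<noteq> 0"
    have "\<bar>t\<bar> * norm (p' w) = norm (p' (t *\<^sub>R w))" by (simp add: linear_scale[OF lin])
    also have "\<dots> \<le> norm (p (x + t *\<^sub>R w) - p x - p' (t *\<^sub>R w)) + norm (p (x + t *\<^sub>R w) - p x)"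
      by norm
    also have "norm (p (x + t *\<^sub>R w) - p x) \<le> L * norm (t *\<^sub>R w)"
      using assms(3)[of "x + t *\<^sub>R w"] elim by simp
    finally show "norm (p' w) \<le> norm (p (x + t *\<^sub>R w) - p x - p' (t *\<^sub>R w)) / norm t + L * norm w"
      using elim by (simp add: field_simps)
  qed
  from tendsto_lowerbound[OF lim this] show ?thesis by simp
qed

text \<open>Bootstrapping: the derivative of \<open>H\<close> at \<open>y\<close> inverts
  \<open>1 + Dp(H y)\<close>. If \<open>H\<close> is of class \<open>C_k k\<close>, so are the
  coefficients of this linear system and hence its solutions, which makes \<open>H\<close> of class
  \<open>C_k (Suc k)\<close>.\<close>

lemma smooth_inverse_perturbed_identity:
  fixes p :: "'a::euclidean_space \<Rightarrow> 'a"
  assumes p: "smooth p" and lip: "\<And>x y. norm (p x - p y) \<le> norm (x - y) / 2"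
    and H: "\<And>y. H y + p (H y) = y"
  shows "smooth H"
proof -
  let ?A = "\<lambda>y. frechet_derivative p (at (H y))"
  have lin: "linear (frechet_derivative p (at x))" for x using smooth_deriv_linear[OF p] .
  have small: "norm (frechet_derivative p (at x) w) \<le> norm w / 2" for x w
    using deriv_norm_le_lipschitz[OF smooth_has_derivative[OF p], of 1 x "1/2" w] lip by auto
  have HL: "norm (H y - H z) \<le> 2 * norm (y - z)" for y z
  proof -
    have "H y - H z = (y - z) - (p (H y) - p (H z))"
      by (subst (3 4) H[symmetric]) simp
    then have "norm (H y - H z) \<le> norm (y - z) + norm (p (H y) - p (H z))"
      by (metis norm_triangle_ineq4)
    then show ?thesis using lip[of "H y" "H z"] by simp
  qed
  have cont: "isCont H y" for y
  proof -
    have "((\<lambda>z. 2 * norm (z - y)) \<longlongrightarrow> 2 * norm (y - y)) (at y)" by (intro tendsto_intros)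
    then have "((\<lambda>z. 2 * norm (z - y)) \<longlongrightarrow> 0) (at y)" by simp
    from Lim_null_comparison[OF always_eventually[OF allI[OF HL]] this]
    have "((\<lambda>z. H z - H y) \<longlongrightarrow> 0) (at y)" .
    then show ?thesis by (simp add: isCont_def LIM_zero_iff)
  qed
  have "\<exists>M. bounded_linear M \<and> (\<forall>w. M (w + ?A y w) = w) \<and> (\<forall>w. M w + ?A y (M w) = w)" for y
    by (rule perturbed_identity_inverse[OF lin small, of "H y"]) blast
  then obtain M where M: "\<And>y. bounded_linear (M y)" "\<And>y w. M y (w + ?A y w) = w" "\<And>y w. M y w + ?A y (M y w) = w"
    by metis
  have der: "(H has_derivative M y) (at y)" for y
  proof (rule has_derivative_inverse_basic[where f = "\<lambda>x. x + p x" and T = UNIV])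
    show "((\<lambda>x. x + p x) has_derivative (\<lambda>w. w + ?A y w)) (at (H y))"
      by (intro derivative_intros smooth_has_derivative p)
  qed (use M cont H in auto)
  have "C_k k H" for k
  proof (induction k)
    case 0
    then show ?case using cont by (simp add: continuous_at_imp_continuous_on)
  next
    case (Suc k)
    have "C_k k (\<lambda>y. ?A y w)" for w
      using C_k_compose[OF _ Suc] smooth_deriv[OF p] unfolding smooth_def by blast
    then have "C_k k (\<lambda>y. M y w)" for w
      by (rule C_k_linear_system[where A = ?A and v = "\<lambda>y. w", OF lin small _ C_k_const M(3)])
    then show ?case by (rule C_k_SucI[OF der])
  qed
  then show ?thesis by (simp add: smooth_def)
qed

subsection \<open>Absolutely convergent power series\<close>

definition mono_val :: "('a::euclidean_space \<Rightarrow> nat) \<Rightarrow> 'a \<Rightarrow> real"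
  where "mono_val \<alpha> x = (\<Prod>b\<in>Basis. (x \<bullet> b) ^ \<alpha> b)"

definition mono_deg :: "('a::euclidean_space \<Rightarrow> nat) \<Rightarrow> nat"
  where "mono_deg \<alpha> = (\<Sum>b\<in>Basis. \<alpha> b)"

text \<open>On a cube, a monomial of degree \<open>d\<close> is bounded by
  \<open>\<rho> ^ d\<close>, which is exactly its weight in the norm used below.\<close>

definition box_at_0 :: "real \<Rightarrow> 'a::euclidean_space set"
  where "box_at_0 \<rho> = {x. \<forall>b\<in>Basis. \<bar>x \<bullet> b\<bar> \<le> \<rho>}"

text \<open>Monomials may occur repeatedly in the series; so sums and products need no collection of terms.\<close>

definition majorized :: "real \<Rightarrow> real \<Rightarrow> ('a::euclidean_space \<Rightarrow> real) \<Rightarrow> bool"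
  where "majorized \<rho> B f \<longleftrightarrow> (\<exists>(c :: nat \<Rightarrow> real) \<alpha> S. S \<le> B \<and>
    ((\<lambda>i. \<bar>c i\<bar> * \<rho> ^ mono_deg (\<alpha> i)) has_sum S) UNIV \<and>
    (\<forall>x\<in>box_at_0 \<rho>. ((\<lambda>i. c i * mono_val (\<alpha> i) x) has_sum f x) UNIV))"

lemma abs_mono_val_le:
  assumes "x \<in> box_at_0 \<rho>" shows "\<bar>mono_val \<alpha> x\<bar> \<le> \<rho> ^ mono_deg \<alpha>"
proof -
  have "\<bar>mono_val \<alpha> x\<bar> = (\<Prod>b\<in>Basis. \<bar>x \<bullet> b\<bar> ^ \<alpha> b)"
    by (simp add: mono_val_def abs_prod power_abs)
  also have "\<dots> \<le> (\<Prod>b\<in>Basis. \<rho> ^ \<alpha> b)"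
    using assms by (intro prod_mono conjI power_mono) (auto simp: box_at_0_def)
  also have "\<dots> = \<rho> ^ mono_deg \<alpha>" by (simp add: mono_deg_def power_sum)
  finally show ?thesis .
qed

lemma mono_val_add: "mono_val (\<lambda>b. \<alpha> b + \<beta> b) x = mono_val \<alpha> x * mono_val \<beta> x"
  by (simp add: mono_val_def power_add prod.distrib)

lemma mono_deg_add: "mono_deg (\<lambda>b. \<alpha> b + \<beta> b) = mono_deg \<alpha> + mono_deg \<beta>"
  by (simp add: mono_deg_def sum.distrib)

lemma majorized_cong:
  assumes "majorized \<rho> B f" "\<And>x. x \<in> box_at_0 \<rho> \<Longrightarrow> f x = g x"
  shows "majorized \<rho> B g"
proof -
  have "(\<forall>x\<in>box_at_0 \<rho>. (h x has_sum f x) UNIV) = (\<forall>x\<in>box_at_0 \<rho>. (h x has_sum g x) UNIV)"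
    for h :: "'a \<Rightarrow> nat \<Rightarrow> real"
    using assms(2) by simp
  then show ?thesis using assms(1) unfolding majorized_def by simp
qed

lemma majorized_mono: "majorized \<rho> B f \<Longrightarrow> B \<le> B' \<Longrightarrow> majorized \<rho> B' f"
  unfolding majorized_def by (meson order_trans)

text \<open>Products of series and series of series are indexed by pairs; the pairing bijection
  brings them back to the index type \<open>nat\<close>.\<close>

lemma majorized_pairI:
  fixes c :: "nat \<times> nat \<Rightarrow> real"
  assumes "((\<lambda>p. \<bar>c p\<bar> * \<rho> ^ mono_deg (\<alpha> p)) has_sum S) UNIV" "S \<le> B"
    and "\<And>x. x \<in> box_at_0 \<rho> \<Longrightarrow> ((\<lambda>p. c p * mono_val (\<alpha> p) x) has_sum f x) UNIV"
  shows "majorized \<rho> B f"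
  unfolding majorized_def
proof (intro exI conjI ballI)
  show "((\<lambda>i. \<bar>c (prod_decode i)\<bar> * \<rho> ^ mono_deg (\<alpha> (prod_decode i))) has_sum S) UNIV"
    using assms(1) has_sum_reindex_bij_betw[OF bij_prod_decode, of "\<lambda>p. \<bar>c p\<bar> * \<rho> ^ mono_deg (\<alpha> p)"] by simp
  show "((\<lambda>i. c (prod_decode i) * mono_val (\<alpha> (prod_decode i)) x) has_sum f x) UNIV" if "x \<in> box_at_0 \<rho>" for x
    using assms(3)[OF that] has_sum_reindex_bij_betw[OF bij_prod_decode, of "\<lambda>p. c p * mono_val (\<alpha> p) x"] by simp
qed fact

lemma majorized_nonneg:
  fixes f :: "'a::euclidean_space \<Rightarrow> real"
  assumes "majorized \<rho> B f" "0 \<le> \<rho>" shows "0 \<le> B"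
proof -
  obtain c :: "nat \<Rightarrow> real" and \<alpha> :: "nat \<Rightarrow> 'a \<Rightarrow> nat" and S
    where c: "S \<le> B" "((\<lambda>i. \<bar>c i\<bar> * \<rho> ^ mono_deg (\<alpha> i)) has_sum S) UNIV"
    using assms(1) unfolding majorized_def by blast
  have "0 \<le> S" by (rule has_sum_nonneg[OF c(2)]) (use assms(2) in auto)
  then show ?thesis using c(1) by simp
qed

lemma majorized_bound:
  assumes "majorized \<rho> B f" "0 \<le> \<rho>" "x \<in> box_at_0 \<rho>" shows "\<bar>f x\<bar> \<le> B"
proof -
  obtain c :: "nat \<Rightarrow> real" and \<alpha> S where c: "S \<le> B" "((\<lambda>i. \<bar>c i\<bar> * \<rho> ^ mono_deg (\<alpha> i)) has_sum S) UNIV"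
    "((\<lambda>i. c i * mono_val (\<alpha> i) x) has_sum f x) UNIV"
    using assms(1,3) unfolding majorized_def by blast
  have le: "norm (c i * mono_val (\<alpha> i) x) \<le> \<bar>c i\<bar> * \<rho> ^ mono_deg (\<alpha> i)" for i
    using abs_mono_val_le[OF assms(3), of "\<alpha> i"] by (simp add: abs_mult mult_left_mono)
  have "(\<lambda>i. norm (c i * mono_val (\<alpha> i) x)) summable_on UNIV"
    by (rule summable_on_comparison_test[OF has_sum_imp_summable[OF c(2)]]) (use le in auto)
  then have "((\<lambda>i. norm (c i * mono_val (\<alpha> i) x)) has_sum (\<Sum>\<^sub>\<infinity>i. norm (c i * mono_val (\<alpha> i) x))) UNIV"
    by (rule has_sum_infsum)
  then have "norm (f x) \<le> S"
    using norm_has_sum_bound[OF _ c(3)] has_sum_mono[OF _ c(2) le] order_trans by blast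
  then show ?thesis using c(1) by simp
qed

text \<open>Completeness of the weighted summable series: the terms of all series together form one
  absolutely summable double family, which may be summed in either order.\<close>

lemma majorized_sums:
  fixes f :: "nat \<Rightarrow> 'a::euclidean_space \<Rightarrow> real"
  assumes f: "\<And>n. majorized \<rho> (B n) (f n)" and \<rho>: "0 \<le> \<rho>" and B: "B sums C"
    and s: "\<And>x. x \<in> box_at_0 \<rho> \<Longrightarrow> (\<lambda>n. f n x) sums s x"
  shows "majorized \<rho> C s"
proof -
  have "\<forall>n. \<exists>c \<alpha> S. S \<le> B n \<and> ((\<lambda>i. \<bar>c i\<bar> * \<rho> ^ mono_deg (\<alpha> i)) has_sum S) (UNIV :: nat set) \<and>
    (\<forall>x\<in>box_at_0 \<rho>. ((\<lambda>i. c i * mono_val (\<alpha> i) x) has_sum f n x) UNIV)"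
    using f unfolding majorized_def by (rule allI)
  then obtain c \<alpha> S where "\<forall>n. S n \<le> B n \<and> ((\<lambda>i. \<bar>c n i\<bar> * \<rho> ^ mono_deg (\<alpha> n i)) has_sum S n) (UNIV :: nat set) \<and>
    (\<forall>x\<in>box_at_0 \<rho>. ((\<lambda>i. c n i * mono_val (\<alpha> n i) x) has_sum f n x) UNIV)"
    unfolding choice_iff by (elim exE)
  then have c: "\<And>n. S n \<le> B n" "\<And>n. ((\<lambda>i. \<bar>c n i\<bar> * \<rho> ^ mono_deg (\<alpha> n i)) has_sum S n) (UNIV :: nat set)"
    "\<And>n x. x \<in> box_at_0 \<rho> \<Longrightarrow> ((\<lambda>i. c n i * mono_val (\<alpha> n i) x) has_sum f n x) UNIV"
    by blast+
  have B0: "0 \<le> B n" for n using majorized_nonneg[OF f \<rho>] .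
  have S0: "0 \<le> S n" for n by (rule has_sum_nonneg[OF c(2)]) (use \<rho> in auto)
  have BC: "(B has_sum C) UNIV"
    using norm_summable_imp_has_sum[OF _ B] B0 sums_summable[OF B] by simp
  have "S summable_on UNIV"
    by (rule summable_on_comparison_test[OF has_sum_imp_summable[OF BC]]) (use c S0 in auto)
  then have Ssum: "(S has_sum infsum S UNIV) UNIV" by (rule has_sum_infsum)
  let ?a = "\<lambda>p. \<bar>c (fst p) (snd p)\<bar> * \<rho> ^ mono_deg (\<alpha> (fst p) (snd p))"
  have asum: "?a summable_on Sigma UNIV (\<lambda>_. UNIV)"
    by (rule summable_on_SigmaI[where g = S]) (use c(2) \<open>S summable_on UNIV\<close> \<rho> in auto)
  have ahas: "(?a has_sum infsum S UNIV) (Sigma UNIV (\<lambda>_. UNIV))"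
    by (rule has_sum_SigmaI[OF _ Ssum asum]) (use c(2) in auto)
  show ?thesis
  proof (rule majorized_pairI)
    show "(?a has_sum infsum S UNIV) UNIV" using ahas by simp
    show "infsum S UNIV \<le> C" using has_sum_mono[OF Ssum BC] c(1) by auto
    fix x :: 'a assume x: "x \<in> box_at_0 \<rho>"
    let ?t = "\<lambda>p. c (fst p) (snd p) * mono_val (\<alpha> (fst p) (snd p)) x"
    have le: "norm (?t p) \<le> ?a p" for p
      using abs_mono_val_le[OF x, of "\<alpha> (fst p) (snd p)"] by (simp add: abs_mult mult_left_mono)
    have "(\<lambda>p. norm (?t p)) summable_on Sigma UNIV (\<lambda>_. UNIV)"
      by (rule summable_on_comparison_test[OF asum]) (use le in auto)
    then have tsum: "?t summable_on Sigma UNIV (\<lambda>_. UNIV)" by (rule abs_summable_summable)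
    have fle: "norm (f n x) \<le> B n" for n using majorized_bound[OF f \<rho> x] by simp
    have "summable (\<lambda>n. norm (f n x))"
      by (rule summable_comparison_test[OF _ sums_summable[OF B]]) (use fle in auto)
    then have "((\<lambda>n. f n x) has_sum s x) UNIV"
      by (rule norm_summable_imp_has_sum[OF _ s[OF x]])
    from has_sum_SigmaI[OF _ this tsum] c(3)[OF x] show "(?t has_sum s x) UNIV" by simp
  qed
qed

lemma majorized_const: "majorized \<rho> \<bar>a\<bar> (\<lambda>x. a)"
  unfolding majorized_def
proof (intro exI conjI ballI)
  show "((\<lambda>i. \<bar>if i = 0 then a else 0\<bar> * \<rho> ^ mono_deg (\<lambda>_. 0)) has_sum \<bar>a\<bar>) (UNIV :: nat set)"
    by (rule has_sum_finite_neutralI[of "{0}"]) (auto simp: mono_deg_def)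
  show "((\<lambda>i. (if i = 0 then a else 0) * mono_val (\<lambda>_. 0) x) has_sum a) (UNIV :: nat set)" for x
    by (rule has_sum_finite_neutralI[of "{0}"]) (auto simp: mono_val_def)
qed simp

lemma majorized_coord:
  fixes b :: "'a::euclidean_space"
  assumes "b \<in> Basis" shows "majorized \<rho> \<rho> (\<lambda>x. x \<bullet> b)"
  unfolding majorized_def
proof (intro exI conjI ballI)
  let ?\<alpha> = "\<lambda>b'. if b' = b then 1 else 0 :: nat"
  have deg: "mono_deg ?\<alpha> = 1" using assms by (simp add: mono_deg_def)
  show "((\<lambda>i. \<bar>if i = 0 then 1 else 0\<bar> * \<rho> ^ mono_deg ?\<alpha>) has_sum \<rho>) (UNIV :: nat set)"
    by (rule has_sum_finite_neutralI[of "{0}"]) (auto simp: deg)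
  have val: "mono_val ?\<alpha> x = x \<bullet> b" for x
  proof -
    have "mono_val ?\<alpha> x = (\<Prod>b'\<in>Basis. if b' = b then x \<bullet> b else 1)"
      unfolding mono_val_def by (rule prod.cong) auto
    then show ?thesis using assms by simp
  qed
  show "((\<lambda>i. (if i = 0 then 1 else 0) * mono_val ?\<alpha> x) has_sum (x \<bullet> b)) (UNIV :: nat set)" for x
    by (rule has_sum_finite_neutralI[of "{0}"]) (auto simp: val)
qed simp

text \<open>A sum is treated as a series of functions with two nonzero members, so that no separate
  merging of index sets is needed.\<close>

lemma majorized_add:
  assumes "majorized \<rho> B f" "majorized \<rho> C g" "0 \<le> \<rho>"
  shows "majorized \<rho> (B + C) (\<lambda>x. f x + g x)"
proof (rule majorized_sums[where f = "\<lambda>n. if n = 0 then f else if n = 1 then g else (\<lambda>_. 0)"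
      and B = "\<lambda>n. if n = 0 then B else if n = 1 then C else 0"])
  show "majorized \<rho> (if n = 0 then B else if n = 1 then C else 0)
      (if n = 0 then f else if n = 1 then g else (\<lambda>_. 0))" for n :: nat
    using assms majorized_const[of \<rho> 0] by auto
  show "(\<lambda>n. if n = 0 then B else if n = 1 then C else 0) sums (B + C)"
    using sums_finite[of "{0,1}" "\<lambda>n::nat. if n = 0 then B else if n = 1 then C else 0"] by auto
  show "(\<lambda>n. (if n = 0 then f else if n = 1 then g else (\<lambda>_. 0)) x) sums (f x + g x)" for x
    using sums_finite[of "{0,1}" "\<lambda>n::nat. (if n = 0 then f else if n = 1 then g else (\<lambda>_. 0)) x"] by auto
qed fact

text \<open>The norm is submultiplicative: the double family of products of terms has the product of
  the two norms as its norm, and equal monomials need not be collected.\<close>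

lemma majorized_mult:
  fixes f g :: "'a::euclidean_space \<Rightarrow> real"
  assumes f: "majorized \<rho> B f" and g: "majorized \<rho> C g" and \<rho>: "0 \<le> \<rho>"
  shows "majorized \<rho> (B * C) (\<lambda>x. f x * g x)"
proof -
  obtain c :: "nat \<Rightarrow> real" and \<alpha> S where c: "S \<le> B" "((\<lambda>i. \<bar>c i\<bar> * \<rho> ^ mono_deg (\<alpha> i)) has_sum S) UNIV"
    "\<And>x. x \<in> box_at_0 \<rho> \<Longrightarrow> ((\<lambda>i. c i * mono_val (\<alpha> i) x) has_sum f x) UNIV"
    using f unfolding majorized_def by blast
  obtain d :: "nat \<Rightarrow> real" and \<beta> T where d: "T \<le> C" "((\<lambda>i. \<bar>d i\<bar> * \<rho> ^ mono_deg (\<beta> i)) has_sum T) UNIV"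
    "\<And>x. x \<in> box_at_0 \<rho> \<Longrightarrow> ((\<lambda>i. d i * mono_val (\<beta> i) x) has_sum g x) UNIV"
    using g unfolding majorized_def by blast
  have S0: "0 \<le> S" "0 \<le> T" by (rule has_sum_nonneg[OF c(2)] has_sum_nonneg[OF d(2)]; use \<rho> in simp)+
  let ?\<gamma> = "\<lambda>p b. \<alpha> (fst p) b + \<beta> (snd p) b"
  let ?a = "\<lambda>p. \<bar>c (fst p) * d (snd p)\<bar> * \<rho> ^ mono_deg (?\<gamma> p)"
  have aeq: "?a (i, j) = (\<bar>c i\<bar> * \<rho> ^ mono_deg (\<alpha> i)) * (\<bar>d j\<bar> * \<rho> ^ mono_deg (\<beta> j))" for i j
    by (simp add: mono_deg_add power_add abs_mult)
  have inner: "((\<lambda>j. ?a (i, j)) has_sum ((\<bar>c i\<bar> * \<rho> ^ mono_deg (\<alpha> i)) * T)) UNIV" for i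
    unfolding aeq by (rule has_sum_cmult_right[OF d(2)])
  have outer: "((\<lambda>i. (\<bar>c i\<bar> * \<rho> ^ mono_deg (\<alpha> i)) * T) has_sum S * T) UNIV"
    by (rule has_sum_cmult_left[OF c(2)])
  have asum: "?a summable_on Sigma UNIV (\<lambda>_. UNIV)"
    by (rule summable_on_SigmaI[OF inner has_sum_imp_summable[OF outer]]) (use \<rho> in auto)
  have ahas: "(?a has_sum S * T) (Sigma UNIV (\<lambda>_. UNIV))"
    by (rule has_sum_SigmaI[OF inner outer asum])
  show ?thesis
  proof (rule majorized_pairI)
    show "(?a has_sum S * T) UNIV" using ahas by simp
    show "S * T \<le> B * C" using c(1) d(1) S0 by (intro mult_mono) auto
    fix x :: 'a assume x: "x \<in> box_at_0 \<rho>"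
    let ?t = "\<lambda>p. c (fst p) * d (snd p) * mono_val (?\<gamma> p) x"
    have le: "norm (?t p) \<le> ?a p" for p
      using abs_mono_val_le[OF x, of "?\<gamma> p"] by (simp add: abs_mult mult_left_mono)
    have "(\<lambda>p. norm (?t p)) summable_on Sigma UNIV (\<lambda>_. UNIV)"
      by (rule summable_on_comparison_test[OF asum]) (use le in auto)
    then have tsum: "?t summable_on Sigma UNIV (\<lambda>_. UNIV)" by (rule abs_summable_summable)
    have teq: "?t (i, j) = (c i * mono_val (\<alpha> i) x) * (d j * mono_val (\<beta> j) x)" for i j
      by (simp add: mono_val_add)
    have "((\<lambda>j. ?t (i, j)) has_sum ((c i * mono_val (\<alpha> i) x) * g x)) UNIV" for i
      unfolding teq by (rule has_sum_cmult_right[OF d(3)[OF x]])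
    from has_sum_SigmaI[OF this has_sum_cmult_left[OF c(3)[OF x]] tsum]
    show "(?t has_sum f x * g x) UNIV" by simp
  qed
qed

lemma majorized_cmult:
  assumes "majorized \<rho> B f" "0 \<le> \<rho>" shows "majorized \<rho> (\<bar>a\<bar> * B) (\<lambda>x. a * f x)"
  by (rule majorized_mult[OF majorized_const assms])

lemma majorized_uminus:
  assumes "majorized \<rho> B f" "0 \<le> \<rho>" shows "majorized \<rho> B (\<lambda>x. - f x)"
  using majorized_cmult[OF assms, of "-1"] by simp

lemma majorized_diff:
  assumes "majorized \<rho> B f" "majorized \<rho> C g" "0 \<le> \<rho>"
  shows "majorized \<rho> (B + C) (\<lambda>x. f x - g x)"
  using majorized_add[OF assms(1) majorized_uminus[OF assms(2,3)] assms(3)] by simp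

lemma majorized_power:
  assumes "majorized \<rho> B f" "0 \<le> \<rho>" shows "majorized \<rho> (B ^ k) (\<lambda>x. f x ^ k)"
proof (induction k)
  case 0 show ?case using majorized_const[of \<rho> 1] by simp
next
  case (Suc k) show ?case using majorized_mult[OF assms(1) Suc assms(2)] by simp
qed

text \<open>Telescoping with the product rule gives the derivative of the power at \<open>B\<close>
  as Lipschitz constant. For \<open>k = 0\<close> the truncated exponent is harmless because of the
  factor \<open>real k\<close>.\<close>

lemma majorized_power_diff:
  assumes f: "majorized \<rho> B f" and g: "majorized \<rho> B g" and d: "majorized \<rho> D (\<lambda>x. f x - g x)" and \<rho>: "0 \<le> \<rho>"
  shows "majorized \<rho> (real k * B ^ (k - 1) * D) (\<lambda>x. f x ^ k - g x ^ k)"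
proof (induction k)
  case 0 show ?case using majorized_const[of \<rho> 0] by simp
next
  case (Suc k)
  have "majorized \<rho> (B * (real k * B ^ (k - 1) * D) + D * B ^ k) (\<lambda>x. f x * (f x ^ k - g x ^ k) + (f x - g x) * g x ^ k)"
    by (intro majorized_add majorized_mult majorized_power assms Suc)
  moreover have "B * (real k * B ^ (k - 1) * D) + D * B ^ k = real (Suc k) * B ^ (Suc k - 1) * D"
    by (cases k) (auto simp: algebra_simps)
  moreover have "f x * (f x ^ k - g x ^ k) + (f x - g x) * g x ^ k = f x ^ Suc k - g x ^ Suc k" for x
    by (simp add: algebra_simps)
  ultimately show ?case by simp
qed

text \<open>Term by term, \<open>\<phi>\<close> is dominated by the exponential series. So
  \<open>exp B\<close> bounds the values, and the differentiated exponential series, again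
  \<open>exp B\<close>, is the Lipschitz constant.\<close>

lemma majorized_entire:
  assumes a: "\<And>k. \<bar>a k\<bar> \<le> 1 / fact k" and \<phi>: "\<And>t::real. (\<lambda>k. a k * t ^ k) sums \<phi> t"
    and f: "majorized \<rho> B f" and \<rho>: "0 \<le> \<rho>"
  shows "majorized \<rho> (exp B) (\<lambda>x. \<phi> (f x))"
    and "majorized \<rho> B g \<Longrightarrow> majorized \<rho> D (\<lambda>x. f x - g x) \<Longrightarrow> majorized \<rho> (exp B * D) (\<lambda>x. \<phi> (f x) - \<phi> (g x))"
proof -
  have e: "(\<lambda>k. 1 / fact k * B ^ k) sums exp B"
    using exp_converges[of B] by (simp add: field_simps)
  have B0: "0 \<le> B" using majorized_nonneg[OF f \<rho>] .
  show "majorized \<rho> (exp B) (\<lambda>x. \<phi> (f x))"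
  proof (rule majorized_sums[OF _ \<rho> e \<phi>])
    show "majorized \<rho> (1 / fact k * B ^ k) (\<lambda>x. a k * f x ^ k)" for k
      using B0 a by (intro majorized_mono[OF majorized_cmult[OF majorized_power[OF f \<rho>, of k] \<rho>, of "a k"]] mult_right_mono) auto
  qed
  assume g: "majorized \<rho> B g" and d: "majorized \<rho> D (\<lambda>x. f x - g x)"
  have D0: "0 \<le> D" using majorized_nonneg[OF d \<rho>] .
  have eq: "1 / fact (Suc k) * (real (Suc k) * B ^ (Suc k - 1) * D) = 1 / fact k * B ^ k * D" for k
    by (simp add: field_simps del: of_nat_Suc)
  have e': "(\<lambda>k. 1 / fact k * (real k * B ^ (k - 1) * D)) sums (exp B * D)"
  proof -
    have "(\<lambda>k. 1 / fact (Suc k) * (real (Suc k) * B ^ (Suc k - 1) * D)) sums (exp B * D)"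
      unfolding eq by (rule sums_mult2[OF e])
    then show ?thesis by (subst (asm) sums_Suc_iff) simp
  qed
  show "majorized \<rho> (exp B * D) (\<lambda>x. \<phi> (f x) - \<phi> (g x))"
  proof (rule majorized_sums[OF _ \<rho> e'])
    show "majorized \<rho> (1 / fact k * (real k * B ^ (k - 1) * D)) (\<lambda>x. a k * (f x ^ k - g x ^ k))" for k
      using B0 a D0
      by (intro majorized_mono[OF majorized_cmult[OF majorized_power_diff[OF f g d \<rho>, of k] \<rho>, of "a k"]] mult_right_mono) auto
    show "(\<lambda>k. a k * (f x ^ k - g x ^ k)) sums (\<phi> (f x) - \<phi> (g x))" for x
      using sums_diff[OF \<phi>[of "f x"] \<phi>[of "g x"]] by (simp add: algebra_simps)
  qed
qed

text \<open>For each \<open>k\<close> only one of the sine and cosine coefficients is nonzero, hence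
  the bound \<open>1 / fact k\<close> for every real centre \<open>s\<close>. This uniformity is
  what later yields one Lipschitz constant at all points.\<close>

lemma sin_shift_series:
  fixes s t :: real
  defines "a \<equiv> \<lambda>k. sin s * cos_coeff k + cos s * sin_coeff k"
  shows "\<bar>a k\<bar> \<le> 1 / fact k" and "(\<lambda>k. a k * t ^ k) sums sin (s + t)"
proof -
  show "\<bar>a k\<bar> \<le> 1 / fact k"
    by (auto simp: a_def sin_coeff_def cos_coeff_def abs_mult power_abs divide_right_mono)
  have "(\<lambda>k. sin s * (cos_coeff k *\<^sub>R t ^ k) + cos s * (sin_coeff k *\<^sub>R t ^ k)) sums (sin s * cos t + cos s * sin t)"
    by (intro sums_add sums_mult sin_converges cos_converges)
  then show "(\<lambda>k. a k * t ^ k) sums sin (s + t)"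
    by (simp add: a_def sin_add algebra_simps)
qed

subsection \<open>Analytic inverses\<close>

lemma has_sum_finite_sum:
  fixes f :: "'i \<Rightarrow> 'x \<Rightarrow> 'b::real_normed_vector"
  assumes "finite I" "\<And>i. i \<in> I \<Longrightarrow> (f i has_sum s i) A"
  shows "((\<lambda>x. \<Sum>i\<in>I. f i x) has_sum (\<Sum>i\<in>I. s i)) A"
  using assms by (induction I rule: finite_induct) (auto intro: has_sum_add)

text \<open>\<open>real_analytic_on\<close> asks for a single coefficient per multi-index. The terms
  are therefore collected along the fibres of the map sending an index to its exponent restricted to
  \<open>Basis\<close>.\<close>

lemma majorized_imp_real_analytic_on:
  fixes F :: "'a::euclidean_space \<Rightarrow> 'b::euclidean_space"
  assumes "\<And>a. a \<in> U \<Longrightarrow> \<exists>\<rho>>0. \<exists>B. \<forall>b\<in>Basis. majorized \<rho> B (\<lambda>x. F (a + x) \<bullet> b)"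
  shows "real_analytic_on F U"
  unfolding real_analytic_on_def
proof
  fix a assume "a \<in> U"
  then obtain \<rho> B where \<rho>: "\<rho> > 0" and maj: "\<And>b. b \<in> Basis \<Longrightarrow> majorized \<rho> B (\<lambda>x. F (a + x) \<bullet> b)"
    using assms by blast
  let ?S = "Basis \<rightarrow>\<^sub>E UNIV :: ('a \<Rightarrow> nat) set"
  let ?m = "\<lambda>\<alpha> x. \<Prod>b\<in>Basis. ((x - a) \<bullet> b) ^ \<alpha> b"
  have comp: "\<exists>d. \<forall>x\<in>ball a \<rho>. ((\<lambda>\<alpha>. ?m \<alpha> x * d \<alpha>) has_sum (F x \<bullet> e)) ?S" if e: "e \<in> Basis" for e
  proof -
    obtain c :: "nat \<Rightarrow> real" and \<alpha> :: "nat \<Rightarrow> 'a \<Rightarrow> nat" and S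
      where c: "((\<lambda>i. \<bar>c i\<bar> * \<rho> ^ mono_deg (\<alpha> i)) has_sum S) UNIV"
        "\<And>x. x \<in> box_at_0 \<rho> \<Longrightarrow> ((\<lambda>i. c i * mono_val (\<alpha> i) x) has_sum (F (a + x) \<bullet> e)) UNIV"
      using maj[OF e] unfolding majorized_def by blast
    let ?r = "\<lambda>i. restrict (\<alpha> i) Basis"
    let ?I = "\<lambda>\<beta>. {i. ?r i = \<beta>}"
    \<comment> \<open>Within one fibre all terms have the same degree, so the weight is a positive
      constant that can be divided out.\<close>
    have csum: "c summable_on ?I \<beta>" for \<beta>
    proof -
      have deg: "mono_deg (\<alpha> i) = mono_deg \<beta>" if "i \<in> ?I \<beta>" for i
        using that by (auto simp: mono_deg_def)
      have "(\<lambda>i. \<bar>c i\<bar> * \<rho> ^ mono_deg (\<alpha> i)) summable_on ?I \<beta>"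
        by (rule summable_on_subset[OF has_sum_imp_summable[OF c(1)]]) auto
      also have "?this \<longleftrightarrow> (\<lambda>i. \<bar>c i\<bar> * \<rho> ^ mono_deg \<beta>) summable_on ?I \<beta>"
        by (rule summable_on_cong) (simp only: deg)
      finally have "(\<lambda>i. \<bar>c i\<bar> * \<rho> ^ mono_deg \<beta>) summable_on ?I \<beta>" .
      then have "(\<lambda>i. norm (c i)) summable_on ?I \<beta>"
        using \<rho> by (subst (asm) summable_on_cmult_left') auto
      then show ?thesis by (rule abs_summable_summable)
    qed
    show ?thesis
    proof (intro exI ballI)
      fix x assume x: "x \<in> ball a \<rho>"
      have xb: "x - a \<in> box_at_0 \<rho>"
        unfolding box_at_0_def
      proof (intro CollectI ballI)
        fix b :: 'a assume "b \<in> Basis"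
        then show "\<bar>(x - a) \<bullet> b\<bar> \<le> \<rho>"
          using x Basis_le_norm[of b "x - a"] by (simp add: dist_norm norm_minus_commute)
      qed
      have eq: "mono_val (\<alpha> i) (x - a) = ?m (?r i) x" for i
        by (simp add: mono_val_def)
      have h: "((\<lambda>i. c i * ?m (?r i) x) has_sum (F x \<bullet> e)) UNIV"
        using c(2)[OF xb] unfolding eq by simp
      have "bij_betw snd (Sigma ?S ?I) UNIV"
        by (intro bij_betwI[where g = "\<lambda>i. (?r i, i)"]) auto
      from has_sum_reindex_bij_betw[OF this, of "\<lambda>i. c i * ?m (?r i) x"] h
      have "((\<lambda>p. c (snd p) * ?m (?r (snd p)) x) has_sum (F x \<bullet> e)) (Sigma ?S ?I)" by simp
      then show "((\<lambda>\<beta>. ?m \<beta> x * infsum c (?I \<beta>)) has_sum (F x \<bullet> e)) ?S"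
      proof (rule has_sum_Sigma')
        fix \<beta> assume "\<beta> \<in> ?S"
        have "((\<lambda>i. c i * ?m \<beta> x) has_sum (infsum c (?I \<beta>) * ?m \<beta> x)) (?I \<beta>)"
          by (rule has_sum_cmult_left[OF has_sum_infsum[OF csum]])
        also have "?this \<longleftrightarrow> ((\<lambda>i. c i * ?m (?r i) x) has_sum (infsum c (?I \<beta>) * ?m \<beta> x)) (?I \<beta>)"
          by (rule has_sum_cong) auto
        finally show "((\<lambda>i. c (snd (\<beta>, i)) * ?m (?r (snd (\<beta>, i))) x) has_sum ?m \<beta> x * infsum c (?I \<beta>)) (?I \<beta>)"
          by (simp only: snd_conv mult.commute[of "infsum c (?I \<beta>)"])
      qed
    qed
  qed
  then have "\<forall>e. \<exists>d. e \<in> Basis \<longrightarrow> (\<forall>x\<in>ball a \<rho>. ((\<lambda>\<alpha>. ?m \<alpha> x * d \<alpha>) has_sum (F x \<bullet> e)) ?S)" by blast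
  then obtain d where d: "\<And>e x. e \<in> Basis \<Longrightarrow> x \<in> ball a \<rho> \<Longrightarrow> ((\<lambda>\<alpha>. ?m \<alpha> x * d e \<alpha>) has_sum (F x \<bullet> e)) ?S"
    unfolding choice_iff by blast
  have "((\<lambda>\<alpha>. ?m \<alpha> x *\<^sub>R (\<Sum>e\<in>Basis. d e \<alpha> *\<^sub>R e)) has_sum F x) ?S" if x: "x \<in> ball a \<rho>" for x
  proof -
    have "((\<lambda>\<alpha>. \<Sum>e\<in>Basis. (?m \<alpha> x * d e \<alpha>) *\<^sub>R e) has_sum (\<Sum>e\<in>Basis. (F x \<bullet> e) *\<^sub>R e)) ?S"
      by (intro has_sum_finite_sum finite_Basis has_sum_bounded_linear[OF bounded_linear_scaleR_left] d x)
    then show ?thesis by (simp add: scaleR_sum_right euclidean_representation)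
  qed
  then show "\<exists>c r. r > 0 \<and> (\<forall>x\<in>ball a r. ((\<lambda>\<alpha>. ?m \<alpha> x *\<^sub>R c \<alpha>) has_sum F x) ?S)"
    using \<rho> by (intro exI[of _ "\<lambda>\<alpha>. \<Sum>e\<in>Basis. d e \<alpha> *\<^sub>R e"] exI[of _ \<rho>]) simp
qed

section \<open>Lipschitz estimates for substitution into power series\<close>

definition vmajorized :: "real \<Rightarrow> real \<Rightarrow> ('a::euclidean_space \<Rightarrow> 'a) \<Rightarrow> bool"
  where "vmajorized \<rho> B u \<longleftrightarrow> (\<forall>b\<in>Basis. majorized \<rho> B (\<lambda>x. u x \<bullet> b))"

text \<open>On power series of norm at most \<open>2\<rho>\<close>, the substitution operator \<open>u \<mapsto> q \<circ> (a + u)\<close> is bounded by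
  \<open>M\<close> and Lipschitz with constant \<open>L\<close>. The radius \<open>2\<rho>\<close> leaves room for the identity, of norm \<open>\<rho>\<close>, plus
  a correction of the same size.\<close>

definition ma_lipschitz_upto :: "real \<Rightarrow> 'a::euclidean_space \<Rightarrow> real \<Rightarrow> real \<Rightarrow> ('a \<Rightarrow> real) \<Rightarrow> bool"
  where "ma_lipschitz_upto r a M L q \<longleftrightarrow> (\<forall>\<rho>. 0 < \<rho> \<and> \<rho> \<le> r \<longrightarrow>
    (\<forall>u. vmajorized \<rho> (2 * \<rho>) u \<longrightarrow> majorized \<rho> M (\<lambda>x. q (a + u x))) \<and>
    (\<forall>u v D. vmajorized \<rho> (2 * \<rho>) u \<longrightarrow> vmajorized \<rho> (2 * \<rho>) v \<longrightarrow> vmajorized \<rho> D (\<lambda>x. u x - v x) \<longrightarrow>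
       majorized \<rho> (L * D) (\<lambda>x. q (a + u x) - q (a + v x))))"

text \<open>The radius is hidden because it may depend on the centre and on the function; it is
  \<open>L\<close> that has to be the same at every centre.\<close>

definition ma_lipschitz :: "'a::euclidean_space \<Rightarrow> real \<Rightarrow> real \<Rightarrow> ('a \<Rightarrow> real) \<Rightarrow> bool"
  where "ma_lipschitz a M L q \<longleftrightarrow> (\<exists>r>0. ma_lipschitz_upto r a M L q)"

lemma ma_lipschitzI:
  assumes "0 < r"
    and "\<And>\<rho> u. 0 < \<rho> \<Longrightarrow> \<rho> \<le> r \<Longrightarrow> vmajorized \<rho> (2 * \<rho>) u \<Longrightarrow> majorized \<rho> M (\<lambda>x. q (a + u x))"
    and "\<And>\<rho> u v D. 0 < \<rho> \<Longrightarrow> \<rho> \<le> r \<Longrightarrow> vmajorized \<rho> (2 * \<rho>) u \<Longrightarrow> vmajorized \<rho> (2 * \<rho>) v \<Longrightarrow>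
       vmajorized \<rho> D (\<lambda>x. u x - v x) \<Longrightarrow> majorized \<rho> (L * D) (\<lambda>x. q (a + u x) - q (a + v x))"
  shows "ma_lipschitz a M L q"
  unfolding ma_lipschitz_def ma_lipschitz_upto_def
  using assms(1) by (intro exI[of _ r] conjI allI impI) (use assms(2,3) in simp_all)

lemma ma_lipschitz_uptoD:
  assumes "ma_lipschitz_upto r a M L q" "0 < \<rho>" "\<rho> \<le> r" "vmajorized \<rho> (2 * \<rho>) u"
  shows "majorized \<rho> M (\<lambda>x. q (a + u x))"
    and "vmajorized \<rho> (2 * \<rho>) v \<Longrightarrow> vmajorized \<rho> D (\<lambda>x. u x - v x) \<Longrightarrow>
      majorized \<rho> (L * D) (\<lambda>x. q (a + u x) - q (a + v x))"
  using assms unfolding ma_lipschitz_upto_def by simp_all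

lemma ma_lipschitz_const: "ma_lipschitz a \<bar>c\<bar> 0 (\<lambda>x. c)"
  by (rule ma_lipschitzI[of 1]) (use majorized_const[of _ 0] in \<open>auto intro: majorized_const\<close>)

lemma ma_lipschitz_add:
  fixes a :: "'a::euclidean_space"
  assumes "ma_lipschitz a M L p" "ma_lipschitz a N K q"
  shows "ma_lipschitz a (M + N) (L + K) (\<lambda>x. p x + q x)"
proof -
  obtain r where r: "0 < r" "ma_lipschitz_upto r a M L p"
    using assms(1) unfolding ma_lipschitz_def by blast
  obtain s where s: "0 < s" "ma_lipschitz_upto s a N K q"
    using assms(2) unfolding ma_lipschitz_def by blast
  note R = ma_lipschitz_uptoD[OF r(2)] and S = ma_lipschitz_uptoD[OF s(2)]
  show ?thesis
  proof (rule ma_lipschitzI[of "min r s"])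
    fix \<rho> D :: real and u v :: "'a \<Rightarrow> 'a" assume A: "0 < \<rho>" "\<rho> \<le> min r s" "vmajorized \<rho> (2 * \<rho>) u"
    show "majorized \<rho> (M + N) (\<lambda>x. p (a + u x) + q (a + u x))"
      using A by (intro majorized_add R(1) S(1)) auto
    assume A': "vmajorized \<rho> (2 * \<rho>) v" "vmajorized \<rho> D (\<lambda>x. u x - v x)"
    have "majorized \<rho> (L * D + K * D) (\<lambda>x. (p (a + u x) - p (a + v x)) + (q (a + u x) - q (a + v x)))"
      using A A' by (intro majorized_add R(2) S(2)) auto
    then show "majorized \<rho> ((L + K) * D) (\<lambda>x. p (a + u x) + q (a + u x) - (p (a + v x) + q (a + v x)))"
      by (simp add: algebra_simps)
  qed (use r s in auto)
qed

lemma ma_lipschitz_mult: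
  fixes a :: "'a::euclidean_space"
  assumes "ma_lipschitz a M L p" "ma_lipschitz a N K q"
  shows "ma_lipschitz a (M * N) (M * K + L * N) (\<lambda>x. p x * q x)"
proof -
  obtain r where r: "0 < r" "ma_lipschitz_upto r a M L p"
    using assms(1) unfolding ma_lipschitz_def by blast
  obtain s where s: "0 < s" "ma_lipschitz_upto s a N K q"
    using assms(2) unfolding ma_lipschitz_def by blast
  note R = ma_lipschitz_uptoD[OF r(2)] and S = ma_lipschitz_uptoD[OF s(2)]
  show ?thesis
  proof (rule ma_lipschitzI[of "min r s"])
    fix \<rho> D :: real and u v :: "'a \<Rightarrow> 'a" assume A: "0 < \<rho>" "\<rho> \<le> min r s" "vmajorized \<rho> (2 * \<rho>) u"
    show "majorized \<rho> (M * N) (\<lambda>x. p (a + u x) * q (a + u x))"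
      using A by (intro majorized_mult R(1) S(1)) auto
    assume A': "vmajorized \<rho> (2 * \<rho>) v" "vmajorized \<rho> D (\<lambda>x. u x - v x)"
    have "majorized \<rho> (M * (K * D) + (L * D) * N)
      (\<lambda>x. p (a + u x) * (q (a + u x) - q (a + v x)) + (p (a + u x) - p (a + v x)) * q (a + v x))"
      using A A' by (intro majorized_add majorized_mult R S) auto
    then show "majorized \<rho> ((M * K + L * N) * D) (\<lambda>x. p (a + u x) * q (a + u x) - p (a + v x) * q (a + v x))"
      by (simp add: algebra_simps)
  qed (use r s in auto)
qed

lemma ma_lipschitz_cmult:
  assumes "ma_lipschitz a M L p"
  shows "ma_lipschitz a (\<bar>c\<bar> * M) (\<bar>c\<bar> * L) (\<lambda>x. c * p x)"
  using ma_lipschitz_mult[OF ma_lipschitz_const assms, of c] by simp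

lemma ma_lipschitz_sum:
  assumes "finite I" "\<And>i. i \<in> I \<Longrightarrow> ma_lipschitz a (M i) (L i) (p i)"
  shows "ma_lipschitz a (\<Sum>i\<in>I. M i) (\<Sum>i\<in>I. L i) (\<lambda>x. \<Sum>i\<in>I. p i x)"
  using assms
proof (induction I rule: finite_induct)
  case empty
  show ?case using ma_lipschitz_const[of a 0] by simp
next
  case (insert i I)
  then show ?case using ma_lipschitz_add[of a "M i" "L i" "p i"] by simp
qed

lemma exp_half_le_2: "exp (1/2 :: real) \<le> 2"
  using exp_bound_half[of "1/2::real"] by simp

text \<open>The radius \<open>\<delta> / 4\<close> makes the norm of the rescaled argument at most
  \<open>2 * \<rho> / \<delta> \<le> 1/2\<close>. Then \<open>exp (1/2) \<le> 2\<close> gives both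
  constants, and the factor \<open>1 / \<delta>\<close> from the chain rule cancels the amplitude
  \<open>\<delta>\<close>.\<close>

lemma ma_lipschitz_sin:
  fixes a b :: "'a::euclidean_space"
  assumes b: "b \<in> Basis" and \<delta>: "0 < \<delta>"
  shows "ma_lipschitz a (2 * \<delta>) 2 (\<lambda>x. \<delta> * sin ((x \<bullet> b) / \<delta>))"
proof (rule ma_lipschitzI[of "\<delta> / 4"])
  let ?s = "(a \<bullet> b) / \<delta>"
  note ser = sin_shift_series[of ?s]
  fix \<rho> D :: real and u v :: "'a \<Rightarrow> 'a" assume \<rho>: "0 < \<rho>" "\<rho> \<le> \<delta> / 4" and u: "vmajorized \<rho> (2 * \<rho>) u"
  have half: "(1/\<delta>) * (2 * \<rho>) \<le> 1/2" using \<rho> \<delta> by (simp add: field_simps)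
  have scaled: "majorized \<rho> (1/2) (\<lambda>x. (1/\<delta>) * (w x \<bullet> b))" if "vmajorized \<rho> (2 * \<rho>) w" for w :: "'a \<Rightarrow> 'a"
    using majorized_cmult[of \<rho> "2 * \<rho>" "\<lambda>x. w x \<bullet> b" "1/\<delta>"] that b \<rho> \<delta> half
    by (auto simp: vmajorized_def intro: majorized_mono)
  have eq: "(\<lambda>x. \<delta> * sin (((a + w x) \<bullet> b) / \<delta>)) = (\<lambda>x. \<delta> * sin (?s + (1/\<delta>) * (w x \<bullet> b)))" for w :: "'a \<Rightarrow> 'a"
    by (simp add: inner_add_left add_divide_distrib)
  have "majorized \<rho> (\<bar>\<delta>\<bar> * exp (1/2)) (\<lambda>x. \<delta> * sin (?s + (1/\<delta>) * (u x \<bullet> b)))"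
    by (intro majorized_cmult majorized_entire(1)[OF ser scaled[OF u]]) (use \<rho> in auto)
  then show "majorized \<rho> (2 * \<delta>) (\<lambda>x. \<delta> * sin (((a + u x) \<bullet> b) / \<delta>))"
    unfolding eq by (rule majorized_mono) (use exp_half_le_2 \<delta> in auto)
  assume v: "vmajorized \<rho> (2 * \<rho>) v" and D: "vmajorized \<rho> D (\<lambda>x. u x - v x)"
  have Db: "majorized \<rho> D (\<lambda>x. (u x - v x) \<bullet> b)" using D b by (simp add: vmajorized_def)
  then have D0: "0 \<le> D" by (rule majorized_nonneg) (use \<rho> in auto)
  have "majorized \<rho> ((1/\<delta>) * D) (\<lambda>x. (1/\<delta>) * (u x \<bullet> b) - (1/\<delta>) * (v x \<bullet> b))"
    using majorized_cmult[OF Db, of "1/\<delta>"] \<rho> \<delta> by (simp add: inner_diff_left diff_divide_distrib)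
  then have "majorized \<rho> (\<bar>\<delta>\<bar> * (exp (1/2) * ((1/\<delta>) * D)))
      (\<lambda>x. \<delta> * (sin (?s + (1/\<delta>) * (u x \<bullet> b)) - sin (?s + (1/\<delta>) * (v x \<bullet> b))))"
    by (intro majorized_cmult majorized_entire(2)[OF ser scaled[OF u] _ scaled[OF v]]) (use \<rho> in auto)
  then have "majorized \<rho> (2 * D) (\<lambda>x. \<delta> * (sin (?s + (1/\<delta>) * (u x \<bullet> b)) - sin (?s + (1/\<delta>) * (v x \<bullet> b))))"
    by (rule majorized_mono) (use exp_half_le_2 \<delta> D0 in \<open>auto intro: mult_right_mono\<close>)
  then show "majorized \<rho> (2 * D) (\<lambda>x. \<delta> * sin (((a + u x) \<bullet> b) / \<delta>) - \<delta> * sin (((a + v x) \<bullet> b) / \<delta>))"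
    by (simp add: fun_cong[OF eq] right_diff_distrib)
qed (use \<delta> in auto)

lemma vmajorized_const:
  assumes "\<And>b. b \<in> Basis \<Longrightarrow> \<bar>w \<bullet> b\<bar> \<le> C" shows "vmajorized \<rho> C (\<lambda>x. w)"
  unfolding vmajorized_def using assms by (auto intro: majorized_mono[OF majorized_const])

text \<open>Constant functions are power series too: substituting the constants \<open>x - a\<close>
  and \<open>0\<close> turns the estimate between series into one between values.\<close>

lemma ma_lipschitz_imp_local_lipschitz:
  fixes q :: "'a::euclidean_space \<Rightarrow> real"
  assumes "ma_lipschitz a M L q"
  obtains r where "0 < r" "\<And>x. norm (x - a) < r \<Longrightarrow> \<bar>q x - q a\<bar> \<le> L * norm (x - a)"
proof -
  obtain r where r: "0 < r" "ma_lipschitz_upto r a M L q"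
    using assms unfolding ma_lipschitz_def by blast
  have "\<bar>q x - q a\<bar> \<le> L * norm (x - a)" if x: "norm (x - a) < r" for x
  proof -
    have "majorized r (L * norm (x - a)) (\<lambda>y::'a. q (a + (x - a)) - q (a + 0))"
    proof (rule ma_lipschitz_uptoD(2)[OF r(2)])
      show "vmajorized r (2 * r) (\<lambda>y. x - a)"
      proof (rule vmajorized_const)
        fix b :: 'a assume "b \<in> Basis"
        then show "\<bar>(x - a) \<bullet> b\<bar> \<le> 2 * r" using Basis_le_norm[of b "x - a"] x r(1) by linarith
      qed
      show "vmajorized r (2 * r) (\<lambda>y. 0)" by (rule vmajorized_const) (use r(1) in auto)
      show "vmajorized r (norm (x - a)) (\<lambda>y. x - a - 0)" by (rule vmajorized_const) (auto intro: Basis_le_norm)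
    qed (use r(1) in auto)
    from majorized_bound[OF this, of 0] show ?thesis using r(1) by (simp add: box_at_0_def)
  qed
  then show ?thesis using that r(1) by blast
qed

lemma ma_lipschitz_components:
  fixes G :: "'a::euclidean_space \<Rightarrow> 'a"
  assumes G: "\<And>a b. b \<in> Basis \<Longrightarrow> \<exists>M. ma_lipschitz a M L (\<lambda>x. G x \<bullet> b)"
  obtains r M where "0 < r" "\<And>b. b \<in> Basis \<Longrightarrow> ma_lipschitz_upto r a (M b) L (\<lambda>x. G x \<bullet> b)"
proof -
  have "\<forall>b. \<exists>M r. b \<in> Basis \<longrightarrow> 0 < r \<and> ma_lipschitz_upto r a M L (\<lambda>x. G x \<bullet> b)"
    using G[of _ a] unfolding ma_lipschitz_def by blast
  then obtain M r where Mr: "\<And>b. b \<in> Basis \<Longrightarrow> 0 < r b"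
    "\<And>b. b \<in> Basis \<Longrightarrow> ma_lipschitz_upto (r b) a (M b) L (\<lambda>x. G x \<bullet> b)"
    by metis
  let ?r = "Min (r ` (Basis :: 'a set))"
  have r: "0 < ?r" using Mr(1) by (subst Min_gr_iff) auto
  have rb: "?r \<le> r b" if "b \<in> Basis" for b using that by (intro Min_le) auto
  have "ma_lipschitz_upto ?r a (M b) L (\<lambda>x. G x \<bullet> b)" if b: "b \<in> Basis" for b
    using Mr(2)[OF b] order_trans[OF _ rb[OF b]] unfolding ma_lipschitz_upto_def by simp
  then show ?thesis using that r by blast
qed

section \<open>Analyticity of a perturbed identity and of its inverse\<close>

text \<open>Substituting the identity, a series of norm \<open>r\<close>, produces the expansion of
  \<open>G\<close> at \<open>a\<close>.\<close>

lemma real_analytic_perturbed_identity: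
  fixes G :: "'a::euclidean_space \<Rightarrow> 'a"
  assumes G: "\<And>a b. b \<in> Basis \<Longrightarrow> \<exists>M. ma_lipschitz a M L (\<lambda>x. G x \<bullet> b)"
  shows "real_analytic_on (\<lambda>x. x + G x) U"
proof (rule majorized_imp_real_analytic_on)
  fix a
  obtain r M where r: "0 < r" "\<And>b. b \<in> Basis \<Longrightarrow> ma_lipschitz_upto r a (M b) L (\<lambda>x. G x \<bullet> b)"
    using ma_lipschitz_components[OF G, of a] by blast
  have id: "vmajorized r (2 * r) (\<lambda>x. x)"
    using r(1) by (auto simp: vmajorized_def intro: majorized_mono[OF majorized_coord])
  have m: "majorized r (\<bar>a \<bullet> b\<bar> + r + M b) (\<lambda>x. (a + x + G (a + x)) \<bullet> b)" if b: "b \<in> Basis" for b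
    using r(1) b unfolding inner_add_left
    by (intro majorized_add majorized_const majorized_coord ma_lipschitz_uptoD(1)[OF r(2) _ _ id]) auto
  have "\<bar>a \<bullet> b\<bar> + r + M b \<le> (\<Sum>b\<in>Basis. \<bar>a \<bullet> b\<bar> + r + \<bar>M b\<bar>)" if b: "b \<in> Basis" for b
    using member_le_sum[OF b, of "\<lambda>b. \<bar>a \<bullet> b\<bar> + r + \<bar>M b\<bar>"] r(1) by auto
  then show "\<exists>\<rho>>0. \<exists>B. \<forall>b\<in>Basis. majorized \<rho> B (\<lambda>x. (a + x + G (a + x)) \<bullet> b)"
    using r(1) majorized_mono[OF m] by blast
qed

text \<open>The local correction to the inverse is a fixed point of a contraction on power series.
  Its limit there is an analytic function, which is then identified with the given inverse
  pointwise.\<close>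

lemma real_analytic_inverse_perturbed_identity:
  fixes G :: "'a::euclidean_space \<Rightarrow> 'a"
  assumes G: "\<And>a b. b \<in> Basis \<Longrightarrow> \<exists>M. ma_lipschitz a M L (\<lambda>x. G x \<bullet> b)"
    and L: "0 \<le> L" "L \<le> 1/2" and cont: "continuous_on UNIV G"
    and H: "\<And>x. H (x + G x) = x" "\<And>y. H y + G (H y) = y"
  shows "real_analytic_on H U"
proof (rule majorized_imp_real_analytic_on)
  fix y0
  define a where "a = H y0"
  obtain r M where r: "0 < r" "\<And>b. b \<in> Basis \<Longrightarrow> ma_lipschitz_upto r a (M b) L (\<lambda>x. G x \<bullet> b)"
    using ma_lipschitz_components[OF G, of a] by blast
  have diff: "vmajorized r (L * D) (\<lambda>x. G (a + u x) - G (a + v x))"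
    if "vmajorized r (2 * r) u" "vmajorized r (2 * r) v" "vmajorized r D (\<lambda>x. u x - v x)" for u v D
    using ma_lipschitz_uptoD(2)[OF r(2) r(1) order_refl that] unfolding vmajorized_def inner_diff_left by simp
  \<comment> \<open>With \<open>a = H y0\<close>, the function \<open>u x = H (y0 + x) - a\<close>
    should satisfy \<open>u x = x - (G (a + u x) - G a)\<close>; \<open>h\<close> is the fixed point
    iteration for this equation, started at 0.\<close>
  define h where "h = rec_nat (\<lambda>x::'a. 0::'a) (\<lambda>n u x. x - (G (a + u x) - G a))"
  have h0: "h 0 = (\<lambda>x. 0)" and hS: "h (Suc n) = (\<lambda>x. x - (G (a + h n x) - G a))" for n
    by (simp_all add: h_def)
  have z: "vmajorized r C (\<lambda>x. 0)" if "0 \<le> C" for C by (rule vmajorized_const) (use that in auto)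
  have le: "L * (2 * r) \<le> r" using L r(1) by (simp add: mult_left_le_one_le)
  \<comment> \<open>The identity contributes \<open>r\<close> and the correction at most
    \<open>L * (2 * r) \<le> r\<close>, so the iterates never leave the norm ball on which
    substitution is controlled.\<close>
  have hn: "vmajorized r (2 * r) (h n)" for n
  proof (induction n)
    case 0 show ?case using z[of "2*r"] r(1) by (simp add: h0)
  next
    case (Suc n)
    have "vmajorized r (L * (2 * r)) (\<lambda>x. G (a + h n x) - G (a + 0))"
      by (rule diff[OF Suc z]) (use Suc r(1) in auto)
    then have "majorized r (r + L * (2 * r)) (\<lambda>x. h (Suc n) x \<bullet> b)" if "b \<in> Basis" for b
      using majorized_diff[OF majorized_coord[OF that], of r "L * (2 * r)" "\<lambda>x. (G (a + h n x) - G (a + 0)) \<bullet> b"]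
        that r(1) by (simp add: hS inner_diff_left vmajorized_def)
    then show ?case unfolding vmajorized_def
      by (intro ballI) (rule majorized_mono, blast, use le in simp)
  qed
  have dn: "vmajorized r (r * (1/2) ^ n) (\<lambda>x. h (Suc n) x - h n x)" for n
  proof (induction n)
    case 0
    show ?case by (auto simp: hS h0 vmajorized_def intro: majorized_coord)
  next
    case (Suc n)
    have "vmajorized r (L * (r * (1/2) ^ n)) (\<lambda>x. G (a + h (Suc n) x) - G (a + h n x))"
      by (rule diff[OF hn hn Suc])
    moreover have "L * (r * (1/2) ^ n) \<le> r * (1/2) ^ Suc n"
      using mult_right_mono[OF L(2), of "r * (1/2) ^ n"] r(1) by simp
    ultimately have "majorized r (r * (1/2) ^ Suc n) (\<lambda>x. (G (a + h (Suc n) x) - G (a + h n x)) \<bullet> b)" if "b \<in> Basis" for b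
      using that unfolding vmajorized_def by (blast intro: majorized_mono)
    from majorized_uminus[OF this] show ?case
      using r(1) unfolding vmajorized_def hS[of "Suc n"] by (simp add: hS inner_diff_left algebra_simps)
  qed
  have geo: "(\<lambda>n. r * (1/2) ^ n) sums (r * 2)"
    using sums_mult[OF geometric_sums[of "1/2::real"], of r] by simp
  have "\<exists>u. vmajorized r (r * 2) u \<and> (\<forall>x\<in>box_at_0 r. (\<lambda>n. h n x) \<longlonglongrightarrow> u x)"
  proof (intro exI conjI ballI)
    \<comment> \<open>The limit is written as the telescoping series of the increments, whose norms
      form a geometric series with sum \<open>2 * r\<close>; this is the form that
      \<open>majorized_sums\<close> accepts.\<close>
    let ?u = "\<lambda>x. \<Sum>b\<in>Basis. (\<Sum>n. (h (Suc n) x - h n x) \<bullet> b) *\<^sub>R b"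
    have bs: "(\<lambda>n. (h (Suc n) x - h n x) \<bullet> b) sums (?u x \<bullet> b)" if b: "b \<in> Basis" and x: "x \<in> box_at_0 r" for b x
    proof -
      have "norm ((h (Suc n) x - h n x) \<bullet> b) \<le> r * (1/2) ^ n" for n
        using majorized_bound[of r "r * (1/2) ^ n" "\<lambda>x. (h (Suc n) x - h n x) \<bullet> b" x] dn[of n] b x r(1)
        by (auto simp: vmajorized_def)
      then have "summable (\<lambda>n. (h (Suc n) x - h n x) \<bullet> b)"
        by (intro summable_comparison_test[OF _ sums_summable[OF geo]]) auto
      then show ?thesis using b by (simp add: summable_sums)
    qed
    show "vmajorized r (r * 2) ?u"
      unfolding vmajorized_def
    proof
      fix b :: 'a assume b: "b \<in> Basis"
      show "majorized r (r * 2) (\<lambda>x. ?u x \<bullet> b)"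
        by (rule majorized_sums[OF _ _ geo bs[OF b]]) (use dn b r(1) in \<open>auto simp: vmajorized_def\<close>)
    qed
    fix x :: 'a assume x: "x \<in> box_at_0 r"
    have "(\<lambda>n. h n x \<bullet> b) \<longlonglongrightarrow> ?u x \<bullet> b" if b: "b \<in> Basis" for b
    proof -
      have "(\<Sum>i<n. (h (Suc i) x - h i x) \<bullet> b) = h n x \<bullet> b" for n
        using sum_lessThan_telescope[of "\<lambda>i. h i x \<bullet> b" n] by (simp add: inner_diff_left h0)
      then show ?thesis using bs[OF b x] by (simp add: sums_def)
    qed
    then show "(\<lambda>n. h n x) \<longlonglongrightarrow> ?u x" by (rule tendsto_componentwise_iff[THEN iffD2, rule_format])
  qed
  then obtain u where u: "vmajorized r (r * 2) u" "\<And>x. x \<in> box_at_0 r \<Longrightarrow> (\<lambda>n. h n x) \<longlonglongrightarrow> u x" by blast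
  have Hu: "H (y0 + x) = a + u x" if x: "x \<in> box_at_0 r" for x
  proof -
    \<comment> \<open>Continuity of \<open>G\<close> carries the iteration to the limit, so
      \<open>a + u x\<close> is a preimage of \<open>y0 + x\<close>; the left inverse property then
      identifies it with \<open>H (y0 + x)\<close>.\<close>
    have "isCont G (a + u x)" using cont by (simp add: continuous_on_eq_continuous_at)
    then have "(\<lambda>n. x - (G (a + h n x) - G a)) \<longlonglongrightarrow> x - (G (a + u x) - G a)"
      by (intro tendsto_intros isCont_tendsto_compose[of _ G] u x)
    moreover have "(\<lambda>n. h (Suc n) x) \<longlonglongrightarrow> u x" using u(2)[OF x] by (rule LIMSEQ_Suc)
    ultimately have "u x = x - (G (a + u x) - G a)" unfolding hS using LIMSEQ_unique by blast
    moreover have "a + G a = y0" using H(2)[of y0] by (simp add: a_def)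
    ultimately have "(a + u x) + G (a + u x) = y0 + x" by (metis add.assoc add.commute add_diff_cancel_left'
      diff_add_cancel diff_diff_eq2)
    then show ?thesis using H(1)[of "a + u x"] by simp
  qed
  have m: "majorized r (\<bar>a \<bullet> b\<bar> + r * 2) (\<lambda>x. H (y0 + x) \<bullet> b)" if b: "b \<in> Basis" for b
  proof (rule majorized_cong)
    show "majorized r (\<bar>a \<bullet> b\<bar> + r * 2) (\<lambda>x. a \<bullet> b + u x \<bullet> b)"
      using u(1) b r(1) by (intro majorized_add majorized_const) (auto simp: vmajorized_def)
  qed (simp add: Hu inner_add_left)
  have "\<bar>a \<bullet> b\<bar> + r * 2 \<le> norm a + r * 2" if "b \<in> Basis" for b using Basis_le_norm[OF that, of a] by simp
  then show "\<exists>\<rho>>0. \<exists>B. \<forall>b\<in>Basis. majorized \<rho> B (\<lambda>x. H (y0 + x) \<bullet> b)"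
    using r(1) majorized_mono[OF m] by blast
qed

subsection \<open>Homogeneous polynomials\<close>

text \<open>Building forms from linear factors and sums of equal degree makes estimates and
  derivatives accessible to rule induction, with the degree tracked throughout.\<close>

inductive hom_poly :: "nat \<Rightarrow> ('a::euclidean_space \<Rightarrow> real) \<Rightarrow> bool" where
  const: "hom_poly 0 (\<lambda>_. c)"
| lin_mult: "bounded_linear l \<Longrightarrow> hom_poly d p \<Longrightarrow> hom_poly (Suc d) (\<lambda>x. l x * p x)"
| add: "hom_poly d p \<Longrightarrow> hom_poly d q \<Longrightarrow> hom_poly d (\<lambda>x. p x + q x)"

lemma hom_poly_scale: "hom_poly d p \<Longrightarrow> p (c *\<^sub>R x) = c ^ d * p x"
  by (induction rule: hom_poly.induct) (simp_all add: algebra_simps linear_simps)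

lemma hom_poly_cmult: "hom_poly d p \<Longrightarrow> hom_poly d (\<lambda>x. c * p x)"
proof (induction rule: hom_poly.induct)
  case (lin_mult l d p)
  from hom_poly.lin_mult[OF lin_mult(1,3)] show ?case by (simp add: algebra_simps)
next
  case (add d p q)
  from hom_poly.add[OF add(3,4)] show ?case by (simp add: algebra_simps)
qed (auto intro: hom_poly.const)

lemma hom_poly_mult: "hom_poly d p \<Longrightarrow> hom_poly e q \<Longrightarrow> hom_poly (d + e) (\<lambda>x. p x * q x)"
proof (induction rule: hom_poly.induct)
  case (const c)
  then show ?case by (simp add: hom_poly_cmult)
next
  case (lin_mult l d p)
  from hom_poly.lin_mult[OF lin_mult(1) lin_mult(3)[OF lin_mult(4)]] show ?case by (simp add: mult.assoc)
next
  case (add d p q)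
  from hom_poly.add[OF add(3,4)[OF add(5)]] show ?case by (simp add: algebra_simps)
qed

lemma hom_poly_zero: "hom_poly d (\<lambda>_. 0)"
proof (induction d)
  case (Suc d)
  from hom_poly.lin_mult[OF bounded_linear_zero this] show ?case by simp
qed (rule hom_poly.const)

lemma hom_poly_sum: "(\<And>i. i \<in> I \<Longrightarrow> hom_poly d (p i)) \<Longrightarrow> hom_poly d (\<lambda>x. \<Sum>i\<in>I. p i x)"
  by (induction I rule: infinite_finite_induct) (auto intro: hom_poly_zero hom_poly.add)

lemma hom_poly_linear: "bounded_linear l \<Longrightarrow> hom_poly 1 l"
  using hom_poly.lin_mult[OF _ hom_poly.const[of 1]] by simp

lemma hom_poly_imp_real_polynomial_function: "hom_poly d p \<Longrightarrow> real_polynomial_function p"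
  by (induction rule: hom_poly.induct) auto

text \<open>A list of homogeneous pieces may repeat degrees, so a sum becomes concatenation and a
  product becomes the list of all pairwise products.\<close>

lemma real_polynomial_function_hom_poly_sum:
  fixes p :: "'a::euclidean_space \<Rightarrow> real"
  assumes "real_polynomial_function p"
  shows "\<exists>xs. (\<forall>(d,q)\<in>set xs. hom_poly d q) \<and> (\<forall>x. p x = (\<Sum>(d,q)\<leftarrow>xs. q x))"
  using assms
proof (induction rule: real_polynomial_function.induct)
  case (linear f)
  then show ?case by (intro exI[of _ "[(1, f)]"]) (simp add: hom_poly_linear[unfolded One_nat_def])
next
  case (const c)
  show ?case by (intro exI[of _ "[(0, \<lambda>_. c)]"]) (simp add: hom_poly.const)
next
  case (add f g)
  then obtain xs ys where "\<forall>(d,q)\<in>set xs. hom_poly d q" "\<forall>x. f x = (\<Sum>(d,q)\<leftarrow>xs. q x)"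
    "\<forall>(d,q)\<in>set ys. hom_poly d q" "\<forall>x. g x = (\<Sum>(d,q)\<leftarrow>ys. q x)" by blast
  then show ?case by (intro exI[of _ "xs @ ys"]) auto
next
  case (mult f g)
  then obtain xs ys where xs: "\<forall>(d,q)\<in>set xs. hom_poly d q" "\<forall>x. f x = (\<Sum>(d,q)\<leftarrow>xs. q x)"
    and ys: "\<forall>(d,q)\<in>set ys. hom_poly d q" "\<forall>x. g x = (\<Sum>(d,q)\<leftarrow>ys. q x)" by blast
  let ?m = "\<lambda>((d,q),(e,r)). (d + e, \<lambda>x. q x * r x)"
  have "(\<Sum>(d,q)\<leftarrow>map ?m (List.product xs ys). q x) = (\<Sum>(d,q)\<leftarrow>xs. q x) * (\<Sum>(d,q)\<leftarrow>ys. q x)" for x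
  proof (induction xs)
    case (Cons a xs)
    have "(\<Sum>(d,q)\<leftarrow>map ?m (map (Pair a) ys). q x) = snd a x * (\<Sum>(d,q)\<leftarrow>ys. q x)"
      by (induction ys) (auto simp: case_prod_unfold algebra_simps)
    with Cons show ?case by (simp add: case_prod_unfold algebra_simps)
  qed simp
  then show ?case using xs ys
    by (intro exI[of _ "map ?m (List.product xs ys)"]) (auto intro: hom_poly_mult)
qed

text \<open>Comparing the coefficients of \<open>t\<close> in \<open>p (t x) = t\<^sup>m p x\<close> singles out the terms of degree \<open>m\<close>.\<close>

lemma homogeneous_real_polynomial_imp_hom_poly:
  fixes p :: "'a::euclidean_space \<Rightarrow> real"
  assumes "real_polynomial_function p" and hom: "\<And>c x. p (c *\<^sub>R x) = c ^ m * p x"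
  shows "hom_poly m p"
proof -
  obtain xs where xs: "\<forall>(d,q)\<in>set xs. hom_poly d q" "\<forall>x. p x = (\<Sum>(d,q)\<leftarrow>xs. q x)"
    using real_polynomial_function_hom_poly_sum[OF assms(1)] by blast
  let ?P = "\<lambda>ys x. (\<Sum>(d,q)\<leftarrow>ys. monom (q x) d)"
  let ?F = "filter (\<lambda>(d,q). d = m)"
  have ev: "poly (?P ys x) t = (\<Sum>(d,q)\<leftarrow>ys. q (t *\<^sub>R x))" if "\<forall>(d,q)\<in>set ys. hom_poly d q" for ys x t
    using that by (induction ys) (auto simp: hom_poly_scale poly_monom)
  then have "poly (?P xs x) t = poly (monom (p x) m) t" for x t
    using ev[OF xs(1), of x t] xs(2)[rule_format, of "t *\<^sub>R x"] hom[of t x]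
    by (simp only: poly_monom mult.commute)
  then have eq: "?P xs x = monom (p x) m" for x by (simp add: poly_eq_poly_eq_iff[symmetric] fun_eq_iff)
  have "coeff (?P ys x) m = (\<Sum>(d,q)\<leftarrow>?F ys. q x)" for ys :: "(nat \<times> ('a \<Rightarrow> real)) list" and x
    by (induction ys) auto
  then have p: "p = (\<lambda>x. \<Sum>(d,q)\<leftarrow>?F xs. q x)" using eq by (metis coeff_monom)
  have "hom_poly m (\<lambda>x. \<Sum>(d,q)\<leftarrow>?F ys. q x)" if "\<forall>(d,q)\<in>set ys. hom_poly d q" for ys
    using that by (induction ys) (auto intro: hom_poly_zero hom_poly.add)
  then show ?thesis unfolding p using xs(1) .
qed

text \<open>Values and differences are bounded together because the product rule for a linear factor
  needs both, and a common radius \<open>R\<close> lets the two points share one bound.\<close>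

lemma hom_poly_bounds:
  fixes p :: "'a::euclidean_space \<Rightarrow> real"
  assumes "hom_poly d p"
  shows "\<exists>C\<ge>0. \<forall>R x y. norm x \<le> R \<longrightarrow> norm y \<le> R \<longrightarrow>
    \<bar>p x\<bar> \<le> C * R ^ d \<and> \<bar>p x - p y\<bar> \<le> C * real d * R ^ (d - 1) * norm (x - y)"
  using assms
proof (induction rule: hom_poly.induct)
  case (const c)
  show ?case by (rule exI[of _ "\<bar>c\<bar>"]) auto
next
  case (lin_mult l d p)
  then obtain C where C: "C \<ge> 0" "\<And>R (x::'a) (y::'a). norm x \<le> R \<Longrightarrow> norm y \<le> R \<Longrightarrow> \<bar>p x\<bar> \<le> C * R ^ d"
    "\<And>R (x::'a) (y::'a). norm x \<le> R \<Longrightarrow> norm y \<le> R \<Longrightarrow> \<bar>p x - p y\<bar> \<le> C * real d * R ^ (d - 1) * norm (x - y)" by blast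
  interpret bounded_linear l by fact
  obtain M where M: "M > 0" "\<And>x. \<bar>l x\<bar> \<le> norm x * M" using pos_bounded by auto
  show ?case
  proof (intro exI[of _ "M * C"] conjI allI impI)
    fix R :: real and x y :: 'a assume xy: "norm x \<le> R" "norm y \<le> R"
    then have R: "0 \<le> R" using norm_ge_zero order_trans by blast
    have lx: "\<bar>l x\<bar> \<le> R * M" using M(2)[of x] mult_right_mono[OF xy(1), of M] M(1) by linarith
    have "\<bar>l x * p x\<bar> \<le> (R * M) * (C * R ^ d)"
      unfolding abs_mult using lx C(2)[OF xy] R M(1) by (intro mult_mono) auto
    then show "\<bar>l x * p x\<bar> \<le> M * C * R ^ Suc d" by (simp add: algebra_simps)
    have "l x * p x - l y * p y = l x * (p x - p y) + l (x - y) * p y"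
      by (simp add: diff algebra_simps)
    also have "\<bar>\<dots>\<bar> \<le> \<bar>l x\<bar> * \<bar>p x - p y\<bar> + \<bar>l (x - y)\<bar> * \<bar>p y\<bar>"
      by (metis abs_mult abs_triangle_ineq)
    also have "\<dots> \<le> (R * M) * (C * real d * R ^ (d - 1) * norm (x - y)) + (norm (x - y) * M) * (C * R ^ d)"
      using lx C(3)[OF xy] C(2)[OF xy(2,1)] M(2)[of "x - y"] M(1) R C(1) by (intro add_mono mult_mono) auto
    also have "\<dots> = M * C * real (Suc d) * R ^ (Suc d - 1) * norm (x - y)"
      by (cases d) (auto simp: algebra_simps)
    finally show "\<bar>l x * p x - l y * p y\<bar> \<le> M * C * real (Suc d) * R ^ (Suc d - 1) * norm (x - y)" .
  qed (use C M in auto)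
next
  case (add d p q)
  then obtain C where C: "C \<ge> 0" "\<And>R (x::'a) (y::'a). norm x \<le> R \<Longrightarrow> norm y \<le> R \<Longrightarrow> \<bar>p x\<bar> \<le> C * R ^ d"
    "\<And>R (x::'a) (y::'a). norm x \<le> R \<Longrightarrow> norm y \<le> R \<Longrightarrow> \<bar>p x - p y\<bar> \<le> C * real d * R ^ (d - 1) * norm (x - y)" by blast
  from add obtain D where D: "D \<ge> 0" "\<And>R (x::'a) (y::'a). norm x \<le> R \<Longrightarrow> norm y \<le> R \<Longrightarrow> \<bar>q x\<bar> \<le> D * R ^ d"
    "\<And>R (x::'a) (y::'a). norm x \<le> R \<Longrightarrow> norm y \<le> R \<Longrightarrow> \<bar>q x - q y\<bar> \<le> D * real d * R ^ (d - 1) * norm (x - y)" by blast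
  show ?case
  proof (intro exI[of _ "C + D"] conjI allI impI)
    fix R :: real and x y :: 'a assume xy: "norm x \<le> R" "norm y \<le> R"
    show "\<bar>p x + q x\<bar> \<le> (C + D) * R ^ d" using C(2)[OF xy] D(2)[OF xy] by (simp add: algebra_simps)
    show "\<bar>p x + q x - (p y + q y)\<bar> \<le> (C + D) * real d * R ^ (d - 1) * norm (x - y)"
      using C(3)[OF xy] D(3)[OF xy] by (simp add: algebra_simps)
  qed (use C D in auto)
qed

lemma hom_poly_smooth: "hom_poly d p \<Longrightarrow> smooth p"
  by (induction rule: hom_poly.induct) (auto intro: smooth_const smooth_mult smooth_add smooth_bounded_linear)

text \<open>For \<open>d = 0\<close> the truncated \<open>d - 1\<close> is 0 again, which would give
  the wrong degree for \<open>l\<close> times the derivative in the product rule. The second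
  conjunct settles this case: the derivative is zero, and zero has every degree.\<close>

lemma hom_poly_deriv:
  assumes "hom_poly d p"
  shows "hom_poly (d - 1) (\<lambda>x. frechet_derivative p (at x) v) \<and>
    (d = 0 \<longrightarrow> (\<forall>x. frechet_derivative p (at x) v = 0))"
  using assms
proof (induction rule: hom_poly.induct)
  case (const c)
  have "frechet_derivative (\<lambda>_::'a. c) (at x) = (\<lambda>_. 0)" for x
    by (rule frechet_derivative_at[symmetric]) (rule has_derivative_const)
  then show ?case by (simp add: hom_poly.const)
next
  case (lin_mult l d p)
  have eq: "frechet_derivative (\<lambda>x. l x * p x) (at x) v = l v * p x + l x * frechet_derivative p (at x) v" for x
  proof -
    have "((\<lambda>x. l x * p x) has_derivative (\<lambda>v. l x * frechet_derivative p (at x) v + l v * p x)) (at x)"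
      by (intro has_derivative_mult bounded_linear_imp_has_derivative lin_mult(1) smooth_has_derivative
          hom_poly_smooth[OF lin_mult(2)])
    from fun_cong[OF frechet_derivative_at[OF this], of v] show ?thesis by (simp add: add.commute)
  qed
  have "hom_poly d (\<lambda>x. l x * frechet_derivative p (at x) v)"
  proof (cases d)
    case 0
    with lin_mult(3) show ?thesis by (simp add: hom_poly_zero)
  next
    case (Suc e)
    with hom_poly.lin_mult[OF lin_mult(1)] lin_mult(3) show ?thesis by simp
  qed
  then show ?case unfolding eq by (simp add: hom_poly.add hom_poly_cmult lin_mult(2))
next
  case (add d p q)
  have eq: "frechet_derivative (\<lambda>x. p x + q x) (at x) v = frechet_derivative p (at x) v + frechet_derivative q (at x) v" for x
  proof -
    have "((\<lambda>x. p x + q x) has_derivative (\<lambda>v. frechet_derivative p (at x) v + frechet_derivative q (at x) v)) (at x)"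
      by (intro has_derivative_add smooth_has_derivative hom_poly_smooth[OF add(1)] hom_poly_smooth[OF add(2)])
    from fun_cong[OF frechet_derivative_at[OF this], of v] show ?thesis by simp
  qed
  show ?case unfolding eq using add(3,4) by (simp add: hom_poly.add)
qed

section \<open>The sine truncation of polynomials\<close>

definition sine_map :: "real \<Rightarrow> 'a::euclidean_space \<Rightarrow> 'a"
  where "sine_map \<delta> x = (\<Sum>b\<in>Basis. (\<delta> * sin ((x \<bullet> b) / \<delta>)) *\<^sub>R b)"

text \<open>At every centre the coordinates of \<open>sine_map \<delta>\<close> have size of order
  \<open>\<delta>\<close> and Lipschitz constant 2, so a form of degree \<open>d\<close> scales like
  \<open>\<delta> ^ d\<close> and its Lipschitz constant like \<open>\<delta> ^ (d - 1)\<close>.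
  \<open>P\<close> is a selection of coordinates, such as the passage from the state of all cells to
  the inputs of one cell; \<open>C\<close> does not depend on \<open>\<delta>\<close>,
  \<open>P\<close> or \<open>a\<close>.\<close>

lemma hom_poly_sine_map_ma_lipschitz:
  fixes p :: "'b::euclidean_space \<Rightarrow> real"
  assumes "hom_poly d p"
  shows "\<exists>C\<ge>0. \<forall>\<delta>>0. \<forall>P. (\<forall>B\<in>Basis. \<exists>b\<in>Basis. \<forall>x::'a::euclidean_space. P x \<bullet> B = x \<bullet> b) \<longrightarrow>
    (\<forall>a. ma_lipschitz a (C * \<delta> ^ d) (C * real d * \<delta> ^ (d - 1)) (\<lambda>x. p (sine_map \<delta> (P x))))"
  using assms
proof (induction rule: hom_poly.induct)
  case (const c)
  show ?case using ma_lipschitz_const[of _ c] by (intro exI[of _ "\<bar>c\<bar>"]) auto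
next
  case (lin_mult l d p)
  let ?Q = "\<lambda>P. \<forall>B\<in>Basis. \<exists>b\<in>Basis. \<forall>x::'a. (P x :: 'b) \<bullet> B = x \<bullet> b"
  from lin_mult obtain C where C: "C \<ge> 0" "\<And>\<delta> P a. \<delta> > 0 \<Longrightarrow> ?Q P \<Longrightarrow>
    ma_lipschitz a (C * \<delta> ^ d) (C * real d * \<delta> ^ (d - 1)) (\<lambda>x. p (sine_map \<delta> (P x)))" by blast
  \<comment> \<open>Each coordinate of the sine map contributes size \<open>2 * \<delta>\<close> and
    Lipschitz constant 2, weighted by the coefficient of the linear form.\<close>
  define M where "M = (\<Sum>B\<in>Basis. \<bar>l B\<bar> * 2)"
  have M: "M \<ge> 0" by (auto simp: M_def intro: sum_nonneg)
  have l: "ma_lipschitz a (M * \<delta>) M (\<lambda>x. l (sine_map \<delta> (P x)))" if \<delta>: "\<delta> > 0" and P: "?Q P" for \<delta> P a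
  proof -
    interpret bounded_linear l by fact
    have eq: "l (sine_map \<delta> (P x)) = (\<Sum>B\<in>Basis. l B * (\<delta> * sin ((P x \<bullet> B) / \<delta>)))" for x
      by (simp add: sine_map_def sum scale mult.commute)
    have "ma_lipschitz a (2 * \<delta>) 2 (\<lambda>x. \<delta> * sin ((P x \<bullet> B) / \<delta>))" if "B \<in> Basis" for B
    proof -
      from bspec[OF P that] obtain b where b: "b \<in> Basis" "\<forall>x. P x \<bullet> B = x \<bullet> b" by (elim bexE)
      have "(\<lambda>x. \<delta> * sin ((P x \<bullet> B) / \<delta>)) = (\<lambda>x. \<delta> * sin ((x \<bullet> b) / \<delta>))"
        by (simp only: b(2)[rule_format])
      with ma_lipschitz_sin[OF b(1) \<delta>] show ?thesis by simp
    qed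
    then have "ma_lipschitz a (\<Sum>B\<in>Basis. \<bar>l B\<bar> * (2 * \<delta>)) (\<Sum>B\<in>Basis. \<bar>l B\<bar> * 2) (\<lambda>x. l (sine_map \<delta> (P x)))"
      unfolding eq by (intro ma_lipschitz_sum ma_lipschitz_cmult) auto
    then show ?thesis by (simp add: M_def sum_distrib_right mult.assoc)
  qed
  show ?case
  proof (intro exI[of _ "M * C"] conjI allI impI)
    fix \<delta> :: real and P a assume A: "0 < \<delta>" "?Q P"
    have "M * \<delta> * (C * real d * \<delta> ^ (d - 1)) + M * (C * \<delta> ^ d) = M * C * real (Suc d) * \<delta> ^ (Suc d - 1)"
      by (cases d) (auto simp: algebra_simps)
    moreover have "M * \<delta> * (C * \<delta> ^ d) = M * C * \<delta> ^ Suc d" by simp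
    moreover note ma_lipschitz_mult[OF l[OF A] C(2)[OF A], of a]
    ultimately show "ma_lipschitz a (M * C * \<delta> ^ Suc d) (M * C * real (Suc d) * \<delta> ^ (Suc d - 1))
            (\<lambda>x. l (sine_map \<delta> (P x)) * p (sine_map \<delta> (P x)))"
      by (simp only:)
  qed (use C M in auto)
next
  case (add d p q)
  let ?Q = "\<lambda>P. \<forall>B\<in>Basis. \<exists>b\<in>Basis. \<forall>x::'a. (P x :: 'b) \<bullet> B = x \<bullet> b"
  from add(3) obtain C where C: "C \<ge> 0" and C': "\<forall>\<delta>>0. \<forall>P. ?Q P \<longrightarrow>
    (\<forall>a. ma_lipschitz a (C * \<delta> ^ d) (C * real d * \<delta> ^ (d - 1)) (\<lambda>x. p (sine_map \<delta> (P x))))"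
    by (elim exE conjE)
  from add(4) obtain D where D: "D \<ge> 0" and D': "\<forall>\<delta>>0. \<forall>P. ?Q P \<longrightarrow>
    (\<forall>a. ma_lipschitz a (D * \<delta> ^ d) (D * real d * \<delta> ^ (d - 1)) (\<lambda>x. q (sine_map \<delta> (P x))))"
    by (elim exE conjE)
  show ?case
  proof (intro exI[of _ "C + D"] conjI allI impI)
    fix \<delta> :: real and P a assume A: "0 < \<delta>" "?Q P"
    show "ma_lipschitz a ((C + D) * \<delta> ^ d) ((C + D) * real d * \<delta> ^ (d - 1))
            (\<lambda>x. p (sine_map \<delta> (P x)) + q (sine_map \<delta> (P x)))"
      using ma_lipschitz_add[OF C'[THEN spec, THEN mp, OF A(1), THEN spec, THEN mp, OF A(2), THEN spec, of a]
        D'[THEN spec, THEN mp, OF A(1), THEN spec, THEN mp, OF A(2), THEN spec, of a]]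
      by (simp only: distrib_right)
  qed (use C D in auto)
qed

lemma smooth_sine_map: "smooth (sine_map \<delta>)"
proof -
  have "smooth (\<lambda>x::'a. (\<delta> * sin ((1/\<delta>) * (x \<bullet> b) + 0)) *\<^sub>R b)" for b
    by (intro smooth_scaleR smooth_mult smooth_const)
      (simp only: smooth_def, intro allI C_k_sin bounded_linear_const_mult bounded_linear_inner_left)
  then have "smooth (\<lambda>x::'a. \<Sum>b\<in>Basis. (\<delta> * sin ((x \<bullet> b) / \<delta>)) *\<^sub>R b)"
    by (intro smooth_sum) simp
  then show ?thesis by (simp add: sine_map_def[abs_def])
qed

lemma sine_map_0: "sine_map \<delta> 0 = 0"
  by (simp add: sine_map_def)

lemma sine_map_deriv_0:
  assumes "\<delta> \<noteq> 0"
  shows "(sine_map \<delta> has_derivative (\<lambda>v. v)) (at 0)"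
proof -
  have "((\<lambda>x::'a. (\<delta> * sin ((x \<bullet> b) / \<delta>)) *\<^sub>R b) has_derivative (\<lambda>v. (v \<bullet> b) *\<^sub>R b)) (at 0)" for b
    using assms by (auto intro!: derivative_eq_intros)
  then have "((\<lambda>x::'a. \<Sum>b\<in>Basis. (\<delta> * sin ((x \<bullet> b) / \<delta>)) *\<^sub>R b) has_derivative (\<lambda>v. \<Sum>b\<in>Basis. (v \<bullet> b) *\<^sub>R b)) (at 0)"
    by (intro has_derivative_sum)
  then show ?thesis by (simp add: sine_map_def[abs_def] euclidean_representation)
qed

subsection \<open>Taylor terms\<close>

definition vhom_poly :: "nat \<Rightarrow> ('a::euclidean_space \<Rightarrow> 'b::euclidean_space) \<Rightarrow> bool"
  where "vhom_poly d p \<longleftrightarrow> (\<forall>b\<in>Basis. hom_poly d (\<lambda>x. p x \<bullet> b))"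

lemma homogeneous_polys_iff: "p \<in> homogeneous_polys k \<longleftrightarrow> vhom_poly (k + 1) p"
proof
  assume p: "p \<in> homogeneous_polys k"
  show "vhom_poly (k + 1) p"
    unfolding vhom_poly_def
  proof
    fix b :: 'b assume "b \<in> Basis"
    show "hom_poly (k + 1) (\<lambda>x. p x \<bullet> b)"
    proof (rule homogeneous_real_polynomial_imp_hom_poly)
      show "real_polynomial_function (\<lambda>x. p x \<bullet> b)"
        using p bounded_linear_inner_left[of b] by (auto simp: homogeneous_polys_def polynomial_function_def o_def)
    qed (use p in \<open>simp add: homogeneous_polys_def\<close>)
  qed
next
  assume p: "vhom_poly (k + 1) p"
  have "polynomial_function p"
    unfolding polynomial_function_iff_Basis_inner
    using p hom_poly_imp_real_polynomial_function unfolding vhom_poly_def by blast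
  moreover have "p (c *\<^sub>R x) = c ^ (k + 1) *\<^sub>R p x" for c x
  proof (rule euclidean_eqI)
    fix b :: 'b assume b: "b \<in> Basis"
    then have "hom_poly (k + 1) (\<lambda>x. p x \<bullet> b)" using p by (simp only: vhom_poly_def)
    from hom_poly_scale[OF this] show "p (c *\<^sub>R x) \<bullet> b = c ^ (k + 1) *\<^sub>R p x \<bullet> b" by simp
  qed
  ultimately show "p \<in> homogeneous_polys k" by (simp add: homogeneous_polys_def)
qed

lemma vhom_poly_smooth: "vhom_poly d p \<Longrightarrow> smooth p"
  unfolding vhom_poly_def by (rule smooth_componentwise) (rule hom_poly_smooth, erule bspec)

lemma vhom_poly_lipschitz:
  fixes p :: "'a::euclidean_space \<Rightarrow> 'b::euclidean_space"
  assumes "vhom_poly d p"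
  obtains C where "C \<ge> 0" "\<And>R x y. norm x \<le> R \<Longrightarrow> norm y \<le> R \<Longrightarrow> norm (p x - p y) \<le> C * R ^ (d - 1) * norm (x - y)"
    "\<And>x. norm (p x) \<le> C * norm x ^ d"
proof -
  have "\<forall>b. \<exists>C. b \<in> Basis \<longrightarrow> C \<ge> 0 \<and> (\<forall>R x y. norm x \<le> R \<longrightarrow> norm y \<le> R \<longrightarrow>
    \<bar>p x \<bullet> b\<bar> \<le> C * R ^ d \<and> \<bar>p x \<bullet> b - p y \<bullet> b\<bar> \<le> C * real d * R ^ (d - 1) * norm (x - y))"
    using hom_poly_bounds assms unfolding vhom_poly_def by blast
  then obtain C where "\<forall>b. b \<in> Basis \<longrightarrow> C b \<ge> 0 \<and> (\<forall>R x y. norm x \<le> R \<longrightarrow> norm y \<le> R \<longrightarrow>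
    \<bar>p x \<bullet> b\<bar> \<le> C b * R ^ d \<and> \<bar>p x \<bullet> b - p y \<bullet> b\<bar> \<le> C b * real d * R ^ (d - 1) * norm (x - y))"
    unfolding choice_iff by (elim exE)
  then have C: "\<And>b. b \<in> Basis \<Longrightarrow> C b \<ge> 0"
    "\<And>b R (x::'a). b \<in> Basis \<Longrightarrow> norm x \<le> R \<Longrightarrow> \<bar>p x \<bullet> b\<bar> \<le> C b * R ^ d"
    "\<And>b R x y. b \<in> Basis \<Longrightarrow> norm x \<le> R \<Longrightarrow> norm y \<le> R \<Longrightarrow> \<bar>p x \<bullet> b - p y \<bullet> b\<bar> \<le> C b * real d * R ^ (d - 1) * norm (x - y)"
    by blast+
  have S: "sum C Basis \<ge> 0" using C(1) by (rule sum_nonneg)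
  \<comment> \<open>The factor \<open>Suc d\<close> dominates both \<open>d\<close>, from the
    Lipschitz bound, and 1, from the bound on values.\<close>
  let ?C = "sum C Basis * real (Suc d)"
  show ?thesis
  proof (rule that[of ?C])
    show "?C \<ge> 0" using S by simp
    fix R :: real and x y :: 'a assume xy: "norm x \<le> R" "norm y \<le> R"
    then have R: "0 \<le> R" using norm_ge_zero order_trans by blast
    have "norm (p x - p y) \<le> (\<Sum>b\<in>Basis. \<bar>(p x - p y) \<bullet> b\<bar>)" by (rule norm_le_l1)
    also have "\<dots> \<le> (\<Sum>b\<in>Basis. C b * real d * R ^ (d - 1) * norm (x - y))"
      using C(3) xy by (intro sum_mono) (auto simp: inner_diff_left)
    also have "\<dots> = sum C Basis * real d * R ^ (d - 1) * norm (x - y)"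
      by (simp add: sum_distrib_right)
    also have "\<dots> \<le> ?C * R ^ (d - 1) * norm (x - y)"
      using S R by (intro mult_right_mono mult_left_mono) auto
    finally show "norm (p x - p y) \<le> ?C * R ^ (d - 1) * norm (x - y)" .
  next
    fix x :: 'a
    have "norm (p x) \<le> (\<Sum>b\<in>Basis. \<bar>p x \<bullet> b\<bar>)" by (rule norm_le_l1)
    also have "\<dots> \<le> (\<Sum>b\<in>Basis. C b * norm x ^ d)"
      using C(2) by (intro sum_mono) auto
    also have "\<dots> = sum C Basis * 1 * norm x ^ d" by (simp add: sum_distrib_right)
    also have "\<dots> \<le> ?C * norm x ^ d"
      using S by (intro mult_right_mono mult_left_mono) auto
    finally show "norm (p x) \<le> ?C * norm x ^ d" .
  qed
qed

lemma vhom_poly_deriv: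
  assumes "vhom_poly d p" shows "vhom_poly (d - 1) (\<lambda>x. frechet_derivative p (at x) v)"
  unfolding vhom_poly_def
proof
  fix b :: 'b assume b: "b \<in> Basis"
  have "frechet_derivative (\<lambda>x. p x \<bullet> b) (at x) v = frechet_derivative p (at x) v \<bullet> b" for x
  proof -
    have "((\<lambda>x. p x \<bullet> b) has_derivative (\<lambda>v. frechet_derivative p (at x) v \<bullet> b)) (at x)"
      by (intro has_derivative_inner_left smooth_has_derivative vhom_poly_smooth[OF assms])
    from fun_cong[OF frechet_derivative_at[OF this], of v] show ?thesis by simp
  qed
  then show "hom_poly (d - 1) (\<lambda>x. frechet_derivative p (at x) v \<bullet> b)"
    using hom_poly_deriv[of d "\<lambda>x. p x \<bullet> b" v] assms b by (simp add: vhom_poly_def)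
qed

lemma vhom_poly_deriv_bounds:
  fixes p :: "'a::euclidean_space \<Rightarrow> 'b::euclidean_space"
  assumes "vhom_poly (Suc d) p"
  obtains C where "C \<ge> 0" "\<And>x v. norm (frechet_derivative p (at x) v) \<le> C * norm x ^ d * norm v"
    "\<And>R x y v. norm x \<le> R \<Longrightarrow> norm y \<le> R \<Longrightarrow>
      norm (frechet_derivative p (at x) v - frechet_derivative p (at y) v) \<le> C * R ^ (d - 1) * norm (x - y) * norm v"
proof -
  let ?D = "\<lambda>x. frechet_derivative p (at x)"
  note lin = linear_basis_expansion[OF smooth_deriv_linear[OF vhom_poly_smooth[OF assms]]]
  have "\<forall>b. \<exists>C. C \<ge> 0 \<and> (\<forall>R x y. norm x \<le> R \<longrightarrow> norm y \<le> R \<longrightarrow> norm (?D x b - ?D y b) \<le> C * R ^ (d - 1) * norm (x - y))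
    \<and> (\<forall>x. norm (?D x b) \<le> C * norm x ^ d)"
  proof
    fix b
    from vhom_poly_deriv[OF assms, of b] have "vhom_poly d (\<lambda>x. ?D x b)" by simp
    from vhom_poly_lipschitz[OF this]
    show "\<exists>C. C \<ge> 0 \<and> (\<forall>R x y. norm x \<le> R \<longrightarrow> norm y \<le> R \<longrightarrow> norm (?D x b - ?D y b) \<le> C * R ^ (d - 1) * norm (x - y))
      \<and> (\<forall>x. norm (?D x b) \<le> C * norm x ^ d)" by metis
  qed
  then obtain C where "\<forall>b. C b \<ge> 0 \<and> (\<forall>R x y. norm x \<le> R \<longrightarrow> norm y \<le> R \<longrightarrow> norm (?D x b - ?D y b) \<le> C b * R ^ (d - 1) * norm (x - y))
    \<and> (\<forall>x. norm (?D x b) \<le> C b * norm x ^ d)"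
    unfolding choice_iff by (elim exE)
  then have C: "\<And>b. C b \<ge> 0"
    "\<And>b R x y. norm x \<le> R \<Longrightarrow> norm y \<le> R \<Longrightarrow> norm (?D x b - ?D y b) \<le> C b * R ^ (d - 1) * norm (x - y)"
    "\<And>b x. norm (?D x b) \<le> C b * norm x ^ d" by blast+
  show ?thesis
  proof (rule that[of "sum C Basis"])
    show "sum C Basis \<ge> 0" using C(1) by (simp add: sum_nonneg)
    fix x v
    have "norm (?D x v) \<le> (\<Sum>b\<in>Basis. norm ((v \<bullet> b) *\<^sub>R ?D x b))"
      by (subst lin) (rule norm_sum)
    also have "\<dots> \<le> (\<Sum>b\<in>Basis. norm v * (C b * norm x ^ d))"
      using C(3) by (intro sum_mono) (auto intro!: mult_mono Basis_le_norm)
    finally show "norm (?D x v) \<le> sum C Basis * norm x ^ d * norm v"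
      by (simp add: sum_distrib_left sum_distrib_right mult_ac)
  next
    fix R :: real and x y v :: 'a assume xy: "norm x \<le> R" "norm y \<le> R"
    have "?D x v - ?D y v = (\<Sum>b\<in>Basis. (v \<bullet> b) *\<^sub>R (?D x b - ?D y b))"
      unfolding lin[of _ v] by (simp add: scaleR_diff_right sum_subtractf)
    also have "norm \<dots> \<le> (\<Sum>b\<in>Basis. norm ((v \<bullet> b) *\<^sub>R (?D x b - ?D y b)))" by (rule norm_sum)
    also have "\<dots> \<le> (\<Sum>b\<in>Basis. norm v * (C b * R ^ (d - 1) * norm (x - y)))"
      using C(2)[OF xy] by (intro sum_mono) (auto intro!: mult_mono Basis_le_norm)
    finally show "norm (?D x v - ?D y v) \<le> sum C Basis * R ^ (d - 1) * norm (x - y) * norm v"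
      by (simp add: sum_distrib_left sum_distrib_right mult_ac)
  qed
qed

section \<open>Iterated directional derivatives and Taylor coefficients\<close>

abbreviation dird :: "'a::real_normed_vector \<Rightarrow> ('a \<Rightarrow> 'b::real_normed_vector) \<Rightarrow> 'a \<Rightarrow> 'b"
  where "dird x \<equiv> \<lambda>g y. frechet_derivative g (at y) x"

lemma smooth_dird_funpow: "smooth f \<Longrightarrow> smooth ((dird x ^^ j) f)"
  by (induction j) (auto intro: smooth_deriv)

lemma dird_funpow_add:
  assumes "smooth f" "smooth g"
  shows "(dird x ^^ j) (\<lambda>y. f y + g y) = (\<lambda>y. (dird x ^^ j) f y + (dird x ^^ j) g y)"
proof (induction j)
  case (Suc j)
  have "frechet_derivative (\<lambda>y. (dird x ^^ j) f y + (dird x ^^ j) g y) (at y) x =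
      frechet_derivative ((dird x ^^ j) f) (at y) x + frechet_derivative ((dird x ^^ j) g) (at y) x" for y
  proof -
    have "((\<lambda>y. (dird x ^^ j) f y + (dird x ^^ j) g y) has_derivative
      (\<lambda>v. frechet_derivative ((dird x ^^ j) f) (at y) v + frechet_derivative ((dird x ^^ j) g) (at y) v)) (at y)"
      by (intro has_derivative_add smooth_has_derivative smooth_dird_funpow assms)
    from fun_cong[OF frechet_derivative_at[OF this], of x] show ?thesis by simp
  qed
  then show ?case by (simp add: Suc)
qed simp

lemma dird_funpow_scaleR:
  assumes "smooth f"
  shows "(dird x ^^ j) (\<lambda>y. c *\<^sub>R f y) = (\<lambda>y. c *\<^sub>R (dird x ^^ j) f y)"
proof (induction j)
  case (Suc j)
  have "frechet_derivative (\<lambda>y. c *\<^sub>R (dird x ^^ j) f y) (at y) x = c *\<^sub>R frechet_derivative ((dird x ^^ j) f) (at y) x" for y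
  proof -
    have "((\<lambda>y. c *\<^sub>R (dird x ^^ j) f y) has_derivative (\<lambda>v. c *\<^sub>R frechet_derivative ((dird x ^^ j) f) (at y) v)) (at y)"
      by (intro has_derivative_scaleR_right smooth_has_derivative smooth_dird_funpow assms)
    from fun_cong[OF frechet_derivative_at[OF this], of x] show ?thesis by simp
  qed
  then show ?case by (simp add: Suc)
qed simp

lemma dird_zero: "dird x (\<lambda>y. 0) = (\<lambda>y. 0)"
proof
  fix y
  show "frechet_derivative (\<lambda>y. 0) (at y) x = 0"
    using fun_cong[OF frechet_derivative_at[OF has_derivative_const[of 0 "at y"]], of x] by simp
qed

lemma dird_funpow_zero: "(dird x ^^ j) (\<lambda>y. 0) = (\<lambda>y. 0)"
  by (induction j) (simp_all add: dird_zero)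

lemma dird_funpow_sum:
  assumes "finite I" "\<And>i. i \<in> I \<Longrightarrow> smooth (f i)"
  shows "(dird x ^^ j) (\<lambda>y. \<Sum>i\<in>I. f i y) = (\<lambda>y. \<Sum>i\<in>I. (dird x ^^ j) (f i) y)"
  using assms
  by (induction I rule: finite_induct) (simp_all add: dird_funpow_zero dird_funpow_add smooth_sum)

text \<open>The direction \<open>x\<close> enters once per derivative. Expanding it in the basis in
  the innermost derivative yields a linear factor in \<open>x\<close> times a lower iterate of
  \<open>dird b f\<close>, which is why the induction generalises over \<open>f\<close>.\<close>

lemma vhom_poly_dird_funpow:
  fixes f :: "'a::euclidean_space \<Rightarrow> 'b::euclidean_space"
  shows "smooth f \<Longrightarrow> vhom_poly j (\<lambda>x. (dird x ^^ j) f y)"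
proof (induction j arbitrary: f)
  case 0
  then show ?case by (simp add: vhom_poly_def hom_poly.const)
next
  case (Suc j)
  have "(dird x ^^ Suc j) f = (\<lambda>y. \<Sum>b\<in>Basis. (x \<bullet> b) *\<^sub>R (dird x ^^ j) (dird b f) y)" for x
  proof -
    have "dird x f = (\<lambda>y. \<Sum>b\<in>Basis. (x \<bullet> b) *\<^sub>R dird b f y)"
      using linear_basis_expansion[OF smooth_deriv_linear[OF Suc.prems], of _ x] by (rule ext)
    moreover have "(dird x ^^ j) (\<lambda>y. \<Sum>b\<in>Basis. (x \<bullet> b) *\<^sub>R dird b f y) =
        (\<lambda>y. \<Sum>b\<in>Basis. (dird x ^^ j) (\<lambda>y. (x \<bullet> b) *\<^sub>R dird b f y) y)"
      by (intro dird_funpow_sum finite_Basis smooth_scaleR smooth_const smooth_deriv Suc.prems)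
    ultimately show ?thesis
      by (simp only: funpow_Suc_right o_apply dird_funpow_scaleR[OF smooth_deriv[OF Suc.prems]])
  qed
  then have eq: "(dird x ^^ Suc j) f y \<bullet> e = (\<Sum>b\<in>Basis. (x \<bullet> b) * ((dird x ^^ j) (dird b f) y \<bullet> e))" for x e
    by (simp add: inner_sum_left)
  have "vhom_poly j (\<lambda>x. (dird x ^^ j) (dird b f) y)" for b
    by (rule Suc.IH) (intro smooth_deriv Suc.prems)
  then show ?case
    unfolding vhom_poly_def eq by (auto intro!: hom_poly_sum hom_poly.lin_mult bounded_linear_inner_left)
qed

lemma taylor_term_homogeneous:
  fixes f :: "'a::euclidean_space \<Rightarrow> 'b::euclidean_space"
  assumes "smooth f" shows "taylor_term k f \<in> homogeneous_polys k"
proof -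
  have "hom_poly (k + 1) (\<lambda>x. (1 / fact (k + 1)) * ((dird x ^^ (k + 1)) f 0 \<bullet> b))" if "b \<in> Basis" for b
    using vhom_poly_dird_funpow[OF assms, of "k + 1" 0] that unfolding vhom_poly_def by (intro hom_poly_cmult) blast
  then show ?thesis
    unfolding homogeneous_polys_iff vhom_poly_def taylor_term_def by (simp add: field_simps del: funpow.simps fact_Suc)
qed

lemma taylor_term_add:
  assumes "smooth f" "smooth g"
  shows "taylor_term k (\<lambda>y. f y + g y) = (\<lambda>x. taylor_term k f x + taylor_term k g x)"
  unfolding taylor_term_def dird_funpow_add[OF assms] by (simp add: scaleR_add_right)

lemma taylor_term_0: "taylor_term 0 f = frechet_derivative f (at 0)"
  by (simp add: taylor_term_def fun_eq_iff)

text \<open>Letting \<open>t\<close> tend to 0 from the right kills the constant coefficient;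
  dividing by \<open>t\<close> then lowers the degree.\<close>

lemma small_polynomial_zero:
  fixes e :: "nat \<Rightarrow> real"
  assumes "0 < \<epsilon>" "\<And>t. 0 < t \<Longrightarrow> t < \<epsilon> \<Longrightarrow> \<bar>\<Sum>i\<le>m. e i * t ^ i\<bar> \<le> C * t ^ Suc m"
  shows "i \<le> m \<Longrightarrow> e i = 0"
  using assms
proof (induction m arbitrary: e i)
  case (0 e i)
  have lim: "((\<lambda>t::real. C * t) \<longlongrightarrow> C * 0) (at_right 0)" by (intro tendsto_intros)
  have "\<forall>\<^sub>F t in at_right 0. \<bar>e 0\<bar> \<le> C * t"
    using eventually_at_right_less[of 0] eventually_at_right_real[OF 0(2)] by eventually_elim (use 0(3) in auto)
  from tendsto_lowerbound[OF lim this] show ?case using 0 by simp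
next
  case (Suc m e i)
  have lim: "((\<lambda>t::real. C * t ^ Suc (Suc m) + \<bar>\<Sum>i\<le>m. e (Suc i) * t ^ Suc i\<bar>) \<longlongrightarrow>
      C * 0 ^ Suc (Suc m) + \<bar>\<Sum>i\<le>m. e (Suc i) * 0 ^ Suc i\<bar>) (at_right 0)" by (intro tendsto_intros)
  have split: "(\<Sum>i\<le>Suc m. e i * t ^ i) = e 0 + (\<Sum>i\<le>m. e (Suc i) * t ^ Suc i)" for t
    by (subst sum.atMost_Suc_shift) simp
  have "\<forall>\<^sub>F t in at_right 0. \<bar>e 0\<bar> \<le> C * t ^ Suc (Suc m) + \<bar>\<Sum>i\<le>m. e (Suc i) * t ^ Suc i\<bar>"
    using eventually_at_right_less[of 0] eventually_at_right_real[OF Suc.prems(2)]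
  proof eventually_elim
    case (elim t)
    then show ?case using Suc.prems(3)[of t] unfolding split by auto
  qed
  from tendsto_lowerbound[OF lim this] have e0: "e 0 = 0" by simp
  have "e (Suc j) = 0" if "j \<le> m" for j
  proof (rule Suc.IH[OF that Suc.prems(2)])
    fix t :: real assume t: "0 < t" "t < \<epsilon>"
    have "(\<Sum>i\<le>Suc m. e i * t ^ i) = t * (\<Sum>i\<le>m. e (Suc i) * t ^ i)"
      unfolding split e0 by (simp add: sum_distrib_left algebra_simps)
    then have "t * \<bar>\<Sum>i\<le>m. e (Suc i) * t ^ i\<bar> \<le> t * (C * t ^ Suc m)"
      using Suc.prems(3)[OF t] t by (simp add: abs_mult algebra_simps)
    then show "\<bar>\<Sum>i\<le>m. e (Suc i) * t ^ i\<bar> \<le> C * t ^ Suc m" using t(1) by simp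
  qed
  then show ?case using e0 Suc.prems(1) by (cases i) auto
qed

text \<open>Along the ray \<open>t *\<^sub>R x\<close> the Maclaurin polynomial minus
  \<open>t ^ m *\<^sub>R c\<close> has degree at most \<open>m\<close> and is
  \<open>O(t ^ Suc m)\<close>, hence zero. Taylor terms can thus be read off from growth estimates,
  without computing iterated derivatives of composed maps.\<close>

lemma taylor_coefficient_unique:
  fixes w :: "'a::real_normed_vector \<Rightarrow> 'b::euclidean_space"
  assumes w: "smooth w" and "0 < \<epsilon>"
    and small: "\<And>t. 0 < t \<Longrightarrow> t < \<epsilon> \<Longrightarrow> norm (w (t *\<^sub>R x) - t ^ m *\<^sub>R c) \<le> C * t ^ Suc m"
  shows "j < m \<Longrightarrow> (dird x ^^ j) w 0 = 0" and "(dird x ^^ m) w 0 = fact m *\<^sub>R c"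
proof -
  have "(dird x ^^ j) w 0 \<bullet> e = (if j = m then fact m * (c \<bullet> e) else 0)" if j: "j \<le> m" and e: "e \<in> Basis" for j e
  proof -
    define diff where "diff = (\<lambda>j t. (dird x ^^ j) w (t *\<^sub>R x) \<bullet> e)"
    have der: "DERIV (diff j) t :> diff (Suc j) t" for j t
    proof -
      have "((\<lambda>t. (dird x ^^ j) w (t *\<^sub>R x)) has_derivative (\<lambda>s. frechet_derivative ((dird x ^^ j) w) (at (t *\<^sub>R x)) (s *\<^sub>R x))) (at t)"
        by (rule has_derivative_compose[OF _ smooth_has_derivative[OF smooth_dird_funpow[OF w]]])
          (auto intro!: derivative_eq_intros)
      then have "((\<lambda>t. (dird x ^^ j) w (t *\<^sub>R x) \<bullet> e) has_derivative
         (\<lambda>s. frechet_derivative ((dird x ^^ j) w) (at (t *\<^sub>R x)) (s *\<^sub>R x) \<bullet> e)) (at t)"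
        by (rule has_derivative_inner_left)
      then show ?thesis
        by (simp add: diff_def has_field_derivative_def linear_scale[OF smooth_deriv_linear[OF smooth_dird_funpow[OF w]]]
            mult_commute_abs)
    qed
    have "continuous_on {-1..1} (diff (Suc m))"
      using der by (intro DERIV_continuous_on) (auto intro: has_field_derivative_at_within)
    then have "bounded (diff (Suc m) ` {-1..1})" by (intro compact_imp_bounded compact_continuous_image) auto
    then obtain K where "\<forall>y\<in>diff (Suc m) ` {-1..1}. norm y \<le> K" unfolding bounded_iff by blast
    then have K: "\<And>t. t \<in> {-1..1} \<Longrightarrow> \<bar>diff (Suc m) t\<bar> \<le> K" by auto
    define a where "a i = diff i 0 / fact i - (if i = m then c \<bullet> e else 0)" for i
    have "a i = 0" if "i \<le> m" for i
    proof (rule small_polynomial_zero[OF _ _ that])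
      show "0 < min \<epsilon> 1" using \<open>0 < \<epsilon>\<close> by simp
      fix t :: real assume t: "0 < t" "t < min \<epsilon> 1"
      obtain s where s: "\<bar>s\<bar> \<le> \<bar>t\<bar>" "diff 0 t = (\<Sum>i<Suc m. diff i 0 / fact i * t ^ i) + diff (Suc m) s / fact (Suc m) * t ^ Suc m"
        using Maclaurin_all_le[of diff "diff 0" t "Suc m"] der by blast
      have "(\<Sum>i\<le>m. a i * t ^ i) = (\<Sum>i\<le>m. diff i 0 / fact i * t ^ i) - t ^ m * (c \<bullet> e)"
        by (simp add: a_def left_diff_distrib sum_subtractf if_distrib[of "\<lambda>x. x * _"] cong: if_cong)
      also have "\<dots> = (w (t *\<^sub>R x) - t ^ m *\<^sub>R c) \<bullet> e - diff (Suc m) s / fact (Suc m) * t ^ Suc m"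
        using s(2) by (simp add: diff_def lessThan_Suc_atMost inner_diff_left)
      also have "\<bar>\<dots>\<bar> \<le> \<bar>(w (t *\<^sub>R x) - t ^ m *\<^sub>R c) \<bullet> e\<bar> + \<bar>diff (Suc m) s / fact (Suc m) * t ^ Suc m\<bar>"
        by (rule abs_triangle_ineq4)
      also have "\<dots> \<le> C * t ^ Suc m + K * t ^ Suc m"
      proof (rule add_mono)
        show "\<bar>(w (t *\<^sub>R x) - t ^ m *\<^sub>R c) \<bullet> e\<bar> \<le> C * t ^ Suc m"
          using Basis_le_norm[OF e, of "w (t *\<^sub>R x) - t ^ m *\<^sub>R c"] small[of t] t by linarith
        have "\<bar>diff (Suc m) s / fact (Suc m)\<bar> \<le> \<bar>diff (Suc m) s\<bar>"
          using fact_ge_1[of "Suc m"] by (simp add: divide_le_eq mult_le_cancel_left1 del: fact_Suc)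
        also have "\<dots> \<le> K" using s(1) t by (intro K) auto
        finally have "\<bar>diff (Suc m) s / fact (Suc m)\<bar> * t ^ Suc m \<le> K * t ^ Suc m"
          using t by (intro mult_right_mono) auto
        then show "\<bar>diff (Suc m) s / fact (Suc m) * t ^ Suc m\<bar> \<le> K * t ^ Suc m"
          using t by (simp only: abs_mult power_abs abs_of_pos)
      qed
      finally show "\<bar>\<Sum>i\<le>m. a i * t ^ i\<bar> \<le> (C + K) * t ^ Suc m" by (simp add: algebra_simps)
    qed
    from this[OF j] show ?thesis by (auto simp: a_def diff_def field_simps)
  qed
  note coeff = this
  show "(dird x ^^ j) w 0 = 0" if "j < m"
    by (rule euclidean_eqI) (use coeff[of j] that in simp)
  show "(dird x ^^ m) w 0 = fact m *\<^sub>R c"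
    by (rule euclidean_eqI) (use coeff[of m] in simp)
qed

subsection \<open>Orders of vanishing\<close>

lemma smooth_lipschitz_cball:
  fixes h :: "'a::euclidean_space \<Rightarrow> 'b::euclidean_space"
  assumes "smooth h"
  obtains C where "C \<ge> 0" "\<And>x y. norm x \<le> 1 \<Longrightarrow> norm y \<le> 1 \<Longrightarrow> norm (h x - h y) \<le> C * norm (x - y)"
    "\<And>x v. norm x \<le> 1 \<Longrightarrow> norm (frechet_derivative h (at x) v) \<le> C * norm v"
proof -
  let ?D = "\<lambda>x. frechet_derivative h (at x)"
  have "\<forall>b. \<exists>K. \<forall>x\<in>cball 0 1. norm (?D x b) \<le> K"
  proof
    fix b
    have "bounded ((\<lambda>x. ?D x b) ` cball 0 1)"
      by (intro compact_imp_bounded compact_continuous_image smooth_continuous_on smooth_deriv assms) simp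
    then show "\<exists>K. \<forall>x\<in>cball 0 1. norm (?D x b) \<le> K" by (auto simp: bounded_iff)
  qed
  then obtain K where "\<forall>b. \<forall>x\<in>cball 0 1. norm (?D x b) \<le> K b" unfolding choice_iff by (elim exE)
  then have K: "\<And>b x. norm x \<le> 1 \<Longrightarrow> norm (?D x b) \<le> K b" by simp
  have K0: "0 \<le> K b" for b
    by (rule order_trans[OF norm_ge_zero K[of 0]]) simp
  have D: "norm (?D x v) \<le> sum K Basis * norm v" if "norm x \<le> 1" for x v
  proof -
    have "norm (?D x v) \<le> (\<Sum>b\<in>Basis. norm ((v \<bullet> b) *\<^sub>R ?D x b))"
      by (subst linear_basis_expansion[OF smooth_deriv_linear[OF assms]]) (rule norm_sum)
    also have "\<dots> \<le> (\<Sum>b\<in>Basis. norm v * K b)"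
      using K[OF that] by (intro sum_mono) (auto intro!: mult_mono Basis_le_norm)
    finally show ?thesis by (simp add: sum_distrib_left sum_distrib_right mult_ac)
  qed
  have "norm (h x - h y) \<le> sum K Basis * norm (x - y)" if "norm x \<le> 1" "norm y \<le> 1" for x y
  proof (rule differentiable_bound[of "cball 0 1"])
    show "(h has_derivative ?D x) (at x within cball 0 1)" for x
      using smooth_has_derivative[OF assms] by (rule has_derivative_at_withinI)
    show "onorm (?D x) \<le> sum K Basis" if "x \<in> cball 0 1" for x
      using D[of x] that by (intro onorm_le) simp
  qed (use that in auto)
  then show ?thesis using that[of "sum K Basis"] D K0 by (simp add: sum_nonneg)
qed

text \<open>After subtraction of the derivative at 0, what remains has derivative
  \<open>O(norm x)\<close> and hence Lipschitz constant \<open>O(r)\<close> on the ball of radius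
  \<open>r\<close>.\<close>

lemma smooth_deriv_near_0:
  fixes h :: "'a::euclidean_space \<Rightarrow> 'b::euclidean_space"
  assumes "smooth h"
  obtains C where "C \<ge> 0"
    "\<And>x v. norm x \<le> 1 \<Longrightarrow> norm (frechet_derivative h (at x) v - frechet_derivative h (at 0) v) \<le> C * norm x * norm v"
    "\<And>x y r. norm x \<le> r \<Longrightarrow> norm y \<le> r \<Longrightarrow> r \<le> 1 \<Longrightarrow>
      norm (h x - h y - frechet_derivative h (at 0) (x - y)) \<le> C * r * norm (x - y)"
proof -
  let ?D = "\<lambda>x. frechet_derivative h (at x)"
  note lin = linear_basis_expansion[OF smooth_deriv_linear[OF assms]]
  have "\<forall>b. \<exists>C\<ge>0. \<forall>x. norm x \<le> 1 \<longrightarrow> norm (?D x b - ?D 0 b) \<le> C * norm x"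
  proof
    fix b
    obtain C where "C \<ge> 0" "\<And>x y. norm x \<le> 1 \<Longrightarrow> norm y \<le> 1 \<Longrightarrow> norm (?D x b - ?D y b) \<le> C * norm (x - y)"
      by (rule smooth_lipschitz_cball[OF smooth_deriv[OF assms, of b]]) (rule that, assumption+)
    from this(1) this(2)[of _ 0] show "\<exists>C\<ge>0. \<forall>x. norm x \<le> 1 \<longrightarrow> norm (?D x b - ?D 0 b) \<le> C * norm x" by auto
  qed
  then obtain C where "\<forall>b. C b \<ge> 0 \<and> (\<forall>x. norm x \<le> 1 \<longrightarrow> norm (?D x b - ?D 0 b) \<le> C b * norm x)"
    unfolding choice_iff by (elim exE)
  then have C: "\<And>b. C b \<ge> 0" "\<And>b x. norm x \<le> 1 \<Longrightarrow> norm (?D x b - ?D 0 b) \<le> C b * norm x" by blast+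
  have S: "sum C Basis \<ge> 0" using C(1) by (simp add: sum_nonneg)
  have D: "norm (?D x v - ?D 0 v) \<le> sum C Basis * norm x * norm v" if "norm x \<le> 1" for x v
  proof -
    have "?D x v - ?D 0 v = (\<Sum>b\<in>Basis. (v \<bullet> b) *\<^sub>R (?D x b - ?D 0 b))"
      unfolding lin[of _ v] by (simp add: scaleR_diff_right sum_subtractf)
    also have "norm \<dots> \<le> (\<Sum>b\<in>Basis. norm ((v \<bullet> b) *\<^sub>R (?D x b - ?D 0 b)))" by (rule norm_sum)
    also have "\<dots> \<le> (\<Sum>b\<in>Basis. norm v * (C b * norm x))"
      using C(2)[OF that] by (intro sum_mono) (auto intro!: mult_mono Basis_le_norm)
    finally show ?thesis by (simp add: sum_distrib_left sum_distrib_right mult_ac)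
  qed
  show ?thesis
  proof (rule that[OF S D])
    fix x y :: 'a and r :: real assume xy: "norm x \<le> r" "norm y \<le> r" "r \<le> 1"
    let ?g = "\<lambda>x. h x - ?D 0 x"
    have "norm (?g x - ?g y) \<le> (sum C Basis * r) * norm (x - y)"
    proof (rule differentiable_bound[of "cball 0 r"])
      show "(?g has_derivative (\<lambda>v. ?D z v - ?D 0 v)) (at z within cball 0 r)" for z
        by (intro has_derivative_diff has_derivative_at_withinI[OF smooth_has_derivative[OF assms]]
            bounded_linear_imp_has_derivative linear_conv_bounded_linear[THEN iffD1] smooth_deriv_linear assms)
      show "onorm (\<lambda>v. ?D z v - ?D 0 v) \<le> sum C Basis * r" if "z \<in> cball 0 r" for z
      proof (rule onorm_le)
        fix v
        have "norm (?D z v - ?D 0 v) \<le> sum C Basis * norm z * norm v" using that xy by (intro D) auto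
        also have "\<dots> \<le> sum C Basis * r * norm v" using that S by (intro mult_right_mono mult_left_mono) auto
        finally show "norm (?D z v - ?D 0 v) \<le> sum C Basis * r * norm v" .
      qed
    qed (use xy in auto)
    then show "norm (h x - h y - ?D 0 (x - y)) \<le> sum C Basis * r * norm (x - y)"
      by (simp add: linear_diff[OF smooth_deriv_linear[OF assms]] algebra_simps)
  qed
qed

section \<open>Calculus of orders at the origin\<close>

text \<open>The Landau symbol \<open>O(norm x ^ m)\<close> at 0. The normalisation
  \<open>\<epsilon> \<le> 1\<close> makes powers decrease with the exponent, so that a higher order
  implies a lower one on the same ball.\<close>

definition vanishes :: "nat \<Rightarrow> ('a::real_normed_vector \<Rightarrow> 'b::real_normed_vector) \<Rightarrow> bool"
  where "vanishes m f \<longleftrightarrow> (\<exists>C \<epsilon>. 0 \<le> C \<and> 0 < \<epsilon> \<and> \<epsilon> \<le> 1 \<and> (\<forall>x. norm x < \<epsilon> \<longrightarrow> norm (f x) \<le> C * norm x ^ m))"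

lemma vanishesI:
  assumes "0 \<le> C" "0 < \<epsilon>" "\<And>x. norm x < \<epsilon> \<Longrightarrow> norm (f x) \<le> C * norm x ^ m"
  shows "vanishes m f"
  unfolding vanishes_def
  by (intro exI[of _ C] exI[of _ "min \<epsilon> 1"]) (use assms in auto)

lemma vanishesE:
  assumes "vanishes m f"
  obtains C \<epsilon> where "0 \<le> C" "0 < \<epsilon>" "\<epsilon> \<le> 1" "\<And>x. norm x < \<epsilon> \<Longrightarrow> norm (f x) \<le> C * norm x ^ m"
  using assms unfolding vanishes_def by (elim exE conjE) simp

lemma vanishes_mono:
  fixes f :: "'a::real_normed_vector \<Rightarrow> 'b::real_normed_vector"
  assumes "vanishes m f" "k \<le> m" shows "vanishes k f"
proof -
  obtain C \<epsilon> where C: "0 \<le> C" "0 < \<epsilon>" "\<epsilon> \<le> 1" "\<And>x. norm x < \<epsilon> \<Longrightarrow> norm (f x) \<le> C * norm x ^ m"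
    by (rule vanishesE[OF assms(1)]) (rule that, assumption+)
  show ?thesis
  proof (rule vanishesI[OF C(1,2)])
    fix x :: 'a assume x: "norm x < \<epsilon>"
    have "norm x ^ m \<le> norm x ^ k" using x C(3) assms(2) by (intro power_decreasing) auto
    then show "norm (f x) \<le> C * norm x ^ k" using C(4)[OF x] C(1) by (meson mult_left_mono order_trans)
  qed
qed

lemma vanishes_add:
  fixes f g :: "'a::real_normed_vector \<Rightarrow> 'b::real_normed_vector"
  assumes "vanishes m f" "vanishes m g" shows "vanishes m (\<lambda>x. f x + g x)"
proof -
  obtain C \<epsilon> where C: "0 \<le> C" "0 < \<epsilon>" "\<epsilon> \<le> 1" "\<And>x. norm x < \<epsilon> \<Longrightarrow> norm (f x) \<le> C * norm x ^ m"
    by (rule vanishesE[OF assms(1)]) (rule that, assumption+)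
  obtain D \<eta> where D: "0 \<le> D" "0 < \<eta>" "\<eta> \<le> 1" "\<And>x. norm x < \<eta> \<Longrightarrow> norm (g x) \<le> D * norm x ^ m"
    by (rule vanishesE[OF assms(2)]) (rule that, assumption+)
  show ?thesis
  proof (rule vanishesI[of "C + D" "min \<epsilon> \<eta>"])
    fix x :: 'a assume "norm x < min \<epsilon> \<eta>"
    then show "norm (f x + g x) \<le> (C + D) * norm x ^ m"
      using C(4)[of x] D(4)[of x] norm_triangle_ineq[of "f x" "g x"] by (simp add: algebra_simps)
  qed (use C D in auto)
qed

text \<open>Orders add under any product-like estimate. Often one of the two factors is simply a
  power of \<open>norm x\<close> coming from the derivative of a form.\<close>

lemma vanishes_bilinear_bound:
  fixes f :: "'a::real_normed_vector \<Rightarrow> 'b::real_normed_vector" and g :: "'a \<Rightarrow> 'c::real_normed_vector"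
    and h :: "'a \<Rightarrow> 'd::real_normed_vector"
  assumes g: "vanishes k g" and h: "vanishes m h" and C: "0 \<le> C" "0 < \<epsilon>"
    and le: "\<And>x. norm x < \<epsilon> \<Longrightarrow> norm (f x) \<le> C * norm (g x) * norm (h x)"
  shows "vanishes (k + m) f"
proof -
  obtain G \<eta> where G: "0 \<le> G" "0 < \<eta>" "\<eta> \<le> 1" "\<And>x. norm x < \<eta> \<Longrightarrow> norm (g x) \<le> G * norm x ^ k"
    by (rule vanishesE[OF g]) (rule that, assumption+)
  obtain H \<theta> where H: "0 \<le> H" "0 < \<theta>" "\<theta> \<le> 1" "\<And>x. norm x < \<theta> \<Longrightarrow> norm (h x) \<le> H * norm x ^ m"
    by (rule vanishesE[OF h]) (rule that, assumption+)
  show ?thesis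
  proof (rule vanishesI[of "C * G * H" "min \<epsilon> (min \<eta> \<theta>)"])
    fix x :: 'a assume x: "norm x < min \<epsilon> (min \<eta> \<theta>)"
    have "norm (f x) \<le> C * norm (g x) * norm (h x)" using le x by simp
    also have "\<dots> \<le> C * (G * norm x ^ k) * (H * norm x ^ m)"
      using G(4)[of x] H(4)[of x] x C(1) G(1) by (intro mult_mono) auto
    finally show "norm (f x) \<le> C * G * H * norm x ^ (k + m)" by (simp add: power_add mult_ac)
  qed (use C G H in auto)
qed

lemma vanishes_bound:
  fixes f :: "'a::real_normed_vector \<Rightarrow> 'b::real_normed_vector" and g :: "'a \<Rightarrow> 'c::real_normed_vector"
  assumes "vanishes m g" "0 \<le> C" "0 < \<epsilon>" "\<And>x. norm x < \<epsilon> \<Longrightarrow> norm (f x) \<le> C * norm (g x)"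
  shows "vanishes m f"
proof -
  have "vanishes 0 (\<lambda>x::'a. 1::real)" by (rule vanishesI[of 1 1]) auto
  from vanishes_bilinear_bound[OF assms(1) this assms(2,3), of f] assms(4) show ?thesis by simp
qed

lemma vanishes_uminus: "vanishes m f \<Longrightarrow> vanishes m (\<lambda>x. - f x)"
  by (erule vanishes_bound[of _ _ 1 1]) auto

lemma vanishes_diff: "vanishes m f \<Longrightarrow> vanishes m g \<Longrightarrow> vanishes m (\<lambda>x. f x - g x)"
  using vanishes_add[OF _ vanishes_uminus, of m f g] by simp

lemma vanishes_sum:
  fixes f :: "'i \<Rightarrow> 'a::real_normed_vector \<Rightarrow> 'b::real_normed_vector"
  shows "(\<And>i. i \<in> I \<Longrightarrow> vanishes m (f i)) \<Longrightarrow> vanishes m (\<lambda>x. \<Sum>i\<in>I. f i x)"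
proof (induction I rule: infinite_finite_induct)
  case (insert i I)
  then show ?case by (simp add: vanishes_add)
qed (auto intro: vanishesI[of 0 1])

lemma vanishes_linear: "bounded_linear L \<Longrightarrow> vanishes m f \<Longrightarrow> vanishes m (\<lambda>x. L (f x))"
proof -
  assume "bounded_linear L" and f: "vanishes m f"
  then obtain K where "K > 0" "\<And>x. norm (L x) \<le> norm x * K" using bounded_linear.pos_bounded by blast
  then show ?thesis by (intro vanishes_bound[OF f, of K 1]) (auto simp: mult.commute)
qed

lemma vanishes_id: "vanishes 1 (\<lambda>x. x)"
  by (rule vanishesI[of 1 1]) auto

lemma vanishes_compose:
  fixes f :: "'a::real_normed_vector \<Rightarrow> 'b::real_normed_vector" and g :: "'c::real_normed_vector \<Rightarrow> 'a"
  assumes "vanishes m f" "vanishes 1 g" shows "vanishes m (\<lambda>x. f (g x))"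
proof -
  obtain C \<epsilon> where C: "0 \<le> C" "0 < \<epsilon>" "\<epsilon> \<le> 1" "\<And>x. norm x < \<epsilon> \<Longrightarrow> norm (f x) \<le> C * norm x ^ m"
    by (rule vanishesE[OF assms(1)]) (rule that, assumption+)
  obtain D \<eta> where D: "0 \<le> D" "0 < \<eta>" "\<eta> \<le> 1" "\<And>x. norm x < \<eta> \<Longrightarrow> norm (g x) \<le> D * norm x ^ 1"
    by (rule vanishesE[OF assms(2)]) (rule that, assumption+)
  show ?thesis
  \<comment> \<open>\<open>D + 1\<close> replaces \<open>D\<close> because \<open>D\<close> may be
    0.\<close>
  proof (rule vanishesI[of "C * D ^ m" "min \<eta> (\<epsilon> / (D + 1))"])
    fix x :: 'c assume x: "norm x < min \<eta> (\<epsilon> / (D + 1))"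
    have g: "norm (g x) \<le> D * norm x" using D(4)[of x] x by simp
    also have "\<dots> \<le> (D + 1) * norm x" by (simp add: distrib_right)
    also have "\<dots> < \<epsilon>" using x D(1) by (simp add: field_simps)
    finally have "norm (f (g x)) \<le> C * norm (g x) ^ m" by (rule C(4))
    also have "\<dots> \<le> C * (D * norm x) ^ m" using g C(1) by (intro mult_left_mono power_mono) auto
    finally show "norm (f (g x)) \<le> C * D ^ m * norm x ^ m" by (simp add: power_mult_distrib mult_ac)
  qed (use C D in auto)
qed

lemma vanishes_smooth:
  fixes f :: "'a::euclidean_space \<Rightarrow> 'b::euclidean_space"
  assumes "smooth f" "f 0 = 0" shows "vanishes 1 f"
proof -
  obtain C where "C \<ge> 0" "\<And>x y. norm x \<le> 1 \<Longrightarrow> norm y \<le> 1 \<Longrightarrow> norm (f x - f y) \<le> C * norm (x - y)"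
    by (rule smooth_lipschitz_cball[OF assms(1)]) (rule that, assumption+)
  from this(1) this(2)[of _ 0] assms(2) show ?thesis by (intro vanishesI[of C 1]) auto
qed

lemma vanishes_smooth_remainder:
  fixes f :: "'a::euclidean_space \<Rightarrow> 'b::euclidean_space"
  assumes "smooth f" "f 0 = 0" shows "vanishes 2 (\<lambda>x. f x - frechet_derivative f (at 0) x)"
proof -
  obtain C where C: "C \<ge> 0" "\<And>x y r. norm x \<le> r \<Longrightarrow> norm y \<le> r \<Longrightarrow> r \<le> 1 \<Longrightarrow>
      norm (f x - f y - frechet_derivative f (at 0) (x - y)) \<le> C * r * norm (x - y)"
    by (rule smooth_deriv_near_0[OF assms(1)]) (rule that, assumption+)
  show ?thesis
  proof (rule vanishesI[of C 1])
    fix x :: 'a assume "norm x < 1"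
    with C(2)[of x "norm x" 0] assms(2) show "norm (f x - frechet_derivative f (at 0) x) \<le> C * norm x ^ 2"
      by (simp add: power2_eq_square mult.assoc)
  qed (use C in auto)
qed

lemma vanishes_vhom_poly: "vhom_poly d p \<Longrightarrow> vanishes d p"
  by (erule vhom_poly_lipschitz) (rule vanishesI[of _ 1], auto)

lemma vhom_poly_scale:
  assumes "vhom_poly d p" shows "p (c *\<^sub>R x) = c ^ d *\<^sub>R p x"
proof (rule euclidean_eqI)
  fix b :: 'b assume "b \<in> Basis"
  then have "hom_poly d (\<lambda>x. p x \<bullet> b)" using assms by (simp only: vhom_poly_def)
  from hom_poly_scale[OF this] show "p (c *\<^sub>R x) \<bullet> b = c ^ d *\<^sub>R p x \<bullet> b" by simp
qed

text \<open>An error one order beyond the degree \<open>Suc k\<close> of \<open>q\<close> determines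
  the coefficients along every ray, up to and including that of \<open>q\<close>. The radius of
  validity shrinks with the length of the chosen direction.\<close>

lemma taylor_term_of_leading_polynomial:
  fixes w q :: "'a::euclidean_space \<Rightarrow> 'b::euclidean_space"
  assumes w: "smooth w" and q: "vhom_poly (Suc k) q" and v: "vanishes (k + 2) (\<lambda>x. w x - q x)"
  shows "w 0 = 0" "j < k \<Longrightarrow> taylor_term j w = (\<lambda>_. 0)" "taylor_term k w = q"
proof -
  obtain C \<epsilon> where C: "0 \<le> C" "0 < \<epsilon>" "\<epsilon> \<le> 1" "\<And>x. norm x < \<epsilon> \<Longrightarrow> norm (w x - q x) \<le> C * norm x ^ (k + 2)"
    by (rule vanishesE[OF v]) (rule that, assumption+)
  have small: "norm (w (t *\<^sub>R x) - t ^ Suc k *\<^sub>R q x) \<le> (C * norm x ^ (k + 2)) * t ^ Suc (Suc k)"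
    if t: "0 < t" "t < \<epsilon> / (norm x + 1)" for t x
  proof -
    have "norm (t *\<^sub>R x) = t * norm x" using t by simp
    also have "\<dots> \<le> t * (norm x + 1)" using t by (intro mult_left_mono) auto
    also have "\<dots> < \<epsilon>" using t(2) by (subst (asm) pos_less_divide_eq) (auto simp: add_nonneg_pos)
    finally have "norm (w (t *\<^sub>R x) - q (t *\<^sub>R x)) \<le> C * norm (t *\<^sub>R x) ^ (k + 2)" by (rule C(4))
    then show ?thesis using t(1) by (simp add: vhom_poly_scale[OF q] power_mult_distrib mult_ac)
  qed
  have pos: "0 < \<epsilon> / (norm x + 1)" for x :: 'a using C(2) by (simp add: add_nonneg_pos)
  have U1: "(dird x ^^ j) w 0 = 0" if "j < Suc k" for j x
    by (rule taylor_coefficient_unique(1)[OF w pos[of x] _ that]) (rule small)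
  have U2: "(dird x ^^ Suc k) w 0 = fact (Suc k) *\<^sub>R q x" for x
    by (rule taylor_coefficient_unique(2)[OF w pos[of x]]) (rule small)
  show "w 0 = 0" using U1[of 0] by simp
  show "taylor_term k w = q" using U2 by (simp add: taylor_term_def fun_eq_iff del: funpow.simps fact_Suc)
  assume "j < k"
  then show "taylor_term j w = (\<lambda>_. 0)" using U1[of "Suc j"] by (simp add: taylor_term_def fun_eq_iff del: funpow.simps)
qed

text \<open>The sine map agrees with the identity to first order, so its error is
  \<open>O(norm x ^ 2)\<close> while the derivative of \<open>p\<close> is
  \<open>O(norm x ^ k)\<close>. The estimate for derivatives is stated separately because
  \<open>vanishes\<close> for \<open>w - p\<close> says nothing about them, and the functional
  equation for \<open>fbar\<close> contains the derivative of the correction.\<close>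

lemma sine_map_approximation:
  fixes p :: "'a::euclidean_space \<Rightarrow> 'b::euclidean_space"
  assumes p: "vhom_poly (Suc k) p" and k: "1 \<le> k" and \<delta>: "0 < \<delta>"
  defines "w \<equiv> \<lambda>x. p (sine_map \<delta> x)"
  shows "vanishes (k + 2) (\<lambda>x. w x - p x)"
    and "\<exists>C\<ge>0. \<exists>\<epsilon>>0. \<forall>x v. norm x < \<epsilon> \<longrightarrow>
      norm (frechet_derivative w (at x) v - frechet_derivative p (at x) v) \<le> C * norm x ^ (k + 1) * norm v"
proof -
  let ?T = "sine_map \<delta> :: 'a \<Rightarrow> 'a"
  have T: "smooth ?T" by (rule smooth_sine_map)
  have DT0: "frechet_derivative ?T (at 0) = (\<lambda>v. v)"
    by (rule frechet_derivative_at[symmetric, OF sine_map_deriv_0]) (use \<delta> in simp)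
  obtain K where K: "K \<ge> 0" "\<And>x y. norm x \<le> 1 \<Longrightarrow> norm y \<le> 1 \<Longrightarrow> norm (?T x - ?T y) \<le> K * norm (x - y)"
    "\<And>x v. norm x \<le> 1 \<Longrightarrow> norm (frechet_derivative ?T (at x) v) \<le> K * norm v"
    by (rule smooth_lipschitz_cball[OF T]) (rule that, assumption+)
  obtain M where M: "M \<ge> 0"
    "\<And>x v. norm x \<le> 1 \<Longrightarrow> norm (frechet_derivative ?T (at x) v - v) \<le> M * norm x * norm v"
    "\<And>x y r. norm x \<le> r \<Longrightarrow> norm y \<le> r \<Longrightarrow> r \<le> 1 \<Longrightarrow> norm (?T x - ?T y - (x - y)) \<le> M * r * norm (x - y)"
    by (rule smooth_deriv_near_0[OF T, unfolded DT0]) (rule that, assumption+)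
  have TK: "norm (?T x) \<le> (K + 1) * norm x" if "norm x \<le> 1" for x
    using K(2)[of x 0] that by (simp add: sine_map_0 distrib_right add_increasing2)
  have idK: "norm x \<le> (K + 1) * norm x" for x :: 'a using K(1) by (simp add: distrib_right)
  have TM: "norm (?T x - x) \<le> M * norm x ^ 2" if "norm x \<le> 1" for x
    using M(3)[of x "norm x" 0] that by (simp add: sine_map_0 power2_eq_square mult.assoc)
  obtain P where P: "P \<ge> 0" "\<And>R x y. norm x \<le> R \<Longrightarrow> norm y \<le> R \<Longrightarrow> norm (p x - p y) \<le> P * R ^ k * norm (x - y)"
    by (rule vhom_poly_lipschitz[OF p, unfolded diff_Suc_1]) (rule that, assumption+)
  obtain Q where Q: "Q \<ge> 0" "\<And>x v. norm (frechet_derivative p (at x) v) \<le> Q * norm x ^ k * norm v"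
    "\<And>R x y v. norm x \<le> R \<Longrightarrow> norm y \<le> R \<Longrightarrow>
      norm (frechet_derivative p (at x) v - frechet_derivative p (at y) v) \<le> Q * R ^ (k - 1) * norm (x - y) * norm v"
    by (rule vhom_poly_deriv_bounds[OF p]) (rule that, assumption+)
  show "vanishes (k + 2) (\<lambda>x. w x - p x)"
  proof (rule vanishesI[of "P * (K + 1) ^ k * M" 1])
    fix x :: 'a assume x: "norm x < 1"
    have "norm (w x - p x) \<le> P * ((K + 1) * norm x) ^ k * norm (?T x - x)"
      unfolding w_def using x by (intro P(2) TK idK) auto
    also have "\<dots> \<le> P * ((K + 1) * norm x) ^ k * (M * norm x ^ 2)"
      using x P(1) K(1) by (intro mult_left_mono TM) auto
    also have "\<dots> = P * (K + 1) ^ k * M * norm x ^ (k + 2)"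
      by (simp only: power_mult_distrib power_add mult_ac)
    finally show "norm (w x - p x) \<le> P * (K + 1) ^ k * M * norm x ^ (k + 2)" .
  qed (use P K M in auto)
  have C0: "0 \<le> Q * (K + 1) ^ (k - 1) * M * K + Q * M" using Q K M by simp
  have "\<forall>x v. norm x < 1 \<longrightarrow> norm (frechet_derivative w (at x) v - frechet_derivative p (at x) v)
      \<le> (Q * (K + 1) ^ (k - 1) * M * K + Q * M) * norm x ^ (k + 1) * norm v"
  proof (intro allI impI)
    fix x v :: 'a assume x: "norm x < 1"
    let ?u = "frechet_derivative ?T (at x) v"
    let ?Dp = "\<lambda>x. frechet_derivative p (at x)"
    note ps = vhom_poly_smooth[OF p]
    have "(w has_derivative (\<lambda>v. ?Dp (?T x) (frechet_derivative ?T (at x) v))) (at x)"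
      unfolding w_def by (rule has_derivative_compose[OF smooth_has_derivative[OF T] smooth_has_derivative[OF ps]])
    from fun_cong[OF frechet_derivative_at[OF this], of v]
    have "frechet_derivative w (at x) v - ?Dp x v = (?Dp (?T x) ?u - ?Dp x ?u) + ?Dp x (?u - v)"
      by (simp add: linear_diff[OF smooth_deriv_linear[OF ps]])
    also have "norm \<dots> \<le> norm (?Dp (?T x) ?u - ?Dp x ?u) + norm (?Dp x (?u - v))"
      by (rule norm_triangle_ineq)
    also have "norm (?Dp (?T x) ?u - ?Dp x ?u) \<le> Q * ((K + 1) * norm x) ^ (k - 1) * norm (?T x - x) * norm ?u"
      using x by (intro Q(3) TK idK) auto
    also have "\<dots> \<le> Q * ((K + 1) * norm x) ^ (k - 1) * (M * norm x ^ 2) * (K * norm v)"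
      using x Q(1) K(1) M(1) by (intro mult_mono mult_left_mono TM K(3)) auto
    also have "\<dots> = Q * (K + 1) ^ (k - 1) * M * K * (norm x ^ (k - 1) * norm x ^ 2) * norm v"
      by (simp only: power_mult_distrib mult_ac)
    \<comment> \<open>Here \<open>k \<ge> 1\<close> enters: otherwise the truncated
      \<open>k - 1\<close> would not add up to \<open>k + 1\<close>.\<close>
    also have "norm x ^ (k - 1) * norm x ^ 2 = norm x ^ (k + 1)"
      using k by (simp add: power_add[symmetric])
    also have "norm (?Dp x (?u - v)) \<le> Q * norm x ^ k * norm (?u - v)" by (rule Q(2))
    also have "\<dots> \<le> Q * norm x ^ k * (M * norm x * norm v)"
      using x Q(1) by (intro mult_left_mono M(2)) auto
    also have "\<dots> = Q * M * norm x ^ (k + 1) * norm v" by simp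
    finally show "norm (frechet_derivative w (at x) v - ?Dp x v)
      \<le> (Q * (K + 1) ^ (k - 1) * M * K + Q * M) * norm x ^ (k + 1) * norm v"
      by (simp add: algebra_simps)
  qed
  with C0 zero_less_one show "\<exists>C\<ge>0. \<exists>\<epsilon>>0. \<forall>x v. norm x < \<epsilon> \<longrightarrow>
      norm (frechet_derivative w (at x) v - frechet_derivative p (at x) v) \<le> C * norm x ^ (k + 1) * norm v"
    by blast
qed

subsection \<open>Coupled cell networks\<close>

text \<open>\<open>\<tau>\<close> will be both \<open>\<sigma>\<close>, acting on cells, and
  \<open>sigma_tilde \<sigma>\<close>, acting on indices. The size \<open>M\<close> may vary with
  the centre, unlike the Lipschitz constant.\<close>

definition net_lipschitz :: "('n::finite \<Rightarrow> 'c::finite \<Rightarrow> 'c) \<Rightarrow> real \<Rightarrow> ('v::euclidean_space ^ 'n \<Rightarrow> 'v) \<Rightarrow> bool"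
  where "net_lipschitz \<tau> L g \<longleftrightarrow> (\<forall>a. \<forall>B\<in>Basis. \<exists>M. ma_lipschitz a M L (\<lambda>x. network_field \<tau> g x \<bullet> B))"

lemma bounded_linear_reindex: "bounded_linear (\<lambda>x :: 'v::euclidean_space ^ 'c::finite. (\<chi> j. x $ \<tau> j i) :: 'v ^ 'n::finite)"
  by (intro linear_conv_bounded_linear[THEN iffD1] linearI) (simp_all add: vec_eq_iff)

lemma network_field_inner_axis: "network_field \<tau> g x \<bullet> axis i b = g (\<chi> j. x $ \<tau> j i) \<bullet> b"
  by (simp add: network_field_def inner_axis)

lemma smooth_network_field:
  fixes g :: "'v::euclidean_space ^ 'n::finite \<Rightarrow> 'v" and \<tau> :: "'n \<Rightarrow> 'c::finite \<Rightarrow> 'c"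
  assumes "smooth g" shows "smooth (network_field \<tau> g)"
proof (rule smooth_componentwise)
  fix B :: "'v ^ 'c" assume "B \<in> Basis"
  then obtain i b where B: "B = axis i b" by (auto simp: Basis_vec_def)
  show "smooth (\<lambda>x. network_field \<tau> g x \<bullet> B)"
    unfolding B network_field_inner_axis
    by (intro smooth_inner smooth_compose[OF assms] smooth_bounded_linear bounded_linear_reindex)
qed

lemma network_field_deriv:
  fixes g :: "'v::euclidean_space ^ 'n::finite \<Rightarrow> 'v"
  assumes "smooth g"
  shows "frechet_derivative (network_field \<tau> g) (at x) v $ i =
    frechet_derivative g (at (\<chi> j. x $ \<tau> j i)) (\<chi> j. v $ \<tau> j i)"
proof -
  have "((\<lambda>x. network_field \<tau> g x $ i) has_derivative (\<lambda>v. frechet_derivative (network_field \<tau> g) (at x) v $ i)) (at x)"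
    by (intro bounded_linear.has_derivative[OF bounded_linear_vec_nth] smooth_has_derivative smooth_network_field assms)
  moreover have "((\<lambda>x. network_field \<tau> g x $ i) has_derivative
      (\<lambda>v. frechet_derivative g (at (\<chi> j. x $ \<tau> j i)) (\<chi> j. v $ \<tau> j i))) (at x)"
    unfolding network_field_def vec_lambda_beta
    by (rule has_derivative_compose[OF bounded_linear_imp_has_derivative[OF bounded_linear_reindex]
          smooth_has_derivative[OF assms]])
  ultimately show ?thesis using has_derivative_unique by (metis (no_types, lifting))
qed

lemma vanishes_network_field:
  fixes g :: "'v::euclidean_space ^ 'n::finite \<Rightarrow> 'v" and \<tau> :: "'n \<Rightarrow> 'c::finite \<Rightarrow> 'c"
  assumes "vanishes m g" shows "vanishes m (network_field \<tau> g)"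
proof -
  have lin: "vanishes 1 (\<lambda>x :: 'v ^ 'c. (\<chi> j. x $ \<tau> j i) :: 'v ^ 'n)" for i
    by (rule vanishes_linear[OF bounded_linear_reindex vanishes_id])
  have ax: "bounded_linear (axis i :: 'v \<Rightarrow> 'v ^ 'c)" for i
    by (intro linear_conv_bounded_linear[THEN iffD1] linearI) (auto simp: vec_eq_iff axis_def)
  have "vanishes m (\<lambda>x. \<Sum>i\<in>UNIV. axis i (g (\<chi> j. x $ \<tau> j i)) :: 'v ^ 'c)"
    by (intro vanishes_sum vanishes_linear[OF ax] vanishes_compose[OF assms lin])
  also have "(\<lambda>x. \<Sum>i\<in>UNIV. axis i (g (\<chi> j. x $ \<tau> j i)) :: 'v ^ 'c) = network_field \<tau> g"
    by (simp add: fun_eq_iff vec_eq_iff network_field_def axis_def)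
  finally show ?thesis .
qed

lemma network_field_add: "network_field \<tau> (\<lambda>X. f X + g X) x = network_field \<tau> f x + network_field \<tau> g x"
  by (simp add: network_field_def vec_eq_iff)

lemma network_field_diff: "network_field \<tau> (\<lambda>X. f X - g X) x = network_field \<tau> f x - network_field \<tau> g x"
  by (simp add: network_field_def vec_eq_iff)

lemma network_field_at_0: "g 0 = 0 \<Longrightarrow> network_field \<tau> g 0 = 0"
  by (simp add: network_field_def vec_eq_iff zero_vec_def[symmetric])

lemma ma_lipschitz_mono:
  fixes a :: "'a::euclidean_space"
  assumes "ma_lipschitz a M L q" "L \<le> K"
  shows "ma_lipschitz a M K q"
proof -
  obtain r where r: "0 < r" "ma_lipschitz_upto r a M L q" using assms(1) unfolding ma_lipschitz_def by blast
  note R = ma_lipschitz_uptoD[OF r(2)]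
  show ?thesis
  proof (rule ma_lipschitzI[OF r(1)])
    show "majorized \<rho> M (\<lambda>x. q (a + u x))" if "0 < \<rho>" "\<rho> \<le> r" "vmajorized \<rho> (2 * \<rho>) u" for \<rho> u
      using R(1) that .
  next
    fix \<rho> D :: real and u v :: "'a \<Rightarrow> 'a"
    assume A: "0 < \<rho>" "\<rho> \<le> r" "vmajorized \<rho> (2 * \<rho>) u" "vmajorized \<rho> (2 * \<rho>) v"
      and D: "vmajorized \<rho> D (\<lambda>x. u x - v x)"
    obtain b :: 'a where "b \<in> Basis" by (meson ex_in_conv nonempty_Basis)
    then have "0 \<le> D" using D A(1) majorized_nonneg[of \<rho> D "\<lambda>x. (u x - v x) \<bullet> b"] by (simp add: vmajorized_def)
    then show "majorized \<rho> (K * D) (\<lambda>x. q (a + u x) - q (a + v x))"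
      by (intro majorized_mono[OF R(2)[OF A D]] mult_right_mono assms(2))
  qed
qed

lemma net_lipschitz_add:
  assumes "net_lipschitz \<tau> L g" "net_lipschitz \<tau> K h"
  shows "net_lipschitz \<tau> (L + K) (\<lambda>X. g X + h X)"
  using assms ma_lipschitz_add unfolding net_lipschitz_def network_field_add inner_add_left by blast

lemma net_lipschitz_zero: "net_lipschitz \<tau> 0 (\<lambda>X. 0)"
  unfolding net_lipschitz_def network_field_def using ma_lipschitz_const[of _ 0]
  by (auto simp: zero_vec_def[symmetric])

text \<open>The degree is \<open>Suc k \<ge> 2\<close>, so the Lipschitz constant carries the factor
  \<open>\<delta> ^ k\<close> and tends to 0 with \<open>\<delta>\<close>. A threshold, rather than
  one value of \<open>\<delta>\<close>, allows the same truncation to serve two networks.\<close>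

lemma net_lipschitz_sine_map:
  fixes p :: "'v::euclidean_space ^ 'n::finite \<Rightarrow> 'v" and \<tau> :: "'n \<Rightarrow> 'c::finite \<Rightarrow> 'c"
  assumes p: "vhom_poly (Suc k) p" and k: "1 \<le> k" and \<epsilon>: "0 < \<epsilon>"
  obtains \<delta>0 where "0 < \<delta>0" "\<And>\<delta>. 0 < \<delta> \<Longrightarrow> \<delta> \<le> \<delta>0 \<Longrightarrow> net_lipschitz \<tau> \<epsilon> (\<lambda>X. p (sine_map \<delta> X))"
proof -
  let ?Q = "\<lambda>P :: 'v ^ 'c \<Rightarrow> 'v ^ 'n. \<forall>B\<in>Basis. \<exists>b\<in>Basis. \<forall>x. P x \<bullet> B = x \<bullet> b"
  let ?R = "\<lambda>b C. C \<ge> 0 \<and> (\<forall>\<delta>>0. \<forall>P. ?Q P \<longrightarrow> (\<forall>a. ma_lipschitz a (C * \<delta> ^ Suc k)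
      (C * real (Suc k) * \<delta> ^ (Suc k - 1)) (\<lambda>x. p (sine_map \<delta> (P x)) \<bullet> b)))"
  have "\<forall>b. \<exists>C. b \<in> Basis \<longrightarrow> ?R b C"
  proof
    fix b :: 'v
    show "\<exists>C. b \<in> Basis \<longrightarrow> ?R b C"
    proof (cases "b \<in> Basis")
      case True
      then have "hom_poly (Suc k) (\<lambda>X. p X \<bullet> b)" using p by (simp only: vhom_poly_def)
      from hom_poly_sine_map_ma_lipschitz[OF this, where 'a = "'v ^ 'c"] show ?thesis
        by (elim exE) (rule exI, rule impI)
    qed simp
  qed
  then obtain C where C: "\<forall>b. b \<in> Basis \<longrightarrow> ?R b (C b)" unfolding choice_iff by (elim exE)
  have C0: "0 \<le> C b" if "b \<in> Basis" for b using C that by blast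
  define K where "K = (\<Sum>b\<in>Basis. C b) * real (Suc k)"
  have K: "0 \<le> K" unfolding K_def by (intro mult_nonneg_nonneg sum_nonneg C0) auto
  \<comment> \<open>The bound 1 gives \<open>\<delta> ^ k \<le> \<delta>\<close>; the second bound
    makes \<open>K * \<delta>\<close> at most \<open>\<epsilon>\<close>, also when
    \<open>K = 0\<close>.\<close>
  define \<delta>0 where "\<delta>0 = min 1 (\<epsilon> / (K + 1))"
  show ?thesis
  proof (rule that)
    show "0 < \<delta>0" using K \<epsilon> by (simp add: \<delta>0_def)
    fix \<delta> :: real assume \<delta>: "0 < \<delta>" "\<delta> \<le> \<delta>0"
    show "net_lipschitz \<tau> \<epsilon> (\<lambda>X. p (sine_map \<delta> X))"
      unfolding net_lipschitz_def
    proof (intro allI ballI)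
      fix a B :: "'v ^ 'c" assume "B \<in> Basis"
      then obtain i b where B: "B = axis i b" and b: "b \<in> Basis" by (auto simp: Basis_vec_def)
      have Q: "?Q (\<lambda>x. \<chi> j. x $ \<tau> j i)"
      proof
        fix E :: "'v ^ 'n" assume "E \<in> Basis"
        then obtain j e where E: "E = axis j e" "e \<in> Basis" by (auto simp: Basis_vec_def)
        then show "\<exists>b\<in>Basis. \<forall>x :: 'v ^ 'c. (\<chi> j. x $ \<tau> j i) \<bullet> E = x \<bullet> b"
          by (intro bexI[of _ "axis (\<tau> j i) e"]) (auto simp: inner_axis Basis_vec_def)
      qed
      have lip: "ma_lipschitz a (C b * \<delta> ^ Suc k) (C b * real (Suc k) * \<delta> ^ (Suc k - 1))
          (\<lambda>x. p (sine_map \<delta> (\<chi> j. x $ \<tau> j i)) \<bullet> b)"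
        using C[THEN spec, THEN mp, OF b, THEN conjunct2, THEN spec, THEN mp, OF \<delta>(1), THEN spec, THEN mp, OF Q, THEN spec] .
      have "C b * real (Suc k) * \<delta> ^ (Suc k - 1) \<le> K * \<delta>"
      proof (rule mult_mono)
        show "C b * real (Suc k) \<le> K"
          unfolding K_def by (intro mult_right_mono member_le_sum[OF b] C0) auto
        have "\<delta> ^ k \<le> \<delta> ^ 1" using \<delta> k by (intro power_decreasing) (auto simp: \<delta>0_def)
        then show "\<delta> ^ (Suc k - 1) \<le> \<delta>" by simp
      qed (use \<delta> K in auto)
      also have "\<dots> \<le> (K + 1) * (\<epsilon> / (K + 1))" using \<delta> K by (intro mult_mono) (auto simp: \<delta>0_def)
      also have "\<dots> = \<epsilon>" using K by simp
      finally show "\<exists>M. ma_lipschitz a M \<epsilon> (\<lambda>x. network_field \<tau> (\<lambda>X. p (sine_map \<delta> X)) x \<bullet> B)"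
        unfolding B network_field_inner_axis using ma_lipschitz_mono[OF lip] by blast
    qed
  qed
qed

text \<open>The estimate at each centre bounds the derivative there, and the mean value inequality
  makes it global. Passing from components to the norm costs the dimension as a factor.\<close>

lemma net_lipschitz_contraction:
  fixes g :: "'v::euclidean_space ^ 'n::finite \<Rightarrow> 'v" and \<tau> :: "'n \<Rightarrow> 'c::finite \<Rightarrow> 'c"
  assumes g: "smooth g" "net_lipschitz \<tau> L g" and L: "real (DIM('v ^ 'c)) * L \<le> 1/2"
  shows "norm (network_field \<tau> g x - network_field \<tau> g y) \<le> norm (x - y) / 2"
proof -
  let ?G = "network_field \<tau> g"
  have G: "smooth ?G" using g(1) by (rule smooth_network_field)
  have comp: "norm (?G x \<bullet> B - ?G y \<bullet> B) \<le> L * norm (x - y)" if B: "B \<in> Basis" for B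
  proof (rule differentiable_bound[of UNIV])
    show der: "((\<lambda>x. ?G x \<bullet> B) has_derivative (\<lambda>v. frechet_derivative ?G (at x) v \<bullet> B)) (at x within UNIV)" for x
      by (intro has_derivative_inner_left) (simp add: smooth_has_derivative G)
    fix x
    obtain M where "ma_lipschitz x M L (\<lambda>x. ?G x \<bullet> B)" using g(2) B unfolding net_lipschitz_def by blast
    from ma_lipschitz_imp_local_lipschitz[OF this]
    obtain r where "0 < r" "\<And>y. norm (y - x) < r \<Longrightarrow> \<bar>?G y \<bullet> B - ?G x \<bullet> B\<bar> \<le> L * norm (y - x)" by blast
    then have "norm (frechet_derivative ?G (at x) v \<bullet> B) \<le> L * norm v" for v
      using deriv_norm_le_lipschitz[OF der[of x], of r L v] by simp
    then show "onorm (\<lambda>v. frechet_derivative ?G (at x) v \<bullet> B) \<le> L" by (rule onorm_le)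
  qed auto
  have "norm (?G x - ?G y) \<le> (\<Sum>B\<in>Basis. \<bar>(?G x - ?G y) \<bullet> B\<bar>)" by (rule norm_le_l1)
  also have "\<dots> \<le> (\<Sum>B\<in>(Basis :: ('v ^ 'c) set). L * norm (x - y))"
    using comp by (intro sum_mono) (simp add: inner_diff_left)
  also have "\<dots> = (real (DIM('v ^ 'c)) * L) * norm (x - y)" by simp
  also have "\<dots> \<le> (1/2) * norm (x - y)" by (intro mult_right_mono L) auto
  finally show ?thesis by simp
qed

text \<open>The solution of \<open>x + p x = y\<close> is the Banach fixed point of
  \<open>x \<mapsto> y - p x\<close>.\<close>

lemma perturbed_identity_bij:
  fixes p :: "'a::euclidean_space \<Rightarrow> 'a"
  assumes lip: "\<And>x y. norm (p x - p y) \<le> norm (x - y) / 2"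
  obtains H where "\<And>y. H y + p (H y) = y" "\<And>x. H (x + p x) = x"
proof -
  have "\<exists>!x. y - p x = x" for y
    by (rule banach_fix_type[of "1/2"]) (use lip in \<open>auto simp: dist_norm norm_minus_commute\<close>)
  then have ex: "\<exists>!x. x + p x = y" for y by (metis add_diff_cancel_right' diff_add_cancel)
  define H where "H y = (THE x. x + p x = y)" for y
  have "H y + p (H y) = y" for y unfolding H_def by (rule theI'[OF ex])
  moreover have "H (x + p x) = x" for x unfolding H_def by (rule the1_equality[OF ex refl])
  ultimately show ?thesis using that by blast
qed

section \<open>Bracket, intertwining, and the effect of one correction\<close>

text \<open>Component \<open>j\<close> of the network field for \<open>sigma_tilde \<sigma>\<close>
  is \<open>g (A_map \<sigma> j X)\<close>, so the sum over partial derivatives is the total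
  derivative applied to that field.\<close>

lemma Sigma_bracket_eq:
  fixes f g :: "'v::euclidean_space ^ 'n::finite \<Rightarrow> 'v"
  assumes "smooth f" "smooth g"
  shows "Sigma_bracket \<sigma> f g X = frechet_derivative f (at X) (network_field (sigma_tilde \<sigma>) g X)
    - frechet_derivative g (at X) (network_field (sigma_tilde \<sigma>) f X)"
proof -
  have pd: "partial_derivative h j X v = frechet_derivative h (at X) (axis j v)" if h: "smooth h" for h :: "'v ^ 'n \<Rightarrow> 'v" and j v
  proof -
    let ?e = "\<lambda>y. \<chi> k. if k = j then y else X $ k"
    have eX: "?e (X $ j) = X" by (simp add: vec_eq_iff)
    have ax: "bounded_linear (axis j :: 'v \<Rightarrow> 'v ^ 'n)"
      by (intro linear_conv_bounded_linear[THEN iffD1] linearI) (auto simp: vec_eq_iff axis_def)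
    have eq: "?e = (\<lambda>y. axis j y + (X - axis j (X $ j)))" by (auto simp: fun_eq_iff vec_eq_iff axis_def)
    have "(?e has_derivative axis j) (at (X $ j))"
      unfolding eq using bounded_linear_imp_has_derivative[OF ax] by (auto intro!: derivative_eq_intros)
    from has_derivative_compose[OF this smooth_has_derivative[OF h]]
    have "((\<lambda>y. h (?e y)) has_derivative (\<lambda>v. frechet_derivative h (at X) (axis j v))) (at (X $ j))"
      unfolding eX .
    from fun_cong[OF frechet_derivative_at[OF this], of v] show ?thesis by (simp add: partial_derivative_def)
  qed
  have sum: "(\<Sum>j\<in>UNIV. frechet_derivative h (at X) (axis j (k (A_map \<sigma> j X)))) =
      frechet_derivative h (at X) (network_field (sigma_tilde \<sigma>) k X)" if "smooth h" for h k :: "'v ^ 'n \<Rightarrow> 'v"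
  proof -
    have "network_field (sigma_tilde \<sigma>) k X = (\<Sum>j\<in>UNIV. axis j (k (A_map \<sigma> j X)))"
      by (simp add: vec_eq_iff network_field_def axis_def A_map_def)
    then show ?thesis by (simp add: linear_sum[OF smooth_deriv_linear[OF that]])
  qed
  show ?thesis
    unfolding Sigma_bracket_def pd[OF assms(1)] pd[OF assms(2)] sum_subtractf sum[OF assms(1)] sum[OF assms(2)] ..
qed

text \<open>Both sides evaluate \<open>f\<close> on the entries
  \<open>x $ \<sigma> k (\<sigma> j i)\<close>: closure under composition turns inputs of inputs
  into inputs of cell \<open>i\<close>.\<close>

lemma network_field_intertwine:
  fixes \<sigma> :: "'n::finite \<Rightarrow> 'c::finite \<Rightarrow> 'c"
  assumes "map_semigroup \<sigma>"
  shows "(\<chi> j. network_field \<sigma> f x $ \<sigma> j i) = network_field (sigma_tilde \<sigma>) f (\<chi> j. x $ \<sigma> j i)"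
proof -
  have "\<sigma> (sigma_tilde \<sigma> j k) = \<sigma> j \<circ> \<sigma> k" for j k
  proof -
    have "\<exists>!l. \<sigma> l = \<sigma> j \<circ> \<sigma> k" using assms unfolding map_semigroup_def by metis
    then show ?thesis unfolding sigma_tilde_def by (rule theI')
  qed
  then show ?thesis by (simp add: vec_eq_iff network_field_def)
qed

text \<open>The leading term \<open>q\<close> is \<open>-[f\<^sub>0, p]\<^sub>\<Sigma>\<close>, see \<open>Sigma_bracket_eq\<close>.\<close>

lemma normal_form_step_vanishes:
  fixes f p g fbar fbar' :: "'v::euclidean_space ^ 'n::finite \<Rightarrow> 'v" and \<tau> :: "'n \<Rightarrow> 'n \<Rightarrow> 'n"
  defines "\<Gamma> \<equiv> network_field \<tau>" and "D \<equiv> \<lambda>(h :: 'v ^ 'n \<Rightarrow> 'v) X. frechet_derivative h (at X)"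
  assumes f: "smooth f" "f 0 = 0" and p: "vhom_poly (Suc k) p" and k: "1 \<le> k"
    and w: "smooth w" "vanishes (k + 2) (\<lambda>X. w X - p X)"
      "\<exists>C\<ge>0. \<exists>\<epsilon>>0. \<forall>X v. norm X < \<epsilon> \<longrightarrow> norm (D w X v - D p X v) \<le> C * norm X ^ (k + 1) * norm v"
    and g: "smooth g" "vanishes 2 g"
    and lip: "\<And>X Y. norm (\<Gamma> g X - \<Gamma> g Y) \<le> norm (X - Y) / 2"
      "\<And>X Y. norm (\<Gamma> (\<lambda>X. g X + w X) X - \<Gamma> (\<lambda>X. g X + w X) Y) \<le> norm (X - Y) / 2"
    and fbar: "smooth fbar" "\<And>X. fbar (X + \<Gamma> g X) = f X + D g X (\<Gamma> f X)" "D fbar 0 = D f 0"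
    and fbar': "\<And>X. fbar' (X + \<Gamma> (\<lambda>X. g X + w X) X) = f X + D (\<lambda>X. g X + w X) X (\<Gamma> f X)"
    and q: "\<And>X. q X = D p X (\<Gamma> (D f 0) X) - D f 0 (\<Gamma> p X)" "vhom_poly (Suc k) q"
  shows "vanishes (k + 2) (\<lambda>X. fbar' X - fbar X - q X)"
proof -
  let ?g' = "\<lambda>X. g X + w X"
  have lin: "linear (D h X)" if "smooth h" for h X unfolding D_def using that by (rule smooth_deriv_linear)
  have ps: "smooth p" using p by (rule vhom_poly_smooth)
  have vp: "vanishes (Suc k) p" using p by (rule vanishes_vhom_poly)
  have "vanishes (Suc k) (\<lambda>X. (w X - p X) + p X)"
    using w(2) vp by (intro vanishes_add) (auto elim: vanishes_mono)
  then have vw: "vanishes (Suc k) w" by simp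
  have "vanishes 2 w" using k by (intro vanishes_mono[OF vw]) auto
  then have vg': "vanishes 2 ?g'" using g(2) by (intro vanishes_add)
  have zero: "h 0 = 0" if "vanishes (Suc m) h" for m and h :: "'v ^ 'n \<Rightarrow> 'v"
    using vanishesE[OF that, of "h 0 = 0"] by (metis norm_le_zero_iff norm_zero mult_zero_right power_0_Suc)
  have G0: "\<Gamma> g 0 = 0" "\<Gamma> ?g' 0 = 0"
    unfolding \<Gamma>_def using zero[of 1] g(2) vg' by (auto intro!: network_field_at_0 simp: numeral_2_eq_2)
  have Gle: "norm (\<Gamma> g X) \<le> norm X" "norm (\<Gamma> ?g' X) \<le> norm X" for X
  proof -
    have "norm (\<Gamma> g X) \<le> norm X / 2" "norm (\<Gamma> ?g' X) \<le> norm X / 2"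
      using lip(1)[of X 0] lip(2)[of X 0] unfolding G0 diff_zero .
    then show "norm (\<Gamma> g X) \<le> norm X" "norm (\<Gamma> ?g' X) \<le> norm X"
      using norm_ge_zero[of X] by linarith+
  qed
  have vG: "vanishes m (\<Gamma> h)" if "vanishes m h" for m h
    unfolding \<Gamma>_def using that by (rule vanishes_network_field)
  have Gadd: "\<Gamma> ?g' X = \<Gamma> g X + \<Gamma> w X" for X unfolding \<Gamma>_def by (rule network_field_add)

  \<comment> \<open>The two functional equations are compared at \<open>X + \<Gamma> ?g' X\<close>.
    Five errors arise: replacing \<open>D w\<close> by \<open>D p\<close>, replacing
    \<open>f\<close> by its linear part, linearising the increment of \<open>fbar\<close>, replacing
    \<open>w\<close> by \<open>p\<close> inside \<open>D f 0\<close>, and shifting the argument of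
    \<open>q\<close>.\<close>
  have e1: "vanishes (k + 2) (\<lambda>X. D w X (\<Gamma> f X) - D p X (\<Gamma> f X))"
  proof -
    obtain C \<epsilon> where C: "C \<ge> 0" "\<epsilon> > 0" "\<And>X v. norm X < \<epsilon> \<Longrightarrow> norm (D w X v - D p X v) \<le> C * norm X ^ (k + 1) * norm v"
      using w(3) by blast
    have "vanishes ((k + 1) + 1) (\<lambda>X. D w X (\<Gamma> f X) - D p X (\<Gamma> f X))"
    proof (rule vanishes_bilinear_bound[OF _ _ C(1,2)])
      show "vanishes (k + 1) (\<lambda>X :: 'v ^ 'n. norm X ^ (k + 1))" by (rule vanishesI[of 1 1]) auto
      show "vanishes 1 (\<Gamma> f)" by (rule vG) (intro vanishes_smooth f)
    qed (use C(3) in auto)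
    then show ?thesis by simp
  qed
  have e2: "vanishes (k + 2) (\<lambda>X. D p X (\<Gamma> f X) - D p X (\<Gamma> (D f 0) X))"
  proof -
    obtain Q where Q0: "Q \<ge> 0" "\<And>X v. norm (frechet_derivative p (at X) v) \<le> Q * norm X ^ k * norm v"
      by (rule vhom_poly_deriv_bounds[OF p]) (rule that, assumption+)
    have Q: "Q \<ge> 0" "\<And>X v. norm (D p X v) \<le> Q * norm X ^ k * norm v" using Q0 unfolding D_def .
    show ?thesis
    proof (rule vanishes_bilinear_bound[OF _ _ Q(1) zero_less_one])
      show "vanishes k (\<lambda>X :: 'v ^ 'n. norm X ^ k)" by (rule vanishesI[of 1 1]) auto
      show "vanishes 2 (\<Gamma> (\<lambda>X. f X - D f 0 X))"
        unfolding D_def by (intro vG vanishes_smooth_remainder f)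
      show "norm (D p X (\<Gamma> f X) - D p X (\<Gamma> (D f 0) X)) \<le> Q * norm (norm X ^ k) * norm (\<Gamma> (\<lambda>X. f X - D f 0 X) X)" for X
        using Q(2)[of X "\<Gamma> (\<lambda>X. f X - D f 0 X) X"] unfolding \<Gamma>_def network_field_diff linear_diff[OF lin[OF ps]] by simp
    qed
  qed
  have e3: "vanishes (k + 2) (\<lambda>X. fbar (X + \<Gamma> ?g' X) - fbar (X + \<Gamma> g X) - D f 0 (\<Gamma> w X))"
  proof -
    obtain C where C: "C \<ge> 0" "\<And>X Y r. norm X \<le> r \<Longrightarrow> norm Y \<le> r \<Longrightarrow> r \<le> 1 \<Longrightarrow>
      norm (fbar X - fbar Y - frechet_derivative fbar (at 0) (X - Y)) \<le> C * r * norm (X - Y)"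
      by (rule smooth_deriv_near_0[OF fbar(1)]) (rule that, assumption+)
    have "vanishes (1 + Suc k) (\<lambda>X. fbar (X + \<Gamma> ?g' X) - fbar (X + \<Gamma> g X) - D f 0 (\<Gamma> w X))"
    \<comment> \<open>Both arguments of \<open>fbar\<close> have norm at most
      \<open>2 * norm X\<close>; hence the constant \<open>2 * C\<close>, and the radius
      \<open>1/2\<close> that keeps them in the unit ball.\<close>
    proof (rule vanishes_bilinear_bound[OF vanishes_id vG[OF vw], of "2 * C" "1/2"])
      fix X :: "'v ^ 'n" assume X: "norm X < 1/2"
      have "norm (fbar (X + \<Gamma> ?g' X) - fbar (X + \<Gamma> g X) - D fbar 0 ((X + \<Gamma> ?g' X) - (X + \<Gamma> g X)))
        \<le> C * (2 * norm X) * norm ((X + \<Gamma> ?g' X) - (X + \<Gamma> g X))"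
        using Gle[of X] X norm_triangle_ineq[of X "\<Gamma> ?g' X"] norm_triangle_ineq[of X "\<Gamma> g X"]
        unfolding D_def by (intro C(2)) auto
      then show "norm (fbar (X + \<Gamma> ?g' X) - fbar (X + \<Gamma> g X) - D f 0 (\<Gamma> w X)) \<le> 2 * C * norm X * norm (\<Gamma> w X)"
        by (simp add: Gadd fbar(3) mult_ac)
    qed (use C in auto)
    then show ?thesis by simp
  qed
  have e4: "vanishes (k + 2) (\<lambda>X. D f 0 (\<Gamma> w X) - D f 0 (\<Gamma> p X))"
  proof -
    have "vanishes (k + 2) (\<lambda>X. D f 0 (\<Gamma> (\<lambda>X. w X - p X) X))"
      by (intro vanishes_linear[OF linear_conv_bounded_linear[THEN iffD1, OF lin[OF f(1)]]] vG w(2))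
    then show ?thesis unfolding \<Gamma>_def network_field_diff linear_diff[OF lin[OF f(1)]] .
  qed
  have e5: "vanishes (k + 2) (\<lambda>X. q (X + \<Gamma> ?g' X) - q X)"
  proof -
    obtain Q where Q: "Q \<ge> 0" "\<And>R X Y. norm X \<le> R \<Longrightarrow> norm Y \<le> R \<Longrightarrow> norm (q X - q Y) \<le> Q * R ^ k * norm (X - Y)"
      by (rule vhom_poly_lipschitz[OF q(2), unfolded diff_Suc_1]) (rule that, assumption+)
    show ?thesis
    proof (rule vanishes_bilinear_bound[OF _ vG[OF vg'], of k "\<lambda>X. norm X ^ k" "Q * 2 ^ k" 1])
      show "vanishes k (\<lambda>X :: 'v ^ 'n. norm X ^ k)" by (rule vanishesI[of 1 1]) auto
      fix X :: "'v ^ 'n"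
      have "norm (q (X + \<Gamma> ?g' X) - q X) \<le> Q * (2 * norm X) ^ k * norm ((X + \<Gamma> ?g' X) - X)"
        using Gle[of X] norm_triangle_ineq[of X "\<Gamma> ?g' X"] by (intro Q(2)) auto
      then show "norm (q (X + \<Gamma> ?g' X) - q X) \<le> Q * 2 ^ k * norm (norm X ^ k) * norm (\<Gamma> ?g' X)"
        by (simp add: power_mult_distrib mult_ac)
    qed (use Q in auto)
  qed
  have Dadd: "D ?g' X v = D g X v + D w X v" for X v
  proof -
    have "(?g' has_derivative (\<lambda>v. D g X v + D w X v)) (at X)"
      unfolding D_def by (intro has_derivative_add smooth_has_derivative g w)
    from fun_cong[OF frechet_derivative_at[OF this], of v] show ?thesis by (simp add: D_def)
  qed
  let ?d = "\<lambda>Y. fbar' Y - fbar Y - q Y"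
  have "vanishes (k + 2) (\<lambda>X. (D w X (\<Gamma> f X) - D p X (\<Gamma> f X)) + (D p X (\<Gamma> f X) - D p X (\<Gamma> (D f 0) X))
     - (fbar (X + \<Gamma> ?g' X) - fbar (X + \<Gamma> g X) - D f 0 (\<Gamma> w X)) - (D f 0 (\<Gamma> w X) - D f 0 (\<Gamma> p X))
     - (q (X + \<Gamma> ?g' X) - q X))"
    by (intro vanishes_diff vanishes_add e1 e2 e3 e4 e5)
  also have "(\<lambda>X. (D w X (\<Gamma> f X) - D p X (\<Gamma> f X)) + (D p X (\<Gamma> f X) - D p X (\<Gamma> (D f 0) X))
     - (fbar (X + \<Gamma> ?g' X) - fbar (X + \<Gamma> g X) - D f 0 (\<Gamma> w X)) - (D f 0 (\<Gamma> w X) - D f 0 (\<Gamma> p X))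
     - (q (X + \<Gamma> ?g' X) - q X)) = (\<lambda>X. ?d (X + \<Gamma> ?g' X))"
    unfolding fbar' fbar(2) q(1)[of X for X] Dadd by (simp add: algebra_simps)
  finally have conj: "vanishes (k + 2) (\<lambda>X. ?d (X + \<Gamma> ?g' X))" .
  \<comment> \<open>So far the estimate is known at \<open>X + \<Gamma> ?g' X\<close>; substituting
    the inverse, which is \<open>O(norm Y)\<close>, transfers it to an arbitrary point
    \<open>Y\<close>.\<close>
  obtain H where H: "\<And>Y. H Y + \<Gamma> ?g' (H Y) = Y"
    by (rule perturbed_identity_bij[OF lip(2)]) (rule that, assumption)
  have "vanishes 1 H"
  proof (rule vanishesI[of 2 1])
    fix Y
    have "norm (H Y) \<le> norm (H Y + \<Gamma> ?g' (H Y)) + norm (\<Gamma> ?g' (H Y))"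
      using norm_triangle_ineq4[of "H Y + \<Gamma> ?g' (H Y)" "\<Gamma> ?g' (H Y)"] by simp
    also have "norm (\<Gamma> ?g' (H Y)) \<le> norm (H Y) / 2" using lip(2)[of "H Y" 0] unfolding G0(2) diff_zero .
    finally show "norm (H Y) \<le> 2 * norm Y ^ 1" unfolding H by simp
  qed auto
  from vanishes_compose[OF conj this] show ?thesis unfolding H .
qed

subsection \<open>The normal form\<close>

text \<open>Of the two Lipschitz conditions, the one for \<open>\<sigma>\<close> serves to invert
  the conjugacy on the cells and the one for \<open>sigma_tilde \<sigma>\<close> to solve the
  functional equation for \<open>fbar\<close>. Order 2 of \<open>g\<close> makes the change of
  variables tangent to the identity, and \<open>k\<close> counts the terms already
  normalised.\<close>

definition partial_normal_form ::
    "('n::finite \<Rightarrow> 'c::finite \<Rightarrow> 'c) \<Rightarrow> ('v::euclidean_space ^ 'n \<Rightarrow> 'v) \<Rightarrow> (nat \<Rightarrow> ('v ^ 'n \<Rightarrow> 'v) set)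
      \<Rightarrow> nat \<Rightarrow> real \<Rightarrow> ('v ^ 'n \<Rightarrow> 'v) \<Rightarrow> ('v ^ 'n \<Rightarrow> 'v) \<Rightarrow> bool"
  where "partial_normal_form \<sigma> f Nsp k L g fbar \<longleftrightarrow>
    0 \<le> L \<and> smooth g \<and> vanishes 2 g \<and> net_lipschitz \<sigma> L g \<and> net_lipschitz (sigma_tilde \<sigma>) L g \<and>
    smooth fbar \<and> fbar 0 = 0 \<and> taylor_term 0 fbar = taylor_term 0 f \<and>
    (\<forall>X. fbar (X + network_field (sigma_tilde \<sigma>) g X) =
       f X + frechet_derivative g (at X) (network_field (sigma_tilde \<sigma>) f X)) \<and>
    (\<forall>j. 1 \<le> j \<and> j \<le> k \<longrightarrow> taylor_term j fbar \<in> Nsp j)"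

lemma partial_normal_form_0:
  fixes \<sigma> :: "'n::finite \<Rightarrow> 'c::finite \<Rightarrow> 'c" and f :: "'v::euclidean_space ^ 'n \<Rightarrow> 'v"
  assumes "smooth f" "f 0 = 0"
  shows "partial_normal_form \<sigma> f Nsp 0 0 (\<lambda>X. 0) f"
proof -
  have "frechet_derivative (\<lambda>X. 0 :: 'v) (at X) v = 0" for X v :: "'v ^ 'n"
    using fun_cong[OF frechet_derivative_at[OF has_derivative_const[of 0 "at X"]], of v] by simp
  moreover have "vanishes 2 (\<lambda>X :: 'v ^ 'n. 0 :: 'v)" by (rule vanishesI[of 0 1]) auto
  ultimately show ?thesis
    using assms net_lipschitz_zero[of \<sigma>] net_lipschitz_zero[of "sigma_tilde \<sigma>"]
    by (simp add: partial_normal_form_def smooth_const network_field_def zero_vec_def[symmetric])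
qed

text \<open>Splitting the next Taylor term as \<open>a\<close> in the complement plus a bracket with
  some \<open>p\<close> dictates the correction: adding the truncation of \<open>p\<close> to
  \<open>g\<close> subtracts exactly that bracket and leaves \<open>a\<close>.\<close>

lemma partial_normal_form_Suc:
  fixes \<sigma> :: "'n::finite \<Rightarrow> 'c::finite \<Rightarrow> 'c" and f :: "'v::euclidean_space ^ 'n \<Rightarrow> 'v"
  assumes f: "smooth f" "f 0 = 0" and pnf: "partial_normal_form \<sigma> f Nsp k L g fbar"
    and L: "L < \<Lambda>" "real (DIM('v ^ 'n)) * \<Lambda> \<le> 1/2"
    and N: "subspace (Nsp (Suc k))"
    and sum: "is_direct_sum (Nsp (Suc k)) (ad_Sigma \<sigma> (taylor_term 0 f) ` homogeneous_polys (Suc k)) (homogeneous_polys (Suc k))"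
  shows "\<exists>L' g' fbar'. L' < \<Lambda> \<and> partial_normal_form \<sigma> f Nsp (Suc k) L' g' fbar'"
proof -
  let ?\<Gamma> = "network_field (sigma_tilde \<sigma>) :: ('v ^ 'n \<Rightarrow> 'v) \<Rightarrow> 'v ^ 'n \<Rightarrow> 'v ^ 'n"
  let ?D = "\<lambda>(h :: 'v ^ 'n \<Rightarrow> 'v) X. frechet_derivative h (at X)"
  note pnf = pnf[unfolded partial_normal_form_def]
  have g: "0 \<le> L" "smooth g" "vanishes 2 g" "net_lipschitz \<sigma> L g" "net_lipschitz (sigma_tilde \<sigma>) L g"
    and fbar: "smooth fbar" "fbar 0 = 0" "taylor_term 0 fbar = taylor_term 0 f"
      "\<And>X. fbar (X + ?\<Gamma> g X) = f X + ?D g X (?\<Gamma> f X)"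
      "\<And>j. 1 \<le> j \<Longrightarrow> j \<le> k \<Longrightarrow> taylor_term j fbar \<in> Nsp j"
    using pnf by blast+
  define f0 where "f0 = ?D f 0"
  have f0: "taylor_term 0 f = f0" by (simp add: f0_def taylor_term_0)
  have lin0: "linear f0" unfolding f0_def using f(1) by (rule smooth_deriv_linear)
  then have bl0: "bounded_linear f0" by (simp add: linear_conv_bounded_linear)
  have D0: "?D f0 X = f0" for X
    using frechet_derivative_at[OF bounded_linear_imp_has_derivative[OF bl0]] by simp
  have "taylor_term (Suc k) fbar \<in> {a + b | a b. a \<in> Nsp (Suc k) \<and> b \<in> Sigma_bracket \<sigma> f0 ` homogeneous_polys (Suc k)}"
    using sum taylor_term_homogeneous[OF fbar(1), of "Suc k"] unfolding is_direct_sum_def f0 by simp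
  then obtain a p where a: "a \<in> Nsp (Suc k)" and p: "p \<in> homogeneous_polys (Suc k)"
    and dec: "taylor_term (Suc k) fbar = a + Sigma_bracket \<sigma> f0 p" by blast
  \<comment> \<open>That the bracket of \<open>p\<close> is again homogeneous of the same degree is
    read off from the direct sum, as 0 plus an element of the image.\<close>
  have "0 + Sigma_bracket \<sigma> f0 p \<in> {a + b | a b. a \<in> Nsp (Suc k) \<and> b \<in> Sigma_bracket \<sigma> f0 ` homogeneous_polys (Suc k)}"
    using p subspace_0[OF N] by blast
  then have "Sigma_bracket \<sigma> f0 p \<in> homogeneous_polys (Suc k)"
    using sum unfolding is_direct_sum_def f0 by simp
  then have br: "vhom_poly (Suc (Suc k)) (Sigma_bracket \<sigma> f0 p)" by (simp add: homogeneous_polys_iff)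
  have pv: "vhom_poly (Suc (Suc k)) p" using p by (simp add: homogeneous_polys_iff)
  note ps = vhom_poly_smooth[OF pv]
  define q where "q = (\<lambda>X. - Sigma_bracket \<sigma> f0 p X)"
  have qv: "vhom_poly (Suc (Suc k)) q"
    unfolding vhom_poly_def q_def
  proof
    fix b :: 'v assume "b \<in> Basis"
    with br have "hom_poly (Suc (Suc k)) (\<lambda>X. Sigma_bracket \<sigma> f0 p X \<bullet> b)" by (simp only: vhom_poly_def)
    from hom_poly_cmult[OF this, of "-1"] show "hom_poly (Suc (Suc k)) (\<lambda>X. - Sigma_bracket \<sigma> f0 p X \<bullet> b)" by simp
  qed
  have q: "q X = ?D p X (?\<Gamma> (?D f 0) X) - ?D f 0 (?\<Gamma> p X)" for X
    unfolding q_def Sigma_bracket_eq[OF smooth_bounded_linear[OF bl0] ps] D0 by (simp add: f0_def)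

  \<comment> \<open>Half of the remaining gap, so that the new constant
    \<open>L + \<epsilon>\<close> is still strictly below \<open>\<Lambda>\<close>.\<close>
  define \<epsilon> where "\<epsilon> = (\<Lambda> - L) / 2"
  have \<epsilon>: "0 < \<epsilon>" "L + \<epsilon> < \<Lambda>" using L(1) by (simp_all add: \<epsilon>_def field_simps)
  have k1: "1 \<le> Suc k" by simp
  obtain d1 where d1: "0 < d1" "\<And>\<delta>. 0 < \<delta> \<Longrightarrow> \<delta> \<le> d1 \<Longrightarrow> net_lipschitz \<sigma> \<epsilon> (\<lambda>X. p (sine_map \<delta> X))"
    by (rule net_lipschitz_sine_map[OF pv k1 \<epsilon>(1)]) (rule that, assumption+)
  obtain d2 where d2: "0 < d2" "\<And>\<delta>. 0 < \<delta> \<Longrightarrow> \<delta> \<le> d2 \<Longrightarrow> net_lipschitz (sigma_tilde \<sigma>) \<epsilon> (\<lambda>X. p (sine_map \<delta> X))"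
    by (rule net_lipschitz_sine_map[OF pv k1 \<epsilon>(1)]) (rule that, assumption+)
  define \<delta> where "\<delta> = min d1 d2"
  have \<delta>: "0 < \<delta>" "\<delta> \<le> d1" "\<delta> \<le> d2" using d1(1) d2(1) by (auto simp: \<delta>_def)
  define w where "w = (\<lambda>X. p (sine_map \<delta> X))"
  have w: "smooth w" unfolding w_def by (rule smooth_compose[OF ps smooth_sine_map])
  have wapp: "vanishes (Suc k + 2) (\<lambda>X. w X - p X)" "\<exists>C\<ge>0. \<exists>\<epsilon>>0. \<forall>X v. norm X < \<epsilon> \<longrightarrow>
      norm (?D w X v - ?D p X v) \<le> C * norm X ^ (Suc k + 1) * norm v"
    unfolding w_def by (rule sine_map_approximation[OF pv k1 \<delta>(1)])+
  define g' where "g' = (\<lambda>X. g X + w X)"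
  have g': "smooth g'" unfolding g'_def by (intro smooth_add g w)
  have lip': "net_lipschitz \<sigma> (L + \<epsilon>) g'" "net_lipschitz (sigma_tilde \<sigma>) (L + \<epsilon>) g'"
    unfolding g'_def w_def
    by (rule net_lipschitz_add[OF g(4) d1(2)[OF \<delta>(1,2)]], rule net_lipschitz_add[OF g(5) d2(2)[OF \<delta>(1,3)]])
  have vg': "vanishes 2 g'"
  proof -
    have "vanishes (Suc (Suc k)) (\<lambda>X. (w X - p X) + p X)"
      by (rule vanishes_add[OF vanishes_mono[OF wapp(1)] vanishes_vhom_poly[OF pv]]) simp
    then have "vanishes 2 (\<lambda>X. (w X - p X) + p X)" by (rule vanishes_mono) simp
    then show ?thesis unfolding g'_def using g(3) by (simp add: vanishes_add)
  qed
  have "real (DIM('v ^ 'n)) * L' \<le> 1/2" if "L' \<le> \<Lambda>" for L'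
    using mult_left_mono[OF that, of "real (DIM('v ^ 'n))"] L(2) by linarith
  then have con: "norm (?\<Gamma> g X - ?\<Gamma> g Y) \<le> norm (X - Y) / 2" "norm (?\<Gamma> g' X - ?\<Gamma> g' Y) \<le> norm (X - Y) / 2" for X Y
    using net_lipschitz_contraction[OF g(2,5), of X Y] net_lipschitz_contraction[OF g' lip'(2), of X Y] L(1) \<epsilon>(2) by simp_all
  obtain H where H: "\<And>Y. H Y + ?\<Gamma> g' (H Y) = Y" "\<And>X. H (X + ?\<Gamma> g' X) = X"
    by (rule perturbed_identity_bij[OF con(2)]) (rule that, assumption+)
  have Hs: "smooth H"
    by (rule smooth_inverse_perturbed_identity[OF smooth_network_field[OF g'] con(2) H(1)])
  define F where "F = (\<lambda>X. f X + ?D g' X (?\<Gamma> f X))"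
  have Fs: "smooth F" unfolding F_def by (intro smooth_add f smooth_deriv_apply g' smooth_network_field)
  \<comment> \<open>Composing with the global inverse makes the functional equation hold at every
    \<open>X\<close> by construction.\<close>
  define fbar' where "fbar' = (\<lambda>Y. F (H Y))"
  have fbar's: "smooth fbar'" unfolding fbar'_def by (rule smooth_compose[OF Fs Hs])
  have fbar'_conj: "fbar' (X + ?\<Gamma> g' X) = f X + ?D g' X (?\<Gamma> f X)" for X
    by (simp add: fbar'_def H(2) F_def)
  have Dfb: "?D fbar 0 = ?D f 0" using fbar(3) by (simp only: taylor_term_0)
  \<comment> \<open>By the shift in \<open>P^k\<close>, the terms \<open>p\<close> and
    \<open>q\<close> have degree \<open>k + 2\<close>. The error begins in degree
    \<open>k + 3\<close>, so the Taylor term with index \<open>Suc k\<close> changes exactly by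
    \<open>q\<close> and those before it do not change.\<close>
  have "vanishes (Suc k + 2) (\<lambda>X. fbar' X - fbar X - q X)"
    by (rule normal_form_step_vanishes[OF f pv k1 w wapp g(2,3) con(1) con(2)[unfolded g'_def] fbar(1,4) Dfb
          fbar'_conj[unfolded g'_def] q qv])
  then have d: "vanishes (Suc k + 2) (\<lambda>X. (fbar' X - fbar X) - q X)" .
  have ds: "smooth (\<lambda>X. fbar' X - fbar X)" by (intro smooth_diff fbar's fbar)
  note tt = taylor_term_of_leading_polynomial[OF ds qv d]
  have split: "taylor_term j fbar' X = taylor_term j fbar X + taylor_term j (\<lambda>X. fbar' X - fbar X) X" for j X
    using taylor_term_add[OF fbar(1) ds, of j] by (simp add: fun_eq_iff)
  have low: "taylor_term j fbar' = taylor_term j fbar" if "j \<le> k" for j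
    using split[of j] tt(2)[of j] that by (simp add: fun_eq_iff)
  have top: "taylor_term (Suc k) fbar' = a"
    using split[of "Suc k"] tt(3) dec by (simp add: fun_eq_iff q_def)
  have "partial_normal_form \<sigma> f Nsp (Suc k) (L + \<epsilon>) g' fbar'"
    unfolding partial_normal_form_def
    using g(1) \<epsilon>(1) g' vg' lip' fbar's tt(1) fbar(2,3,5) low top a fbar'_conj by (auto simp: le_Suc_eq)
  then show ?thesis using \<epsilon>(2) by blast
qed

text \<open>The induction starts with \<open>g = 0\<close> and \<open>L = 0\<close>. The strict
  inequality \<open>L < \<Lambda>\<close> is carried along because every further degree needs room
  for a correction.\<close>

lemma partial_normal_form_exists:
  fixes \<sigma> :: "'n::finite \<Rightarrow> 'c::finite \<Rightarrow> 'c" and f :: "'v::euclidean_space ^ 'n \<Rightarrow> 'v"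
  assumes f: "smooth f" "f 0 = 0" and \<Lambda>: "0 < \<Lambda>" "real (DIM('v ^ 'n)) * \<Lambda> \<le> 1/2"
    and N: "\<And>k. 1 \<le> k \<Longrightarrow> k \<le> r \<Longrightarrow> subspace (Nsp k)"
      "\<And>k. 1 \<le> k \<Longrightarrow> k \<le> r \<Longrightarrow> is_direct_sum (Nsp k) (ad_Sigma \<sigma> (taylor_term 0 f) ` homogeneous_polys k) (homogeneous_polys k)"
  shows "\<exists>L g fbar. L < \<Lambda> \<and> partial_normal_form \<sigma> f Nsp r L g fbar"
proof -
  have "\<exists>L g fbar. L < \<Lambda> \<and> partial_normal_form \<sigma> f Nsp k L g fbar" if "k \<le> r" for k
    using that
  proof (induction k)
    case 0
    then show ?case using partial_normal_form_0[OF f] \<Lambda>(1) by blast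
  next
    case (Suc k)
    then obtain L g fbar where "L < \<Lambda>" "partial_normal_form \<sigma> f Nsp k L g fbar" by auto
    with partial_normal_form_Suc[OF f, of \<sigma> Nsp k L g fbar \<Lambda>] \<Lambda>(2) N[of "Suc k"] Suc.prems show ?case by simp
  qed
  then show ?thesis by simp
qed

text \<open>Component \<open>i\<close> sees \<open>x\<close> only through the inputs of cell
  \<open>i\<close>. By the intertwining property the claim for that component is the functional
  equation for \<open>fbar\<close> at this input vector.\<close>

lemma pushforward_network_field:
  fixes \<sigma> :: "'n::finite \<Rightarrow> 'c::finite \<Rightarrow> 'c" and f g fbar :: "'v::euclidean_space ^ 'n \<Rightarrow> 'v"
  assumes \<sigma>: "map_semigroup \<sigma>" and g: "smooth g" and inj: "inj (\<lambda>x. x + network_field \<sigma> g x)"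
    and fbar: "\<And>X. fbar (X + network_field (sigma_tilde \<sigma>) g X) =
       f X + frechet_derivative g (at X) (network_field (sigma_tilde \<sigma>) f X)"
    and y: "y = x + network_field \<sigma> g x"
  shows "pushforward (\<lambda>x. x + network_field \<sigma> g x) UNIV (network_field \<sigma> f) y = network_field \<sigma> fbar y"
proof -
  let ?\<Phi> = "\<lambda>x. x + network_field \<sigma> g x"
  let ?\<pi> = "\<lambda>i (x :: 'v ^ 'c). \<chi> j. x $ \<sigma> j i"
  have inv: "inv_into UNIV ?\<Phi> y = x" unfolding y using inv_f_f[OF inj] .
  have "(?\<Phi> has_derivative (\<lambda>v. v + frechet_derivative (network_field \<sigma> g) (at x) v)) (at x)"
    by (intro has_derivative_add has_derivative_ident smooth_has_derivative smooth_network_field g)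
  from frechet_derivative_at[OF this]
  have push: "pushforward ?\<Phi> UNIV (network_field \<sigma> f) y =
      network_field \<sigma> f x + frechet_derivative (network_field \<sigma> g) (at x) (network_field \<sigma> f x)"
    unfolding pushforward_def inv by metis
  have "(network_field \<sigma> f x + frechet_derivative (network_field \<sigma> g) (at x) (network_field \<sigma> f x)) $ i =
      network_field \<sigma> fbar y $ i" for i
  proof -
    have "network_field \<sigma> f x $ i = f (?\<pi> i x)" by (simp add: network_field_def)
    moreover have "frechet_derivative (network_field \<sigma> g) (at x) (network_field \<sigma> f x) $ i =
        frechet_derivative g (at (?\<pi> i x)) (network_field (sigma_tilde \<sigma>) f (?\<pi> i x))"
      unfolding network_field_deriv[OF g] network_field_intertwine[OF \<sigma>] ..
    moreover have "?\<pi> i y = ?\<pi> i x + network_field (sigma_tilde \<sigma>) g (?\<pi> i x)"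
      unfolding network_field_intertwine[OF \<sigma>, symmetric] y by (simp add: vec_eq_iff)
    moreover have "network_field \<sigma> fbar y $ i = fbar (?\<pi> i y)" by (simp add: network_field_def)
    ultimately show ?thesis using fbar[of "?\<pi> i x"] by simp
  qed
  then show ?thesis unfolding push vec_eq_iff by blast
qed

theorem theorem6p1:
  fixes \<sigma> :: "'n::finite \<Rightarrow> 'c::finite \<Rightarrow> 'c"
    and f :: "'v::euclidean_space ^ 'n \<Rightarrow> 'v"
    and r :: nat
    and Nsp :: "nat \<Rightarrow> ('v ^ 'n \<Rightarrow> 'v) set"
  assumes "map_semigroup \<sigma>"
    and "smooth f"
    and "f 0 = 0"
    and "1 \<le> r"
    and "\<And>k. 1 \<le> k \<Longrightarrow> k \<le> r \<Longrightarrow> subspace (Nsp k) \<and> Nsp k \<subseteq> homogeneous_polys k"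
    and "\<And>k. 1 \<le> k \<Longrightarrow> k \<le> r \<Longrightarrow>
           is_direct_sum (Nsp k) (ad_Sigma \<sigma> (taylor_term 0 f) ` homogeneous_polys k)
             (homogeneous_polys k)"
  shows "\<exists>(\<Phi> :: 'v ^ 'c \<Rightarrow> 'v ^ 'c) U W (fbar :: 'v ^ 'n \<Rightarrow> 'v).
           0 \<in> U \<and> 0 \<in> W \<and> analytic_diffeomorphism \<Phi> U W \<and>
           smooth fbar \<and>
           (\<forall>y\<in>W. pushforward \<Phi> U (network_field \<sigma> f) y = network_field \<sigma> fbar y) \<and>
           fbar 0 = 0 \<and> taylor_term 0 fbar = taylor_term 0 f \<and>
           (\<forall>k. 1 \<le> k \<and> k \<le> r \<longrightarrow> taylor_term k fbar \<in> Nsp k)"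
proof -
  let ?d = "real (DIM('v ^ 'n))" and ?e = "real (DIM('v ^ 'c))"
  \<comment> \<open>With twice the sum of both dimensions in the denominator, the contraction
    criterion holds on both spaces. As dimensions are at least 1, the bound \<open>1/2\<close>
    needed for inverting power series follows as well.\<close>
  define \<Lambda> where "\<Lambda> = 1 / (2 * (?d + ?e))"
  have de: "1 \<le> ?d" "1 \<le> ?e" using DIM_positive[where 'a = "'v ^ 'n"] DIM_positive[where 'a = "'v ^ 'c"] by linarith+
  then have \<Lambda>: "0 < \<Lambda>" "?d * \<Lambda> \<le> 1/2" "?e * \<Lambda> \<le> 1/2" "\<Lambda> \<le> 1/2"
    by (auto simp: \<Lambda>_def field_simps)
  have "\<exists>L g fbar. L < \<Lambda> \<and> partial_normal_form \<sigma> f Nsp r L g fbar"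
    by (rule partial_normal_form_exists[OF assms(2,3) \<Lambda>(1,2)]) (use assms(5,6) in auto)
  then obtain L g fbar where L: "L < \<Lambda>" and pnf: "partial_normal_form \<sigma> f Nsp r L g fbar" by blast
  note pnf = pnf[unfolded partial_normal_form_def]
  let ?G = "network_field \<sigma> g"
  let ?\<Phi> = "\<lambda>x. x + ?G x"
  have g: "0 \<le> L" "smooth g" "net_lipschitz \<sigma> L g" using pnf by blast+
  have "?e * L \<le> 1/2" using mult_left_mono[of L \<Lambda> ?e] L \<Lambda>(3) by linarith
  then have lip: "norm (?G x - ?G y) \<le> norm (x - y) / 2" for x y by (rule net_lipschitz_contraction[OF g(2,3)])
  obtain H where H: "\<And>y. H y + ?G (H y) = y" "\<And>x. H (x + ?G x) = x"
    by (rule perturbed_identity_bij[OF lip]) (rule that, assumption+)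
  have inj: "inj ?\<Phi>" by (rule inj_on_inverseI[of _ H]) (rule H(2))
  have surj: "surj ?\<Phi>" by (rule surjI[of _ H]) (rule H(1))
  have inv: "inv_into UNIV ?\<Phi> = H" by (rule inv_equality) (use H in auto)
  have ma: "\<exists>M. ma_lipschitz a M L (\<lambda>x. ?G x \<bullet> B)" if "B \<in> Basis" for a B
    using g(3) that unfolding net_lipschitz_def by blast
  \<comment> \<open>The contraction estimate holds on the whole space, so both neighbourhoods can be
    taken to be everything.\<close>
  have "analytic_diffeomorphism ?\<Phi> UNIV UNIV"
    unfolding analytic_diffeomorphism_def inv
  proof (intro conjI open_UNIV)
    show "bij_betw ?\<Phi> UNIV UNIV" using inj surj by (rule bijI)
    show "real_analytic_on ?\<Phi> UNIV" by (rule real_analytic_perturbed_identity[OF ma])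
    show "real_analytic_on H UNIV"
      by (rule real_analytic_inverse_perturbed_identity[OF ma g(1) _ _ H(2,1)])
        (use L \<Lambda>(4) smooth_continuous_on[OF smooth_network_field[OF g(2)]] in auto)
  qed
  moreover have "\<forall>y\<in>UNIV. pushforward ?\<Phi> UNIV (network_field \<sigma> f) y = network_field \<sigma> fbar y"
  proof
    fix y
    show "pushforward ?\<Phi> UNIV (network_field \<sigma> f) y = network_field \<sigma> fbar y"
      by (rule pushforward_network_field[OF assms(1) g(2) inj, where x = "H y"]) (use pnf H(1) in auto)
  qed
  ultimately show ?thesis using pnf by (intro exI[of _ ?\<Phi>] exI[of _ UNIV] exI[of _ fbar]) auto
qed

end
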